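(* Let $R$ be either an integral domain in which $2$ is a unit or a field of characteristic $2$. If $(C,\Psi)$ is an Alexander-Whitney coalgebra over $R$ (with $C_1=C_2=0$) such that $\widetilde\Omega(C,\Psi)$ is primitively generated with respect to the naturally induced comultiplication $\psi$, then the underlying graded algebra of $\mathfrak L_2(C,\Psi)$ is (isomorphic to) the tensor algebra $T\big(\mathfrak A^{\mathbb N}(s^{-1}C)(s^{-1}\overline C)\big)$.
   Context: Chain (co)algebras are over $R$, with $R$-free underlying graded modules; the Koszul sign convention is used. $V_+=V_{>0}$; $s^{-1}$ is desuspension; $s^{-1}1:=0$. A chain coalgebra $C$ is coassociative, counital, coaugmented and non-negatively graded with $C_0=R$; it is simply connected if also $C_1=0$. $\Omega C=(T(s^{-1}C_+),d_\Omega)$, $d_\Omega(s^{-1}c)=-s^{-1}(dc)+\sum(-1)^{|c_i|}s^{-1}c_i\,s^{-1}c^i$, where $\overline\Delta(c)=\sum c_i\otimes c^i$ is the reduced comultiplication. The linear part of a chain algebra map $\theta:\Omega C\to\Omega C'$ is the map $\theta_1:C\to C'$ with $\theta(s^{-1}c)-s^{-1}\theta_1(c)$ of word length $\ge2$. Milgram's map $q:\Omega(C\otimes C)\to\Omega C\otimes\Omega C$ is the chain algebra map with $q(s^{-1}(c\otimes1))=s^{-1}c\otimes1$, $q(s^{-1}(1\otimes d))=1\otimes s^{-1}d$, $q(s^{-1}(c\otimes d))=0$ for $c,d\in C_+$. An Alexander-Whitney coalgebra is a pair $(C,\Psi)$ with $C$ simply connected and $\Psi:\Omega C\to\Omega(C\otimes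 C)$ a chain algebra map with linear part the comultiplication $\Delta$ of $C$, such that $\psi=q\Psi$ is coassociative; $\widetilde\Omega(C,\Psi)$ is the chain Hopf algebra $(\Omega C,\psi)$. It is primitively generated if generated as an algebra by its primitive elements. For $C$ with $C_1=C_2=0$, $\mathfrak P(C)=R\oplus C_+\oplus\overline C_+$, $\overline C_+=s^{-1}C_+$, $\bar c=s^{-1}c$, with $\tilde dc=dc-\bar c$, $\tilde d\bar c=-\overline{dc}$, comultiplication extending $\Delta$ and $\widetilde\Delta(\bar c)=(\sigma\otimes\iota+\iota\otimes\sigma)\Delta(c)$, where $\iota(c)=c$, $\sigma(c)=\bar c$, $\sigma(1)=0$; $\pi:\mathfrak P(C)\to C$ is the projection killing $\overline C_+$. Let $\iota:\Omega C\to\Omega\mathfrak P(C)$ be the (nondifferential) inclusion of algebras and $\kappa:\Omega C\to\Omega\mathfrak P(C)$ the degree $-1$ $(\iota,\iota)$-derivation with $\kappa(s^{-1}c)=-s^{-1}\bar c$. $\mathfrak{PL}(C,\Psi)$ is the chain Hopf algebra $\Omega\mathfrak P(C)$ with comultiplication the algebra map $\tilde\psi$ with $\tilde\psi(s^{-1}c)=(\iota\otimes\iota)\psi(s^{-1}c)$, $\tilde\psi(s^{-1}\bar c)=-(\kappa\otimes\iota+\iota\otimes\kappa)\psi(s^{-1}c)$. The double-loop construction is the sub chain algebra $\mathfrak L_2(C,\Psi)=\{x\in\Omega\mathfrak P(C):(1\otimes\Omega\pi)\tilde\psi(x)=x\otimes1\}$. For graded modules $V$, $W$, $\mathfrak A^{\mathbb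 N}(V)(W)$ denotes the graded submodule of the free graded Lie algebra $\mathbb L(V\oplus W)$ (inside $T(V\oplus W)$) spanned by all iterated graded commutators $[v_1,[v_2,[\dots[v_k,w]\dots]]]$ with $k\ge0$, $v_i\in V$, $w\in W$. In the statement $s^{-1}C$ and $s^{-1}\overline C$ mean $s^{-1}C_+$ and $s^{-1}\overline C_+$. *)

theory Defs
  imports Complex_Main "HOL-Library.Poly_Mapping" "HOL-Library.Product_Plus" "HOL-Algebra.QuotRing" "HOL-Algebra.Module"
begin

section \<open>Based free modules, graded linear algebra\<close>

text \<open>
  The free \<open>R\<close>-module with basis \<open>X\<close> consists of the finitely supported functions in
  \<open>'a \<Rightarrow>\<^sub>0 'r\<close> with support in \<open>X :: 'a set\<close>; a grading is a degree function on basis elements.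
  Linear maps are given by their values on the basis.
\<close>

abbreviation bas :: "'a \<Rightarrow> ('a \<Rightarrow>\<^sub>0 'r::comm_ring_1)"
  where "bas a \<equiv> Poly_Mapping.single a 1"

definition smul :: "'r::comm_ring_1 \<Rightarrow> ('a \<Rightarrow>\<^sub>0 'r) \<Rightarrow> ('a \<Rightarrow>\<^sub>0 'r)"
  where "smul r x = Poly_Mapping.map ((*) r) x"

lemma lookup_smul: "Poly_Mapping.lookup (smul r x) a = r * Poly_Mapping.lookup x a"
  by (simp add: smul_def Poly_Mapping.map.rep_eq when_def)

global_interpretation pm: Modules.module "smul :: 'r::comm_ring_1 \<Rightarrow> ('a \<Rightarrow>\<^sub>0 'r) \<Rightarrow> _"
  by unfold_locales (auto intro!: poly_mapping_eqI simp: lookup_smul lookup_add algebra_simps)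

definition supported :: "'a set \<Rightarrow> ('a \<Rightarrow>\<^sub>0 'r::comm_ring_1) set"
  where "supported X = {x. Poly_Mapping.keys x \<subseteq> X}"

definition homog :: "('a \<Rightarrow> int) \<Rightarrow> int \<Rightarrow> ('a \<Rightarrow>\<^sub>0 'r::comm_ring_1) \<Rightarrow> bool"
  where "homog dg n x \<longleftrightarrow> (\<forall>a\<in>Poly_Mapping.keys x. dg a = n)"

definition lin_ext :: "('a \<Rightarrow> ('b \<Rightarrow>\<^sub>0 'r)) \<Rightarrow> ('a \<Rightarrow>\<^sub>0 'r::comm_ring_1) \<Rightarrow> ('b \<Rightarrow>\<^sub>0 'r)"
  where "lin_ext g x = (\<Sum>a\<in>Poly_Mapping.keys x. smul (Poly_Mapping.lookup x a) (g a))"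

definition ksign :: "int \<Rightarrow> 'r::comm_ring_1"
  where "ksign n = (if even n then 1 else - 1)"

text \<open>The tensor product of the free modules on \<open>'a\<close> and \<open>'b\<close> is the free module on \<open>'a \<times> 'b\<close>.\<close>

definition tens :: "('a \<Rightarrow>\<^sub>0 'r) \<Rightarrow> ('b \<Rightarrow>\<^sub>0 'r::comm_ring_1) \<Rightarrow> ('a \<times> 'b \<Rightarrow>\<^sub>0 'r)"
  where "tens x y = lin_ext (\<lambda>a. lin_ext (\<lambda>b. bas (a, b)) y) x"

text \<open>
  \<open>tmap dg k f g\<close> is the tensor product of linear maps \<open>f\<close> and \<open>g\<close>, where \<open>g\<close> has degree \<open>k\<close>:
  \<open>(f \<otimes> g)(x \<otimes> y) = (-1)^(k |x|) f x \<otimes> g y\<close>, with \<open>dg\<close> the degree on the left source factor.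
\<close>

definition tmap :: "('a \<Rightarrow> int) \<Rightarrow> int \<Rightarrow> (('a \<Rightarrow>\<^sub>0 'r) \<Rightarrow> ('c \<Rightarrow>\<^sub>0 'r)) \<Rightarrow> (('b \<Rightarrow>\<^sub>0 'r) \<Rightarrow> ('d \<Rightarrow>\<^sub>0 'r))
    \<Rightarrow> ('a \<times> 'b \<Rightarrow>\<^sub>0 'r::comm_ring_1) \<Rightarrow> ('c \<times> 'd \<Rightarrow>\<^sub>0 'r)"
  where "tmap dg k f g = lin_ext (\<lambda>(a, b). smul (ksign (k * dg a)) (tens (f (bas a)) (g (bas b))))"

definition reassoc :: "(('a \<times> 'b) \<times> 'c \<Rightarrow>\<^sub>0 'r::comm_ring_1) \<Rightarrow> ('a \<times> ('b \<times> 'c) \<Rightarrow>\<^sub>0 'r)"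
  where "reassoc = lin_ext (\<lambda>((a, b), c). bas (a, (b, c)))"


section \<open>Tensor algebras of based free modules\<close>

text \<open>
  Words form the free monoid, written additively so that \<open>'a list \<Rightarrow>\<^sub>0 'r\<close>, with the convolution
  product of \<^theory>\<open>HOL-Library.Poly_Mapping\<close>, is the tensor algebra of the free module on \<open>'a\<close>.
\<close>

instantiation list :: (type) monoid_add
begin
definition zero_list :: "'a list" where "zero_list = []"
definition plus_list :: "'a list \<Rightarrow> 'a list \<Rightarrow> 'a list" where "plus_list u v = u @ v"
instance by standard (simp_all add: zero_list_def plus_list_def)
end

definition word_degree :: "('a \<Rightarrow> int) \<Rightarrow> 'a list \<Rightarrow> int"
  where "word_degree dg w = (\<Sum>a\<leftarrow>w. dg a)"

text \<open>
  The product of \<open>T V \<otimes> T V\<close> with the Koszul sign,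
  \<open>(u \<otimes> v)(u' \<otimes> v') = (-1)^(|v||u'|) u u' \<otimes> v v'\<close>; \<open>dg\<close> is the degree of words.
\<close>

definition tmult :: "('a list \<Rightarrow> int) \<Rightarrow> ('a list \<times> 'a list \<Rightarrow>\<^sub>0 'r) \<Rightarrow> ('a list \<times> 'a list \<Rightarrow>\<^sub>0 'r)
    \<Rightarrow> ('a list \<times> 'a list \<Rightarrow>\<^sub>0 'r::comm_ring_1)"
  where "tmult dg x y = lin_ext (\<lambda>(u, v). lin_ext (\<lambda>(u', v').
           smul (ksign (dg v * dg u')) (bas (u @ u', v @ v'))) y) x"

text \<open>The algebra map out of a tensor algebra extending \<open>g\<close> on letters, into an algebra with
  product \<open>m\<close> and unit \<open>e\<close>.\<close>

definition alg_ext :: "(('b \<Rightarrow>\<^sub>0 'r) \<Rightarrow> ('b \<Rightarrow>\<^sub>0 'r) \<Rightarrow> ('b \<Rightarrow>\<^sub>0 'r)) \<Rightarrow> ('b \<Rightarrow>\<^sub>0 'r)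
    \<Rightarrow> ('a \<Rightarrow> ('b \<Rightarrow>\<^sub>0 'r)) \<Rightarrow> ('a list \<Rightarrow>\<^sub>0 'r::comm_ring_1) \<Rightarrow> ('b \<Rightarrow>\<^sub>0 'r)"
  where "alg_ext m e g = lin_ext (\<lambda>w. foldr (\<lambda>a. m (g a)) w e)"

text \<open>
  The degree \<open>-1\<close> derivation \<open>\<delta>\<close> along the algebra map extending \<open>f\<close>, with values \<open>D\<close> on letters:
  \<open>\<delta>(x y) = \<delta>(x) f(y) + (-1)^|x| f(x) \<delta>(y)\<close>.
\<close>

primrec der_word :: "('a \<Rightarrow> int) \<Rightarrow> ('a \<Rightarrow> ('b list \<Rightarrow>\<^sub>0 'r)) \<Rightarrow> ('a \<Rightarrow> ('b list \<Rightarrow>\<^sub>0 'r))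
    \<Rightarrow> 'a list \<Rightarrow> ('b list \<Rightarrow>\<^sub>0 'r::comm_ring_1)"
  where
    "der_word dg f D [] = 0"
  | "der_word dg f D (a # w) =
       D a * alg_ext (*) 1 f (bas w) + smul (ksign (dg a)) (f a * der_word dg f D w)"

definition der_ext :: "('a \<Rightarrow> int) \<Rightarrow> ('a \<Rightarrow> ('b list \<Rightarrow>\<^sub>0 'r)) \<Rightarrow> ('a \<Rightarrow> ('b list \<Rightarrow>\<^sub>0 'r))
    \<Rightarrow> ('a list \<Rightarrow>\<^sub>0 'r::comm_ring_1) \<Rightarrow> ('b list \<Rightarrow>\<^sub>0 'r)"
  where "der_ext dg f D = lin_ext (der_word dg f D)"


section \<open>Chain coalgebras and the cobar construction\<close>

text \<open>
  A coaugmented chain coalgebra on a based free graded module. Only the values of the fields on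
  \<open>cbasis\<close> matter. The basis element \<open>cunit\<close> is \<open>1 \<in> C\<^sub>0 = R\<close>, the image of the coaugmentation, and
  the remaining basis elements span \<open>C\<^sub>+\<close>; hence the counit is the coefficient of \<open>cunit\<close>.
\<close>

record (overloaded) ('b, 'r::zero) coalg =
  cbasis :: "'b set"
  cunit :: 'b
  cdeg :: "'b \<Rightarrow> int"
  cdiff :: "'b \<Rightarrow> ('b \<Rightarrow>\<^sub>0 'r)"
  ccomult :: "'b \<Rightarrow> ('b \<times> 'b \<Rightarrow>\<^sub>0 'r)"

definition Cdiff :: "('b, 'r::comm_ring_1) coalg \<Rightarrow> ('b \<Rightarrow>\<^sub>0 'r) \<Rightarrow> ('b \<Rightarrow>\<^sub>0 'r)"
  where "Cdiff C = lin_ext (cdiff C)"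

definition Ccomult :: "('b, 'r::comm_ring_1) coalg \<Rightarrow> ('b \<Rightarrow>\<^sub>0 'r) \<Rightarrow> ('b \<times> 'b \<Rightarrow>\<^sub>0 'r)"
  where "Ccomult C = lin_ext (ccomult C)"

definition chain_coalgebra :: "('b, 'r::comm_ring_1) coalg \<Rightarrow> bool"
  where "chain_coalgebra C \<longleftrightarrow>
    cunit C \<in> cbasis C \<and>
    (\<forall>b\<in>cbasis C. 0 \<le> cdeg C b \<and> (cdeg C b = 0 \<longleftrightarrow> b = cunit C)) \<and>
    (\<forall>b\<in>cbasis C.
       cdiff C b \<in> supported (cbasis C) \<and>
       homog (cdeg C) (cdeg C b - 1) (cdiff C b) \<and>
       Cdiff C (cdiff C b) = 0) \<and>
    (\<forall>b\<in>cbasis C.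
       ccomult C b \<in> supported (cbasis C \<times> cbasis C) \<and>
       homog (\<lambda>(x, y). cdeg C x + cdeg C y) (cdeg C b) (ccomult C b) \<and>
       Ccomult C (cdiff C b) =
         tmap (cdeg C) 0 (Cdiff C) id (ccomult C b) + tmap (cdeg C) (- 1) id (Cdiff C) (ccomult C b) \<and>
       reassoc (tmap (cdeg C) 0 (Ccomult C) id (ccomult C b)) =
         tmap (cdeg C) 0 id (Ccomult C) (ccomult C b)) \<and>
    (\<forall>b\<in>cbasis C.
       Poly_Mapping.lookup (cdiff C b) (cunit C) = 0 \<and>
       lin_ext (\<lambda>(x, y). if x = cunit C then bas y else 0) (ccomult C b) = bas b \<and>
       lin_ext (\<lambda>(x, y). if y = cunit C then bas x else 0) (ccomult C b) = bas b) \<and>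
    cdiff C (cunit C) = 0 \<and>
    ccomult C (cunit C) = bas (cunit C, cunit C)"

definition simply_connected :: "('b, 'r::comm_ring_1) coalg \<Rightarrow> bool"
  where "simply_connected C \<longleftrightarrow> chain_coalgebra C \<and> (\<forall>b\<in>cbasis C. cdeg C b \<noteq> 1)"

definition tensor_coalg :: "('b, 'r::comm_ring_1) coalg \<Rightarrow> ('c, 'r) coalg \<Rightarrow> ('b \<times> 'c, 'r) coalg"
  where "tensor_coalg C D = \<lparr>
    cbasis = cbasis C \<times> cbasis D,
    cunit = (cunit C, cunit D),
    cdeg = (\<lambda>(x, y). cdeg C x + cdeg D y),
    cdiff = (\<lambda>(x, y). tens (cdiff C x) (bas y) + smul (ksign (cdeg C x)) (tens (bas x) (cdiff D y))),
    ccomult = (\<lambda>(x, y). lin_ext (\<lambda>((x1, x2), (y1, y2)).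
        smul (ksign (cdeg C x2 * cdeg D y1)) (bas ((x1, y1), (x2, y2))))
        (tens (ccomult C x) (ccomult D y))) \<rparr>"

text \<open>
  \<open>\<Omega> C\<close> is modelled inside words in basis elements of \<open>C\<close>: the letter \<open>b\<close> stands for
  \<open>s\<^sup>-\<^sup>1 b\<close>, and only the letters from \<open>C\<^sub>+\<close> are used.
\<close>

definition pbasis :: "('b, 'r::comm_ring_1) coalg \<Rightarrow> 'b set"
  where "pbasis C = cbasis C - {cunit C}"

definition cobar :: "('b, 'r::comm_ring_1) coalg \<Rightarrow> ('b list \<Rightarrow>\<^sub>0 'r) set"
  where "cobar C = supported (lists (pbasis C))"

definition ldeg :: "('b, 'r::comm_ring_1) coalg \<Rightarrow> 'b \<Rightarrow> int"
  where "ldeg C b = cdeg C b - 1"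

abbreviation wdeg :: "('b, 'r::comm_ring_1) coalg \<Rightarrow> 'b list \<Rightarrow> int"
  where "wdeg C \<equiv> word_degree (ldeg C)"

text \<open>The map \<open>s\<^sup>-\<^sup>1\<close> from \<open>C\<close> to \<open>\<Omega> C\<close>, with \<open>s\<^sup>-\<^sup>1 1 = 0\<close>.\<close>

definition sinv :: "('b, 'r::comm_ring_1) coalg \<Rightarrow> ('b \<Rightarrow>\<^sub>0 'r) \<Rightarrow> ('b list \<Rightarrow>\<^sub>0 'r)"
  where "sinv C = lin_ext (\<lambda>b. if b = cunit C then 0 else bas [b])"

definition reduced_comult :: "('b, 'r::comm_ring_1) coalg \<Rightarrow> 'b \<Rightarrow> ('b \<times> 'b \<Rightarrow>\<^sub>0 'r)"
  where "reduced_comult C b = ccomult C b - bas (b, cunit C) - bas (cunit C, b)"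

definition cobar_diff :: "('b, 'r::comm_ring_1) coalg \<Rightarrow> ('b list \<Rightarrow>\<^sub>0 'r) \<Rightarrow> ('b list \<Rightarrow>\<^sub>0 'r)"
  where "cobar_diff C = der_ext (ldeg C) (\<lambda>b. bas [b])
    (\<lambda>b. - sinv C (cdiff C b) +
         lin_ext (\<lambda>(x, y). smul (ksign (cdeg C x)) (sinv C (bas x) * sinv C (bas y)))
           (reduced_comult C b))"

definition chain_algebra_map ::
  "('b, 'r::comm_ring_1) coalg \<Rightarrow> ('c, 'r) coalg \<Rightarrow> (('b list \<Rightarrow>\<^sub>0 'r) \<Rightarrow> ('c list \<Rightarrow>\<^sub>0 'r)) \<Rightarrow> bool"
  where "chain_algebra_map C D \<theta> \<longleftrightarrow>
    \<theta> \<in> cobar C \<rightarrow> cobar D \<and>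
    (\<forall>x\<in>cobar C. \<forall>y\<in>cobar C. \<theta> (x + y) = \<theta> x + \<theta> y \<and> \<theta> (x * y) = \<theta> x * \<theta> y) \<and>
    (\<forall>r. \<forall>x\<in>cobar C. \<theta> (smul r x) = smul r (\<theta> x)) \<and>
    \<theta> 1 = 1 \<and>
    (\<forall>n. \<forall>x\<in>cobar C. homog (wdeg C) n x \<longrightarrow> homog (wdeg D) n (\<theta> x)) \<and>
    (\<forall>x\<in>cobar C. \<theta> (cobar_diff C x) = cobar_diff D (\<theta> x))"

definition has_linear_part ::
  "('b, 'r::comm_ring_1) coalg \<Rightarrow> ('c, 'r) coalg \<Rightarrow> (('b list \<Rightarrow>\<^sub>0 'r) \<Rightarrow> ('c list \<Rightarrow>\<^sub>0 'r))
    \<Rightarrow> (('b \<Rightarrow>\<^sub>0 'r) \<Rightarrow> ('c \<Rightarrow>\<^sub>0 'r)) \<Rightarrow> bool"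
  where "has_linear_part C D \<theta> \<theta>1 \<longleftrightarrow>
    (\<forall>c\<in>supported (cbasis C).
       \<forall>w\<in>Poly_Mapping.keys (\<theta> (sinv C c) - sinv D (\<theta>1 c)). 2 \<le> length w)"

definition cobar_map ::
  "('b, 'r::comm_ring_1) coalg \<Rightarrow> ('c, 'r) coalg \<Rightarrow> (('b \<Rightarrow>\<^sub>0 'r) \<Rightarrow> ('c \<Rightarrow>\<^sub>0 'r))
    \<Rightarrow> ('b list \<Rightarrow>\<^sub>0 'r) \<Rightarrow> ('c list \<Rightarrow>\<^sub>0 'r)"
  where "cobar_map C D f = alg_ext (*) 1 (\<lambda>b. sinv D (f (bas b)))"


section \<open>Alexander-Whitney coalgebras\<close>

definition milgram ::
  "('b, 'r::comm_ring_1) coalg \<Rightarrow> (('b \<times> 'b) list \<Rightarrow>\<^sub>0 'r) \<Rightarrow> ('b list \<times> 'b list \<Rightarrow>\<^sub>0 'r)"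
  where "milgram C = alg_ext (tmult (wdeg C)) (bas ([], []))
    (\<lambda>(c, d). if d = cunit C then bas ([c], [])
              else if c = cunit C then bas ([], [d])
              else 0)"

definition aw_comult ::
  "('b, 'r::comm_ring_1) coalg \<Rightarrow> (('b list \<Rightarrow>\<^sub>0 'r) \<Rightarrow> (('b \<times> 'b) list \<Rightarrow>\<^sub>0 'r))
    \<Rightarrow> ('b list \<Rightarrow>\<^sub>0 'r) \<Rightarrow> ('b list \<times> 'b list \<Rightarrow>\<^sub>0 'r)"
  where "aw_comult C \<Psi> x = milgram C (\<Psi> x)"

definition AW_coalgebra ::
  "('b, 'r::comm_ring_1) coalg \<Rightarrow> (('b list \<Rightarrow>\<^sub>0 'r) \<Rightarrow> (('b \<times> 'b) list \<Rightarrow>\<^sub>0 'r)) \<Rightarrow> bool"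
  where "AW_coalgebra C \<Psi> \<longleftrightarrow>
    simply_connected C \<and>
    chain_algebra_map C (tensor_coalg C C) \<Psi> \<and>
    has_linear_part C (tensor_coalg C C) \<Psi> (Ccomult C) \<and>
    (\<forall>x\<in>cobar C.
       reassoc (tmap (wdeg C) 0 (aw_comult C \<Psi>) id (aw_comult C \<Psi> x)) =
       tmap (wdeg C) 0 id (aw_comult C \<Psi>) (aw_comult C \<Psi> x))"

definition primitives ::
  "('b, 'r::comm_ring_1) coalg \<Rightarrow> (('b list \<Rightarrow>\<^sub>0 'r) \<Rightarrow> (('b \<times> 'b) list \<Rightarrow>\<^sub>0 'r)) \<Rightarrow> ('b list \<Rightarrow>\<^sub>0 'r) set"
  where "primitives C \<Psi> = {x \<in> cobar C. aw_comult C \<Psi> x = tens x 1 + tens 1 x}"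

inductive_set generated_subalgebra :: "('a list \<Rightarrow>\<^sub>0 'r::comm_ring_1) set \<Rightarrow> ('a list \<Rightarrow>\<^sub>0 'r) set"
  for S
  where
    one: "1 \<in> generated_subalgebra S"
  | gen: "x \<in> S \<Longrightarrow> x \<in> generated_subalgebra S"
  | add: "x \<in> generated_subalgebra S \<Longrightarrow> y \<in> generated_subalgebra S \<Longrightarrow> x + y \<in> generated_subalgebra S"
  | mul: "x \<in> generated_subalgebra S \<Longrightarrow> y \<in> generated_subalgebra S \<Longrightarrow> x * y \<in> generated_subalgebra S"
  | scl: "x \<in> generated_subalgebra S \<Longrightarrow> smul r x \<in> generated_subalgebra S"

definition primitively_generated ::
  "('b, 'r::comm_ring_1) coalg \<Rightarrow> (('b list \<Rightarrow>\<^sub>0 'r) \<Rightarrow> (('b \<times> 'b) list \<Rightarrow>\<^sub>0 'r)) \<Rightarrow> bool"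
  where "primitively_generated C \<Psi> \<longleftrightarrow> generated_subalgebra (primitives C \<Psi>) = cobar C"


section \<open>The path-loop and double-loop constructions\<close>

text \<open>In \<open>\<PP>(C)\<close> the basis element \<open>Inl b\<close> is \<open>b\<close> and \<open>Inr b\<close> is \<open>s\<^sup>-\<^sup>1 b\<close>, for \<open>b \<in> C\<^sub>+\<close>.\<close>

definition path_incl :: "('b \<Rightarrow>\<^sub>0 'r::comm_ring_1) \<Rightarrow> ('b + 'b \<Rightarrow>\<^sub>0 'r)"
  where "path_incl = lin_ext (\<lambda>b. bas (Inl b))"

definition path_susp :: "('b, 'r::comm_ring_1) coalg \<Rightarrow> ('b \<Rightarrow>\<^sub>0 'r) \<Rightarrow> ('b + 'b \<Rightarrow>\<^sub>0 'r)"
  where "path_susp C = lin_ext (\<lambda>b. if b = cunit C then 0 else bas (Inr b))"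

definition path_coalg :: "('b, 'r::comm_ring_1) coalg \<Rightarrow> ('b + 'b, 'r) coalg"
  where "path_coalg C = \<lparr>
    cbasis = Inl ` cbasis C \<union> Inr ` pbasis C,
    cunit = Inl (cunit C),
    cdeg = case_sum (cdeg C) (\<lambda>b. cdeg C b - 1),
    cdiff = case_sum
      (\<lambda>b. path_incl (cdiff C b) - path_susp C (bas b))
      (\<lambda>b. - path_susp C (cdiff C b)),
    ccomult = case_sum
      (\<lambda>b. tmap (cdeg C) 0 path_incl path_incl (ccomult C b))
      (\<lambda>b. tmap (cdeg C) 0 (path_susp C) path_incl (ccomult C b) +
           tmap (cdeg C) (- 1) path_incl (path_susp C) (ccomult C b)) \<rparr>"

definition path_proj :: "('b + 'b \<Rightarrow>\<^sub>0 'r::comm_ring_1) \<Rightarrow> ('b \<Rightarrow>\<^sub>0 'r)"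
  where "path_proj = lin_ext (case_sum bas (\<lambda>_. 0))"

definition incl :: "('b list \<Rightarrow>\<^sub>0 'r::comm_ring_1) \<Rightarrow> (('b + 'b) list \<Rightarrow>\<^sub>0 'r)"
  where "incl = alg_ext (*) 1 (\<lambda>b. bas [Inl b])"

definition kappa :: "('b, 'r::comm_ring_1) coalg \<Rightarrow> ('b list \<Rightarrow>\<^sub>0 'r) \<Rightarrow> (('b + 'b) list \<Rightarrow>\<^sub>0 'r)"
  where "kappa C = der_ext (ldeg C) (\<lambda>b. bas [Inl b]) (\<lambda>b. - bas [Inr b])"

definition path_loop_comult ::
  "('b, 'r::comm_ring_1) coalg \<Rightarrow> (('b list \<Rightarrow>\<^sub>0 'r) \<Rightarrow> (('b \<times> 'b) list \<Rightarrow>\<^sub>0 'r))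
    \<Rightarrow> (('b + 'b) list \<Rightarrow>\<^sub>0 'r) \<Rightarrow> (('b + 'b) list \<times> ('b + 'b) list \<Rightarrow>\<^sub>0 'r)"
  where "path_loop_comult C \<Psi> = alg_ext (tmult (wdeg (path_coalg C))) (bas ([], []))
    (case_sum
      (\<lambda>b. tmap (wdeg C) 0 incl incl (aw_comult C \<Psi> (bas [b])))
      (\<lambda>b. - (tmap (wdeg C) 0 (kappa C) incl (aw_comult C \<Psi> (bas [b])) +
              tmap (wdeg C) (- 1) incl (kappa C) (aw_comult C \<Psi> (bas [b])))))"

definition double_loop ::
  "('b, 'r::comm_ring_1) coalg \<Rightarrow> (('b list \<Rightarrow>\<^sub>0 'r) \<Rightarrow> (('b \<times> 'b) list \<Rightarrow>\<^sub>0 'r))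
    \<Rightarrow> (('b + 'b) list \<Rightarrow>\<^sub>0 'r) set"
  where "double_loop C \<Psi> = {x \<in> cobar (path_coalg C).
    tmap (wdeg (path_coalg C)) 0 id (cobar_map (path_coalg C) C path_proj) (path_loop_comult C \<Psi> x)
      = tens x 1}"


section \<open>Iterated graded commutators\<close>

text \<open>The bilinear extension of \<open>[u, v] = u v - (-1)^(|u||v|) v u\<close>.\<close>

definition gcomm :: "('a list \<Rightarrow> int) \<Rightarrow> ('a list \<Rightarrow>\<^sub>0 'r) \<Rightarrow> ('a list \<Rightarrow>\<^sub>0 'r) \<Rightarrow> ('a list \<Rightarrow>\<^sub>0 'r::comm_ring_1)"
  where "gcomm dg x y =
    lin_ext (\<lambda>u. lin_ext (\<lambda>v. bas (u @ v) - smul (ksign (dg u * dg v)) (bas (v @ u))) y) x"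

inductive_set iterated_commutators ::
  "('a list \<Rightarrow> int) \<Rightarrow> ('a list \<Rightarrow>\<^sub>0 'r::comm_ring_1) set \<Rightarrow> ('a list \<Rightarrow>\<^sub>0 'r) set \<Rightarrow> ('a list \<Rightarrow>\<^sub>0 'r) set"
  for dg V W
  where
    base: "w \<in> W \<Longrightarrow> w \<in> iterated_commutators dg V W"
  | step: "v \<in> V \<Longrightarrow> x \<in> iterated_commutators dg V W \<Longrightarrow> gcomm dg v x \<in> iterated_commutators dg V W"

definition ad_span ::
  "('a list \<Rightarrow> int) \<Rightarrow> ('a list \<Rightarrow>\<^sub>0 'r::comm_ring_1) set \<Rightarrow> ('a list \<Rightarrow>\<^sub>0 'r) set \<Rightarrow> ('a list \<Rightarrow>\<^sub>0 'r) set"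
  where "ad_span dg V W = pm.span (iterated_commutators dg V W)"

text \<open>The submodules \<open>s\<^sup>-\<^sup>1C\<^sub>+\<close> and \<open>s\<^sup>-\<^sup>1(s\<^sup>-\<^sup>1C\<^sub>+)\<close> of the tensor algebra \<open>\<Omega> \<PP>(C)\<close> on their direct sum.\<close>

definition desusp_C :: "('b, 'r::comm_ring_1) coalg \<Rightarrow> (('b + 'b) list \<Rightarrow>\<^sub>0 'r) set"
  where "desusp_C C = supported {[Inl b] | b. b \<in> pbasis C}"

definition desusp_Cbar :: "('b, 'r::comm_ring_1) coalg \<Rightarrow> (('b + 'b) list \<Rightarrow>\<^sub>0 'r) set"
  where "desusp_Cbar C = supported {[Inr b] | b. b \<in> pbasis C}"


section \<open>Graded algebras; the tensor algebra of an arbitrary graded submodule\<close>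

record ('r, 'm) graded_algebra = "('r, 'm) module" +
  grade :: "int \<Rightarrow> 'm set"

definition graded_algebra_isomorphic ::
  "('r, 'm) graded_algebra \<Rightarrow> ('r, 'n) graded_algebra \<Rightarrow> bool"
  where "graded_algebra_isomorphic A B \<longleftrightarrow>
    (\<exists>\<phi>\<in>ring_iso A B.
       (\<forall>r. \<forall>x\<in>carrier A. \<phi> (smult A r x) = smult B r (\<phi> x)) \<and>
       (\<forall>n. \<phi> ` grade A n = grade B n))"

definition double_loop_algebra ::
  "('b, 'r::comm_ring_1) coalg \<Rightarrow> (('b list \<Rightarrow>\<^sub>0 'r) \<Rightarrow> (('b \<times> 'b) list \<Rightarrow>\<^sub>0 'r))
    \<Rightarrow> ('r, ('b + 'b) list \<Rightarrow>\<^sub>0 'r) graded_algebra"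
  where "double_loop_algebra C \<Psi> = \<lparr>
    carrier = double_loop C \<Psi>, mult = (*), one = 1, zero = 0, add = (+), smult = smul,
    grade = (\<lambda>n. {x \<in> double_loop C \<Psi>. homog (wdeg (path_coalg C)) n x}) \<rparr>"

text \<open>
  No basis of the submodule \<open>M\<close> is assumed, so \<open>T(M)\<close> is built as the free associative algebra on the
  set \<open>M\<close> modulo the two-sided ideal that makes the inclusion of generators linear.
  The degree \<open>n\<close> part is spanned by the products of homogeneous elements of \<open>M\<close> of total degree \<open>n\<close>.
\<close>

definition free_algebra :: "'m set \<Rightarrow> ('m list \<Rightarrow>\<^sub>0 'r::comm_ring_1) ring"
  where "free_algebra M = \<lparr>
    carrier = supported (lists M), mult = (*), one = 1, zero = 0, add = (+) \<rparr>"

definition tensor_relations :: "('a \<Rightarrow>\<^sub>0 'r::comm_ring_1) set \<Rightarrow> (('a \<Rightarrow>\<^sub>0 'r) list \<Rightarrow>\<^sub>0 'r) set"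
  where "tensor_relations M =
    {bas [x + y] - bas [x] - bas [y] | x y. x \<in> M \<and> y \<in> M} \<union>
    {bas [smul r x] - smul r (bas [x]) | r x. x \<in> M}"

definition tensor_ideal :: "('a \<Rightarrow>\<^sub>0 'r::comm_ring_1) set \<Rightarrow> (('a \<Rightarrow>\<^sub>0 'r) list \<Rightarrow>\<^sub>0 'r) set"
  where "tensor_ideal M = genideal (free_algebra M) (tensor_relations M)"

definition tensor_class ::
  "('a \<Rightarrow>\<^sub>0 'r::comm_ring_1) set \<Rightarrow> (('a \<Rightarrow>\<^sub>0 'r) list \<Rightarrow>\<^sub>0 'r) \<Rightarrow> (('a \<Rightarrow>\<^sub>0 'r) list \<Rightarrow>\<^sub>0 'r) set"
  where "tensor_class M x = a_r_coset (free_algebra M) (tensor_ideal M) x"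

definition tensor_algebra ::
  "('a \<Rightarrow> int) \<Rightarrow> ('a \<Rightarrow>\<^sub>0 'r::comm_ring_1) set \<Rightarrow> ('r, (('a \<Rightarrow>\<^sub>0 'r) list \<Rightarrow>\<^sub>0 'r) set) graded_algebra"
  where "tensor_algebra dg M = (let Q = FactRing (free_algebra M) (tensor_ideal M) in \<lparr>
    carrier = carrier Q, mult = mult Q, one = one Q, zero = zero Q, add = add Q,
    smult = (\<lambda>r X. \<Union>x\<in>X. tensor_class M (smul r x)),
    grade = (\<lambda>n. tensor_class M ` pm.span
      {bas ms | ms. \<exists>ks. list_all2 (\<lambda>m k. m \<in> M \<and> homog dg k m) ms ks \<and> sum_list ks = n}) \<rparr>)"

text \<open>In particular \<^const>\<open>genideal\<close> and \<^const>\<open>FactRing\<close> above are applied to a ring:\<close>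

lemma ring_free_algebra: "Ring.ring (free_algebra M :: ('m list \<Rightarrow>\<^sub>0 'r::comm_ring_1) ring)"
proof -
  have minus: "- x \<in> supported (lists M)" if "x \<in> supported (lists M)" for x :: "'m list \<Rightarrow>\<^sub>0 'r"
    using that by (simp add: supported_def)
  have plus: "x + y \<in> supported (lists M)"
    if "x \<in> supported (lists M)" "y \<in> supported (lists M)" for x y :: "'m list \<Rightarrow>\<^sub>0 'r"
    using that Poly_Mapping.keys_add[of x y] by (auto simp: supported_def)
  have times: "x * y \<in> supported (lists M)"
    if "x \<in> supported (lists M)" "y \<in> supported (lists M)" for x y :: "'m list \<Rightarrow>\<^sub>0 'r"
    using that keys_mult[of x y] by (fastforce simp: supported_def plus_list_def)
  have one: "(1 :: 'm list \<Rightarrow>\<^sub>0 'r) \<in> supported (lists M)"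
    by (simp add: supported_def zero_list_def)
  have zero: "(0 :: 'm list \<Rightarrow>\<^sub>0 'r) \<in> supported (lists M)"
    by (simp add: supported_def)
  show ?thesis
    unfolding free_algebra_def
  proof (rule ringI)
    show "abelian_group \<lparr>carrier = supported (lists M), mult = (*), one = 1, zero = 0 :: 'm list \<Rightarrow>\<^sub>0 'r, add = (+)\<rparr>"
      by (rule abelian_groupI) (auto simp: plus zero algebra_simps intro!: bexI[OF _ minus])
    show "Group.monoid \<lparr>carrier = supported (lists M), mult = (*), one = 1 :: 'm list \<Rightarrow>\<^sub>0 'r, zero = 0 :: 'm list \<Rightarrow>\<^sub>0 'r, add = (+)\<rparr>"
      by (rule monoidI) (simp_all add: times one mult.assoc)
  qed (auto simp: algebra_simps)
qed

end

theory Submission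
  imports Defs
begin

text \<open>
  Write \<open>V = s\<^sup>-\<^sup>1C\<^sub>+\<close> and \<open>W\<close> for the desuspension of \<open>s\<^sup>-\<^sup>1C\<^sub>+\<close>. Primitive generation lifts each basis
  element \<open>b\<close> of \<open>V\<close> to a homogeneous primitive \<open>p\<^sub>b = b + \<close> longer words, and then \<open>- \<kappa> p\<^sub>b\<close> lifts the
  corresponding element of \<open>W\<close>. Sending the letters to these elements is an automorphism \<open>\<phi>\<close> of
  \<open>T(V \<oplus> W)\<close>, since it is unitriangular for the word length, which the degree bounds. Under the
  coaction \<open>\<rho> = (1 \<otimes> \<Omega>\<pi>) \<psi>\<close> (with \<open>\<psi>\<close> the comultiplication of the path-loop construction) the first elements
  are primitive and the second coinvariant, so \<open>\<phi>\<close> maps iterated commutators \<open>[v\<^sub>1,[\<dots>[v\<^sub>k,w]]]\<close> to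
  coinvariants. The products of the iterated commutators of letters with a word in \<open>V\<close> on the right
  form a basis of \<open>T(V \<oplus> W)\<close>, again by unitriangularity, so these commutators generate a free algebra \<open>A\<close>
  with \<open>T(V \<oplus> W) = A \<otimes> T(V)\<close>, and the coaction on the factor \<open>T(V)\<close> has no further coinvariants.
\<close>

section \<open>Linear maps between free modules\<close>

text \<open>A letter is in general not primitive, so commutators of letters need not be coinvariant,
  and their inclusion is not the isomorphism; the isomorphism is that inclusion followed by the
  substitution \<open>phi\<close>. This is why generators and their values are kept apart to the
  end. Freeness is read off from words: every word in the two kinds of letters cuts uniquely, after
  each letter of \<open>W\<close>, into blocks \<open>v1 ... vk w\<close> and a remaining word in
  \<open>V\<close>, and \<open>[v1,[...[vk,w]]]\<close> is its block plus signed words in which some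
  \<open>vi\<close> has passed to the right of \<open>w\<close>. The two changes of basis use
  different measures: for commutators the number of pairs with a letter of \<open>V\<close> before a
  letter of \<open>W\<close>, for \<open>phi\<close> the degree minus the length. The second is
  nonnegative because the vanishing of \<open>C\<close> in degrees 1 and 2 gives every letter, even
  a twice desuspended one, degree at least 1. A separate obstacle is that the tensor algebra of a
  submodule is a quotient by relations; a spanning family with independent monomials identifies the
  ideal of relations with the kernel of an evaluation map.\<close>

abbreviation keys :: "('a \<Rightarrow>\<^sub>0 'r::zero) \<Rightarrow> 'a set" where "keys \<equiv> Poly_Mapping.keys"

abbreviation lookup :: "('a \<Rightarrow>\<^sub>0 'r::zero) \<Rightarrow> 'a \<Rightarrow> 'r" where "lookup \<equiv> Poly_Mapping.lookup"

definition is_linear :: "(('a \<Rightarrow>\<^sub>0 'r::comm_ring_1) \<Rightarrow> ('b \<Rightarrow>\<^sub>0 'r)) \<Rightarrow> bool"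
  where "is_linear f \<longleftrightarrow> (\<forall>x y. f (x + y) = f x + f y) \<and> (\<forall>r x. f (smul r x) = smul r (f x))"

named_theorems linear_intros

lemma keys_smul: "keys (smul r x) \<subseteq> keys x"
  by (auto simp: in_keys_iff lookup_smul)

lemma ksign_add: "ksign (m + n) = (ksign m * ksign n :: 'r::comm_ring_1)"
  by (auto simp: ksign_def)

lemma poly_mapping_decomp:
  assumes "finite A" "keys x \<subseteq> A"
  shows "x = (\<Sum>a\<in>A. smul (lookup x a) (bas a))"
proof (rule poly_mapping_eqI)
  fix k
  have "lookup (\<Sum>a\<in>A. smul (lookup x a) (bas a)) k = (\<Sum>a\<in>A. if a = k then lookup x a else 0)"
    unfolding lookup_sum by (intro sum.cong) (auto simp: lookup_smul lookup_single when_def)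
  also have "\<dots> = lookup x k"
    using assms by (auto simp: in_keys_iff)
  finally show "lookup x k = lookup (\<Sum>a\<in>A. smul (lookup x a) (bas a)) k" by simp
qed

text \<open>The support changes with the argument; a common finite superset lets the defining sums
  of several arguments be compared term by term.\<close>

lemma lin_ext_superset:
  assumes "finite A" "keys x \<subseteq> A"
  shows "lin_ext g x = (\<Sum>a\<in>A. smul (lookup x a) (g a))"
  unfolding lin_ext_def
  by (rule sum.mono_neutral_left) (use assms in \<open>auto simp: in_keys_iff\<close>)

lemma is_linearI:
  assumes "\<And>x y. f (x + y) = f x + f y" "\<And>r x. f (smul r x) = smul r (f x)"
  shows "is_linear f"
  using assms by (simp add: is_linear_def)

lemma is_linear_lin_ext: "is_linear (lin_ext g)"
proof (rule is_linearI)
  fix x y :: "'a \<Rightarrow>\<^sub>0 'b"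
  have "lin_ext g (x + y) = (\<Sum>a\<in>keys x \<union> keys y. smul (lookup (x + y) a) (g a))"
    by (rule lin_ext_superset) (simp_all add: keys_add)
  also have "\<dots> = (\<Sum>a\<in>keys x \<union> keys y. smul (lookup x a) (g a))
      + (\<Sum>a\<in>keys x \<union> keys y. smul (lookup y a) (g a))"
    by (simp add: lookup_add pm.scale_left_distrib sum.distrib)
  also have "\<dots> = lin_ext g x + lin_ext g y"
    by (subst (1 2) lin_ext_superset[where A = "keys x \<union> keys y"]) auto
  finally show "lin_ext g (x + y) = lin_ext g x + lin_ext g y" .
next
  fix r and x :: "'a \<Rightarrow>\<^sub>0 'b"
  have "lin_ext g (smul r x) = (\<Sum>a\<in>keys x. smul (lookup (smul r x) a) (g a))"
    by (rule lin_ext_superset) (simp_all add: keys_smul)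
  also have "\<dots> = smul r (lin_ext g x)"
    by (simp add: lookup_smul lin_ext_def pm.scale_sum_right)
  finally show "lin_ext g (smul r x) = smul r (lin_ext g x)" .
qed

lemma
  assumes "is_linear f"
  shows linear_add: "f (x + y) = f x + f y"
    and linear_smul: "f (smul r x) = smul r (f x)"
    and linear_zero: "f 0 = 0"
    and linear_minus: "f (- x) = - f x"
    and linear_diff: "f (x - y) = f x - f y"
    and linear_sum: "f (\<Sum>i\<in>I. h i) = (\<Sum>i\<in>I. f (h i))"
proof -
  show add: "f (x + y) = f x + f y" for x y
    using assms by (simp add: is_linear_def)
  show zero: "f 0 = 0"
    using add[of 0 0] by simp
  show "f (smul r x) = smul r (f x)"
    using assms by (simp add: is_linear_def)
  show minus: "f (- x) = - f x" for x
    using add[of x "- x"] zero by (simp add: eq_neg_iff_add_eq_0 add.commute)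
  show "f (x - y) = f x - f y"
    using add[of x "- y"] minus by simp
  show "f (\<Sum>i\<in>I. h i) = (\<Sum>i\<in>I. f (h i))"
    by (induction I rule: infinite_finite_induct) (simp_all add: zero add)
qed

lemmas lin_ext_add = linear_add[OF is_linear_lin_ext]
lemmas lin_ext_smul = linear_smul[OF is_linear_lin_ext]
lemmas lin_ext_zero = linear_zero[OF is_linear_lin_ext]
lemmas lin_ext_diff = linear_diff[OF is_linear_lin_ext]

lemma lin_ext_bas [simp]: "lin_ext g (bas a) = g a"
  by (subst lin_ext_superset[where A = "{a}"]) (auto simp: lookup_single)

lemma lin_ext_bas_id: "lin_ext bas x = x"
  using poly_mapping_decomp[of "keys x" x] by (simp add: lin_ext_def)

lemma linear_eq_lin_ext:
  assumes "is_linear f"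
  shows "f x = lin_ext (\<lambda>a. f (bas a)) x"
proof -
  have "f x = f (\<Sum>a\<in>keys x. smul (lookup x a) (bas a))"
    using poly_mapping_decomp[of "keys x" x] by simp
  also have "\<dots> = lin_ext (\<lambda>a. f (bas a)) x"
    by (simp add: linear_sum[OF assms] linear_smul[OF assms] lin_ext_def)
  finally show ?thesis .
qed

lemma lin_ext_cong:
  assumes "\<And>a. a \<in> keys x \<Longrightarrow> g a = h a"
  shows "lin_ext g x = lin_ext h x"
  using assms by (simp add: lin_ext_def)

text \<open>Agreement is asked only on the support of the one element \<open>x\<close>. This suits
  identities that hold only for homogeneous elements or only on a based submodule.\<close>

lemma linear_eqI:
  assumes "is_linear f" "is_linear g" "\<And>a. a \<in> keys x \<Longrightarrow> f (bas a) = g (bas a)"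
  shows "f x = g x"
  unfolding linear_eq_lin_ext[OF assms(1), of x] linear_eq_lin_ext[OF assms(2), of x]
  by (rule lin_ext_cong) (rule assms(3))

lemma is_linear_comp:
  assumes "is_linear f" "is_linear g"
  shows "is_linear (\<lambda>x. f (g x))"
  using assms by (simp add: is_linear_def)

lemma is_linear_ident [linear_intros]: "is_linear (\<lambda>x. x)"
  by (simp add: is_linear_def)

lemma is_linear_id [linear_intros]: "is_linear id"
  by (simp add: is_linear_def)

lemma is_linear_zero [linear_intros]: "is_linear (\<lambda>x. 0)"
  by (simp add: is_linear_def)

lemma is_linear_plus [linear_intros]:
  "is_linear f \<Longrightarrow> is_linear g \<Longrightarrow> is_linear (\<lambda>x. f x + g x)"
  by (simp add: is_linear_def algebra_simps pm.scale_right_distrib)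

lemma is_linear_diff [linear_intros]:
  "is_linear f \<Longrightarrow> is_linear g \<Longrightarrow> is_linear (\<lambda>x. f x - g x)"
  by (simp add: is_linear_def algebra_simps pm.scale_right_diff_distrib)

lemma is_linear_smul [linear_intros]: "is_linear f \<Longrightarrow> is_linear (\<lambda>x. smul r (f x))"
  by (simp add: is_linear_def pm.scale_right_distrib mult.commute)

lemma is_linear_lin_ext_arg [linear_intros]: "is_linear f \<Longrightarrow> is_linear (\<lambda>x. lin_ext g (f x))"
  by (rule is_linear_comp[OF is_linear_lin_ext])

lemma is_linear_sum [linear_intros]:
  "(\<And>i. i \<in> I \<Longrightarrow> is_linear (f i)) \<Longrightarrow> is_linear (\<lambda>x. \<Sum>i\<in>I. f i x)"
  by (induction I rule: infinite_finite_induct) (auto intro!: linear_intros)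

lemma is_linear_lin_ext_fun: "(\<And>a. is_linear (F a)) \<Longrightarrow> is_linear (\<lambda>y. lin_ext (\<lambda>a. F a y) x)"
  unfolding lin_ext_def by (intro linear_intros)

lemma lin_ext_lin_ext: "lin_ext f (lin_ext g x) = lin_ext (\<lambda>a. lin_ext f (g a)) x"
  by (rule linear_eqI) (auto intro!: linear_intros)

section \<open>Scalars and the convolution product\<close>

lemma smul_single: "smul r (Poly_Mapping.single a c) = Poly_Mapping.single a (r * c)"
  by (rule poly_mapping_eqI) (simp add: lookup_smul lookup_single when_def)

lemma single_zero_mult: "Poly_Mapping.single 0 r * x = smul r (x :: 'a::monoid_add \<Rightarrow>\<^sub>0 'r::comm_ring_1)"
proof -
  have "Poly_Mapping.single 0 r * (\<Sum>a\<in>keys x. smul (lookup x a) (bas a))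
      = smul r (\<Sum>a\<in>keys x. smul (lookup x a) (bas a))"
    by (simp add: sum_distrib_left pm.scale_sum_right smul_single mult_single)
  then show ?thesis
    using poly_mapping_decomp[of "keys x" x] by simp
qed

lemma smul_mult_left: "smul r x * y = smul r (x * y :: 'a::monoid_add \<Rightarrow>\<^sub>0 'r::comm_ring_1)"
  by (metis single_zero_mult mult.assoc)

text \<open>The scalar has to pass \<open>x\<close> in a noncommutative product, so associativity
  alone does not help and both factors are expanded in basis elements.\<close>

lemma smul_mult_right: "x * smul r y = smul r (x * y :: 'a::monoid_add \<Rightarrow>\<^sub>0 'r::comm_ring_1)"
proof -
  have "(\<Sum>a\<in>keys x. smul (lookup x a) (bas a)) * smul r (\<Sum>b\<in>keys y. smul (lookup y b) (bas b))
      = smul r ((\<Sum>a\<in>keys x. smul (lookup x a) (bas a)) * (\<Sum>b\<in>keys y. smul (lookup y b) (bas b)))"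
    by (simp add: sum_product pm.scale_sum_right smul_single mult_single mult.left_commute)
  then show ?thesis
    using poly_mapping_decomp[of "keys x" x] poly_mapping_decomp[of "keys y" y] by simp
qed

lemma is_linear_mult_left [linear_intros]:
  fixes f :: "('c \<Rightarrow>\<^sub>0 'r) \<Rightarrow> ('a::monoid_add \<Rightarrow>\<^sub>0 'r::comm_ring_1)"
  shows "is_linear f \<Longrightarrow> is_linear (\<lambda>x. f x * c)"
  by (simp add: is_linear_def algebra_simps smul_mult_left)

lemma is_linear_mult_right [linear_intros]:
  fixes f :: "('c \<Rightarrow>\<^sub>0 'r) \<Rightarrow> ('a::monoid_add \<Rightarrow>\<^sub>0 'r::comm_ring_1)"
  shows "is_linear f \<Longrightarrow> is_linear (\<lambda>x. c * f x)"
  by (simp add: is_linear_def algebra_simps smul_mult_right)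

lemma bas_Nil [simp]: "bas [] = 1"
  by (simp flip: zero_list_def)

lemma lin_ext_one [simp]: "lin_ext g 1 = g []"
  by (simp flip: bas_Nil)

lemma bas_mult_bas: "bas u * bas v = bas (u @ v)"
  by (simp add: mult_single plus_list_def)

section \<open>Supports and homogeneity\<close>

lemma keys_lin_ext: "keys (lin_ext g x) \<subseteq> (\<Union>a\<in>keys x. keys (g a))"
  unfolding lin_ext_def using keys_sum keys_smul by fastforce

lemma supported_zero [simp]: "0 \<in> supported X"
  by (simp add: supported_def)

lemma supported_bas [simp]: "a \<in> X \<Longrightarrow> bas a \<in> supported X"
  by (simp add: supported_def)

lemma supported_add: "x \<in> supported X \<Longrightarrow> y \<in> supported X \<Longrightarrow> x + y \<in> supported X"
  using keys_add[of x y] by (auto simp: supported_def)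

lemma supported_uminus: "x \<in> supported X \<Longrightarrow> - x \<in> supported X"
  by (simp add: supported_def)

lemma supported_diff: "x \<in> supported X \<Longrightarrow> y \<in> supported X \<Longrightarrow> x - y \<in> supported X"
  using keys_diff[of x y] by (auto simp: supported_def)

lemma supported_smul: "x \<in> supported X \<Longrightarrow> smul r x \<in> supported X"
  using keys_smul[of r x] by (auto simp: supported_def)

lemma supported_lin_ext:
  "x \<in> supported X \<Longrightarrow> (\<And>a. a \<in> X \<Longrightarrow> g a \<in> supported Y) \<Longrightarrow> lin_ext g x \<in> supported Y"
  using keys_lin_ext[of g x] unfolding supported_def by blast

lemma supported_mult:
  "x \<in> supported (lists X) \<Longrightarrow> y \<in> supported (lists X) \<Longrightarrow> x * y \<in> supported (lists X)"
  using keys_mult[of x y] by (fastforce simp: supported_def plus_list_def)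

lemma supported_one: "1 \<in> supported (lists X)"
  using supported_bas[of "[]" "lists X"] by simp

lemma supported_mono: "X \<subseteq> Y \<Longrightarrow> x \<in> supported X \<Longrightarrow> x \<in> supported Y"
  by (auto simp: supported_def)

lemma linear_eqI_supported:
  assumes "is_linear f" "is_linear g" "x \<in> supported X" "\<And>a. a \<in> X \<Longrightarrow> f (bas a) = g (bas a)"
  shows "f x = g x"
  by (rule linear_eqI[OF assms(1,2)]) (use assms(3) in \<open>auto simp: supported_def intro: assms(4)\<close>)

lemma homog_conv_supported: "homog dg n x \<longleftrightarrow> x \<in> supported {a. dg a = n}"
  by (auto simp: homog_def supported_def)

lemma homog_bas [simp]: "homog dg n (bas a :: 'a \<Rightarrow>\<^sub>0 'r::comm_ring_1) \<longleftrightarrow> dg a = n"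
  by (simp add: homog_def)

lemma homog_zero [simp]: "homog dg n 0"
  by (simp add: homog_def)

lemma homog_add: "homog dg n x \<Longrightarrow> homog dg n y \<Longrightarrow> homog dg n (x + y)"
  by (simp add: homog_conv_supported supported_add)

lemma homog_diff: "homog dg n x \<Longrightarrow> homog dg n y \<Longrightarrow> homog dg n (x - y)"
  by (simp add: homog_conv_supported supported_diff)

lemma homog_uminus: "homog dg n x \<Longrightarrow> homog dg n (- x)"
  by (simp add: homog_conv_supported supported_uminus)

lemma homog_smul: "homog dg n x \<Longrightarrow> homog dg n (smul r x)"
  by (simp add: homog_conv_supported supported_smul)

lemma homog_lin_ext:
  "homog dg n x \<Longrightarrow> (\<And>a. a \<in> keys x \<Longrightarrow> dg a = n \<Longrightarrow> homog dg' n (g a)) \<Longrightarrow> homog dg' n (lin_ext g x)"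
  using keys_lin_ext[of g x] unfolding homog_def by blast

lemma word_degree_append [simp]: "word_degree dg (u @ v) = word_degree dg u + word_degree dg v"
  by (simp add: word_degree_def)

lemma word_degree_Cons [simp]: "word_degree dg (a # v) = dg a + word_degree dg v"
  by (simp add: word_degree_def)

lemma word_degree_Nil [simp]: "word_degree dg [] = 0"
  by (simp add: word_degree_def)

lemma homog_mult:
  "homog (word_degree dg) m x \<Longrightarrow> homog (word_degree dg) n y \<Longrightarrow> homog (word_degree dg) (m + n) (x * y)"
  using keys_mult[of x y] by (fastforce simp: homog_def plus_list_def)

lemma homog_one [simp]: "homog (word_degree dg) 0 1"
  unfolding bas_Nil[symmetric] homog_bas by simp

section \<open>Homogeneous components\<close>

definition component :: "('a \<Rightarrow> int) \<Rightarrow> int \<Rightarrow> ('a \<Rightarrow>\<^sub>0 'r::comm_ring_1) \<Rightarrow> ('a \<Rightarrow>\<^sub>0 'r)"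
  where "component dg n = lin_ext (\<lambda>a. if dg a = n then bas a else 0)"

lemma lookup_component: "lookup (component dg n x) a = (if dg a = n then lookup x a else 0)"
proof -
  have "lookup (component dg n x) a = (\<Sum>b\<in>keys x. if b = a then (if dg a = n then lookup x a else 0) else 0)"
    unfolding component_def lin_ext_def lookup_sum
    by (intro sum.cong) (auto simp: lookup_smul lookup_single when_def)
  then show ?thesis by (auto simp: in_keys_iff)
qed

lemma is_linear_component [linear_intros]: "is_linear f \<Longrightarrow> is_linear (\<lambda>x. component dg n (f x))"
  unfolding component_def by (intro linear_intros)

lemma homog_component: "homog dg n (component dg n x)"
  by (auto simp: homog_def in_keys_iff lookup_component split: if_splits)

lemma keys_component: "keys (component dg n x) \<subseteq> keys x"
  by (auto simp: in_keys_iff lookup_component split: if_splits)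

lemma component_homog: "homog dg m x \<Longrightarrow> component dg n x = (if m = n then x else 0)"
  by (rule poly_mapping_eqI) (auto simp: lookup_component homog_def in_keys_iff)

lemma component_lin_ext:
  assumes "\<And>a. a \<in> keys x \<Longrightarrow> homog dg' (dg a) (g a)"
  shows "component dg' n (lin_ext g x) = lin_ext g (component dg n x)"
proof (rule linear_eqI[where x = x])
  fix a assume "a \<in> keys x"
  show "component dg' n (lin_ext g (bas a)) = lin_ext g (component dg n (bas a))"
    using component_homog[OF assms[OF \<open>a \<in> keys x\<close>], of n]
    by (simp add: component_def[of dg] lin_ext_zero)
qed (intro linear_intros)+

section \<open>Tensor products and algebra maps\<close>

lemma is_linear_tens_left [linear_intros]: "is_linear f \<Longrightarrow> is_linear (\<lambda>x. tens (f x) y)"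
  unfolding tens_def by (intro linear_intros)

lemma is_linear_tens_right [linear_intros]: "is_linear f \<Longrightarrow> is_linear (\<lambda>y. tens x (f y))"
  unfolding tens_def by (rule is_linear_lin_ext_fun) (intro linear_intros)

lemma tens_bas [simp]: "tens (bas a) (bas b) = bas (a, b)"
  by (simp add: tens_def)

lemma tens_zero_left [simp]: "tens 0 y = 0"
  by (simp add: linear_zero[OF is_linear_tens_left[OF is_linear_ident]])

lemma tens_zero_right [simp]: "tens x 0 = 0"
  by (simp add: linear_zero[OF is_linear_tens_right[OF is_linear_ident]])

lemma tens_smul_right: "tens x (smul r y) = smul r (tens x y)"
  by (simp add: linear_smul[OF is_linear_tens_right[OF is_linear_ident]])

lemma tens_diff_left: "tens (x - x') y = tens x y - tens x' y"
  by (simp add: linear_diff[OF is_linear_tens_left[OF is_linear_ident]])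

lemma tens_smul_left: "tens (smul r x) y = smul r (tens x y)"
  by (simp add: linear_smul[OF is_linear_tens_left[OF is_linear_ident]])

lemma tens_uminus_left: "tens (- x) y = - tens x y"
  by (simp add: linear_minus[OF is_linear_tens_left[OF is_linear_ident]])

lemma is_linear_tmap [linear_intros]: "is_linear h \<Longrightarrow> is_linear (\<lambda>x. tmap dg k f g (h x))"
  unfolding tmap_def by (intro linear_intros)

lemmas tmap_linear = linear_add[OF is_linear_tmap[OF is_linear_ident]]
  linear_smul[OF is_linear_tmap[OF is_linear_ident]] linear_minus[OF is_linear_tmap[OF is_linear_ident]]

lemma tmap_bas: "tmap dg k f g (bas (a, b)) = smul (ksign (k * dg a)) (tens (f (bas a)) (g (bas b)))"
  by (simp add: tmap_def)

lemma ksign_zero [simp]: "ksign 0 = 1"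
  by (simp add: ksign_def)

lemma tmap_tens:
  assumes "is_linear f" "is_linear g"
  shows "tmap dg 0 f g (tens x y) = tens (f x) (g y)"
proof (rule linear_eqI[where x = x])
  fix a
  show "tmap dg 0 f g (tens (bas a) y) = tens (f (bas a)) (g y)"
    by (rule linear_eqI[where x = y])
      (auto intro!: linear_intros is_linear_comp[OF assms(2)] is_linear_comp[of "tens _"] simp: tmap_bas)
qed (auto intro!: linear_intros is_linear_comp[OF _ assms(1), of "\<lambda>x. tens x _"])

text \<open>A version of \<open>tmult\<close> with a different alphabet in each factor: the coaction
  \<open>rho\<close> takes values in the tensor product of the path-loop construction with the cobar
  construction.\<close>

definition tmult2 :: "('a list \<Rightarrow> int) \<Rightarrow> ('b list \<Rightarrow> int) \<Rightarrow> ('a list \<times> 'b list \<Rightarrow>\<^sub>0 'r)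
    \<Rightarrow> ('a list \<times> 'b list \<Rightarrow>\<^sub>0 'r) \<Rightarrow> ('a list \<times> 'b list \<Rightarrow>\<^sub>0 'r::comm_ring_1)"
  where "tmult2 dg dg' x y = lin_ext (\<lambda>(u, v). lin_ext (\<lambda>(u', v').
           smul (ksign (dg' v * dg u')) (bas (u @ u', v @ v'))) y) x"

lemma tmult_conv_tmult2: "tmult dg = tmult2 dg dg"
  by (simp add: fun_eq_iff tmult_def tmult2_def)

lemma is_linear_tmult2_left [linear_intros]: "is_linear f \<Longrightarrow> is_linear (\<lambda>x. tmult2 dg dg' (f x) y)"
  unfolding tmult2_def by (intro linear_intros)

lemma is_linear_tmult2_right [linear_intros]: "is_linear f \<Longrightarrow> is_linear (\<lambda>y. tmult2 dg dg' x (f y))"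
  unfolding tmult2_def split_def by (rule is_linear_lin_ext_fun) (intro linear_intros)

lemma tmult2_bas:
  "tmult2 dg dg' (bas (u, v)) (bas (u', v')) = smul (ksign (dg' v * dg u')) (bas (u @ u', v @ v'))"
  by (simp add: tmult2_def)

lemma tmult2_smul_right: "tmult2 dg dg' x (smul r y) = smul r (tmult2 dg dg' x y)"
  by (simp add: linear_smul[OF is_linear_tmult2_right[OF is_linear_ident]])

lemma tmult2_smul_left: "tmult2 dg dg' (smul r x) y = smul r (tmult2 dg dg' x y)"
  by (simp add: linear_smul[OF is_linear_tmult2_left[OF is_linear_ident]])

lemma tmult2_add_left: "tmult2 dg dg' (x + x') y = tmult2 dg dg' x y + tmult2 dg dg' x' y"
  by (simp add: linear_add[OF is_linear_tmult2_left[OF is_linear_ident]])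

lemma tmult2_add_right: "tmult2 dg dg' x (y + y') = tmult2 dg dg' x y + tmult2 dg dg' x y'"
  by (simp add: linear_add[OF is_linear_tmult2_right[OF is_linear_ident]])

text \<open>The Koszul sign sees only the two inner factors, so the outer factors \<open>x\<close>
  and \<open>y'\<close> may be inhomogeneous.\<close>

lemma tmult2_tens:
  assumes y: "homog dg' m y" and x': "homog dg n x'"
  shows "tmult2 dg dg' (tens x y) (tens x' y') = smul (ksign (m * n)) (tens (x * x') (y * y'))"
proof (rule linear_eqI[where x = x])
  fix u
  show "tmult2 dg dg' (tens (bas u) y) (tens x' y') = smul (ksign (m * n)) (tens (bas u * x') (y * y'))"
  proof (rule linear_eqI[where x = y])
    fix v assume "v \<in> keys y"
    with y have v: "dg' v = m" by (simp add: homog_def)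
    show "tmult2 dg dg' (tens (bas u) (bas v)) (tens x' y')
        = smul (ksign (m * n)) (tens (bas u * x') (bas v * y'))"
    proof (rule linear_eqI[where x = x'])
      fix u' assume "u' \<in> keys x'"
      with x' have u': "dg u' = n" by (simp add: homog_def)
      show "tmult2 dg dg' (tens (bas u) (bas v)) (tens (bas u') y')
          = smul (ksign (m * n)) (tens (bas u * bas u') (bas v * y'))"
        by (rule linear_eqI[where x = y'])
          (auto intro!: linear_intros simp: tmult2_bas bas_mult_bas v u')
    qed (intro linear_intros)+
  qed (intro linear_intros)+
qed (intro linear_intros)+

lemma tmult2_assoc:
  fixes dg :: "'a \<Rightarrow> int" and dg' :: "'b \<Rightarrow> int"
  defines "d \<equiv> word_degree dg" and "d' \<equiv> word_degree dg'"
  shows "tmult2 d d' (tmult2 d d' x y) z = tmult2 d d' x (tmult2 d d' y z)"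
proof (rule linear_eqI[where x = x])
  fix a
  show "tmult2 d d' (tmult2 d d' (bas a) y) z = tmult2 d d' (bas a) (tmult2 d d' y z)"
  proof (rule linear_eqI[where x = y])
    fix b
    show "tmult2 d d' (tmult2 d d' (bas a) (bas b)) z = tmult2 d d' (bas a) (tmult2 d d' (bas b) z)"
    proof (rule linear_eqI[where x = z])
      fix c
      show "tmult2 d d' (tmult2 d d' (bas a) (bas b)) (bas c)
          = tmult2 d d' (bas a) (tmult2 d d' (bas b) (bas c))"
        by (cases a; cases b; cases c)
          (simp add: tmult2_bas tmult2_smul_left tmult2_smul_right d_def d'_def algebra_simps ksign_add)
    qed (intro linear_intros)+
  qed (intro linear_intros)+
qed (intro linear_intros)+

lemma tmult2_one_left: "tmult2 (word_degree dg) (word_degree dg') (bas ([], [])) x = x"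
  by (rule linear_eqI[where x = x]) (auto intro!: linear_intros simp: tmult2_bas)

section \<open>Algebra maps and derivations out of a tensor algebra\<close>

lemma is_linear_alg_ext [linear_intros]: "is_linear f \<Longrightarrow> is_linear (\<lambda>x. alg_ext m e g (f x))"
  unfolding alg_ext_def by (intro linear_intros)

lemma alg_ext_bas: "alg_ext m e g (bas w) = foldr (\<lambda>a. m (g a)) w e"
  by (simp add: alg_ext_def)

text \<open>A left unit suffices: \<open>foldr\<close> closes every product with \<open>e\<close>,
  and \<open>e\<close> is cancelled only in front of the value on the second word.\<close>

lemma alg_ext_mult:
  assumes "\<And>y. is_linear (\<lambda>x. m x y)" "\<And>x. is_linear (\<lambda>y. m x y)"
    and assoc: "\<And>x y z. m (m x y) z = m x (m y z)" and unit: "\<And>x. m e x = x"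
  shows "alg_ext m e g (x * y) = m (alg_ext m e g x) (alg_ext m e g y)"
proof (rule linear_eqI[where x = x])
  fix u
  show "alg_ext m e g (bas u * y) = m (alg_ext m e g (bas u)) (alg_ext m e g y)"
  proof (rule linear_eqI[where x = y])
    fix v
    have "foldr (\<lambda>a. m (g a)) (u @ v) e = m (foldr (\<lambda>a. m (g a)) u e) (foldr (\<lambda>a. m (g a)) v e)"
      by (induction u) (simp_all add: assoc unit)
    then show "alg_ext m e g (bas u * bas v) = m (alg_ext m e g (bas u)) (alg_ext m e g (bas v))"
      by (simp add: bas_mult_bas alg_ext_bas)
  qed (auto intro!: linear_intros is_linear_comp[OF assms(2)])
qed (auto intro!: linear_intros is_linear_comp[OF assms(1)])

lemma alg_ext_times:
  "alg_ext (*) 1 g (x * y) = alg_ext (*) 1 g x * alg_ext (*) (1 :: 'b list \<Rightarrow>\<^sub>0 'r::comm_ring_1) g y"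
  by (rule alg_ext_mult) (auto intro!: linear_intros simp: mult.assoc)

lemma alg_ext_tmult2:
  fixes dg :: "'a \<Rightarrow> int" and dg' :: "'b \<Rightarrow> int"
  defines "m \<equiv> tmult2 (word_degree dg) (word_degree dg')"
  shows "alg_ext m (bas ([], [])) g (x * y) = m (alg_ext m (bas ([], [])) g x) (alg_ext m (bas ([], [])) g y)"
  unfolding m_def by (rule alg_ext_mult) (auto intro!: linear_intros simp: tmult2_assoc tmult2_one_left)

lemma alg_ext_one [simp]: "alg_ext m e g 1 = e"
  using alg_ext_bas[of m e g "[]"] by simp

lemma alg_ext_letter: "alg_ext (*) 1 g (bas [a]) = (g a :: 'b list \<Rightarrow>\<^sub>0 'r::comm_ring_1)"
  by (simp add: alg_ext_bas)

lemma bas_Cons: "(bas (a # w) :: 'a list \<Rightarrow>\<^sub>0 'r::comm_ring_1) = bas [a] * bas w"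
  by (simp add: bas_mult_bas)

lemma supported_alg_ext:
  assumes "x \<in> supported (lists X)" "\<And>a. a \<in> X \<Longrightarrow> g a \<in> supported (lists Y)"
  shows "alg_ext (*) 1 g x \<in> supported (lists Y)"
proof -
  have "foldr (\<lambda>a. (*) (g a)) w 1 \<in> supported (lists Y)" if "w \<in> lists X" for w
    using that by (induction w) (auto intro: supported_mult supported_one assms(2))
  then show ?thesis
    unfolding alg_ext_def by (intro supported_lin_ext[OF assms(1)]) auto
qed

lemma homog_alg_ext_word:
  assumes "\<And>a. a \<in> set w \<Longrightarrow> homog (word_degree dg') (dg a) (g a)"
  shows "homog (word_degree dg') (word_degree dg w) (alg_ext (*) 1 g (bas w))"
  using assms by (induction w) (auto simp: alg_ext_bas intro!: homog_mult)

lemma is_linear_der_ext [linear_intros]: "is_linear h \<Longrightarrow> is_linear (\<lambda>x. der_ext dg f D (h x))"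
  unfolding der_ext_def by (intro linear_intros)

lemma der_ext_bas: "der_ext dg f D (bas w) = der_word dg f D w"
  by (simp add: der_ext_def)

lemma der_ext_one [simp]: "der_ext dg f D 1 = 0"
  using der_ext_bas[of dg f D "[]"] by simp

lemma der_word_append:
  "der_word dg f D (u @ v) = der_word dg f D u * alg_ext (*) 1 f (bas v)
    + smul (ksign (word_degree dg u)) (alg_ext (*) 1 f (bas u) * der_word dg f D v)"
proof (induction u)
  case (Cons a u)
  have "alg_ext (*) 1 f (bas (u @ v)) = alg_ext (*) 1 f (bas u) * alg_ext (*) 1 f (bas v)"
    by (simp add: alg_ext_times flip: bas_mult_bas)
  moreover have "alg_ext (*) 1 f (bas (a # u)) = f a * alg_ext (*) 1 f (bas u)"
    by (simp add: alg_ext_bas)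
  ultimately show ?case
    by (simp add: Cons.IH algebra_simps smul_mult_left smul_mult_right pm.scale_right_distrib ksign_add)
qed simp

section \<open>Unitriangular changes of basis\<close>

text \<open>The inverse is returned as a family indexed by the basis \<open>S\<close>, so that its linear extension
  is defined everywhere.\<close>

lemma unitriangular_inverse:
  fixes g :: "'z \<Rightarrow> ('a \<Rightarrow>\<^sub>0 'r::comm_ring_1)" and h :: "'z \<Rightarrow> 'a" and \<mu> :: "'a \<Rightarrow> nat"
  assumes bij: "bij_betw h Z S"
    and tri: "\<And>z. z \<in> Z \<Longrightarrow> g z - bas (h z) \<in> supported {s \<in> S. \<mu> s < \<mu> (h z)}"
  obtains k where "\<And>s. s \<in> S \<Longrightarrow> k s \<in> supported Z" "\<And>s. s \<in> S \<Longrightarrow> lin_ext g (k s) = bas s"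
    "\<And>z. z \<in> Z \<Longrightarrow> lin_ext k (g z) = bas z"
proof -
  have "\<exists>x\<in>supported Z. lin_ext g x = bas s" if "s \<in> S" for s
    using that
  proof (induction "\<mu> s" arbitrary: s rule: less_induct)
    case less
    from less.prems bij obtain z where z: "z \<in> Z" "h z = s"
      by (auto simp: bij_betw_def)
    let ?r = "g z - bas s"
    have r: "?r \<in> supported {t \<in> S. \<mu> t < \<mu> s}"
      using tri[OF z(1)] z(2) by simp
    have "\<forall>t\<in>{t \<in> S. \<mu> t < \<mu> s}. \<exists>x. x \<in> supported Z \<and> lin_ext g x = bas t"
      using less.hyps by blast
    then obtain y where y: "\<forall>t\<in>{t \<in> S. \<mu> t < \<mu> s}. y t \<in> supported Z \<and> lin_ext g (y t) = bas t"
      by metis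
    \<comment> \<open>The remainder \<open>?r\<close> consists of smaller basis elements, which have
      preimages by induction; subtracting their combination from \<open>bas z\<close> removes
      it.\<close>
    have "lin_ext g (lin_ext y ?r) = lin_ext bas ?r"
      unfolding lin_ext_lin_ext by (rule lin_ext_cong) (use r y in \<open>auto simp: supported_def\<close>)
    then have "lin_ext g (bas z - lin_ext y ?r) = bas s"
      by (simp add: lin_ext_diff lin_ext_bas_id)
    moreover have "bas z - lin_ext y ?r \<in> supported Z"
      using z y by (intro supported_diff supported_lin_ext[OF r]) auto
    ultimately show ?case by blast
  qed
  then have "\<forall>s\<in>S. \<exists>x. x \<in> supported Z \<and> lin_ext g x = bas s"
    by blast
  then obtain k where k: "\<forall>s\<in>S. k s \<in> supported Z \<and> lin_ext g (k s) = bas s"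
    by metis
  \<comment> \<open>Injectivity by a leading term: choose \<open>z0\<close> of maximal measure in
    the support of \<open>x\<close>. No other \<open>g z\<close> contains \<open>h z0\<close>, since
    \<open>h\<close> is injective and remainders have smaller measure, so the coefficient of
    \<open>x\<close> at \<open>z0\<close> survives.\<close>
  have inj: "x = 0" if x: "x \<in> supported Z" and zero: "lin_ext g x = 0" for x
  proof (rule ccontr)
    assume "x \<noteq> 0"
    then have "keys x \<noteq> {}" by simp
    define n where "n = Max ((\<lambda>z. \<mu> (h z)) ` keys x)"
    have "n \<in> (\<lambda>z. \<mu> (h z)) ` keys x"
      unfolding n_def using \<open>keys x \<noteq> {}\<close> by (intro Max_in) auto
    then obtain z0 where z0: "z0 \<in> keys x" "\<mu> (h z0) = n" by auto
    have le: "\<mu> (h z) \<le> \<mu> (h z0)" if "z \<in> keys x" for z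
      unfolding z0(2) n_def using that by (intro Max_ge) auto
    have Z: "keys x \<subseteq> Z" using x by (simp add: supported_def)
    have coeff: "lookup (g z) (h z0) = (if z = z0 then 1 else 0)" if "z \<in> keys x" for z
    proof -
      have "h z0 \<notin> keys (g z - bas (h z))"
        using tri[of z] that Z le[OF that] by (force simp: supported_def)
      then have "lookup (g z) (h z0) = lookup (bas (h z)) (h z0)"
        by (simp add: in_keys_iff lookup_minus)
      also have "\<dots> = (if z = z0 then 1 else 0)"
        using bij that z0 Z by (auto simp: lookup_single when_def bij_betw_def inj_on_def)
      finally show ?thesis .
    qed
    have "lookup (lin_ext g x) (h z0) = (\<Sum>z\<in>keys x. if z = z0 then lookup x z else 0)"
      unfolding lin_ext_def lookup_sum by (rule sum.cong) (auto simp: lookup_smul coeff)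
    also have "\<dots> = lookup x z0"
      using z0 by simp
    finally show False
      using zero z0 by (simp add: in_keys_iff)
  qed
  have "lin_ext k (g z) = bas z" if z: "z \<in> Z" for z
  proof -
    have "h z \<in> S" using bij z by (auto simp: bij_betw_def)
    then have "(g z - bas (h z)) + bas (h z) \<in> supported S"
      by (intro supported_add supported_mono[OF _ tri[OF z]]) auto
    then have gz: "g z \<in> supported S" by simp
    \<comment> \<open>The family \<open>k\<close> is so far a right inverse; injectivity turns it
      into a left inverse.\<close>
    have "lin_ext g (lin_ext k (g z)) = lin_ext bas (g z)"
      unfolding lin_ext_lin_ext by (rule lin_ext_cong) (use k gz in \<open>auto simp: supported_def\<close>)
    then have "lin_ext g (lin_ext k (g z) - bas z) = 0"
      by (simp add: lin_ext_diff lin_ext_bas_id)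
    moreover have "lin_ext k (g z) - bas z \<in> supported Z"
      using k z by (intro supported_diff supported_lin_ext[OF gz]) auto
    ultimately show ?thesis
      using inj by fastforce
  qed
  with k show thesis by (intro that) auto
qed

section \<open>A basis of the tensor algebra adapted to iterated commutators\<close>

lemma supported_mult_general:
  "x \<in> supported X \<Longrightarrow> y \<in> supported Y \<Longrightarrow> (\<And>u v. u \<in> X \<Longrightarrow> v \<in> Y \<Longrightarrow> u @ v \<in> S) \<Longrightarrow> x * y \<in> supported S"
  using keys_mult[of x y] by (fastforce simp: supported_def plus_list_def)

text \<open>Both factors are split as leading word plus remainder. The relation stays abstract
  because it is used for \<open>moved\<close> (commutators) and for \<open>longer\<close> (the
  substitution \<open>phi\<close>).\<close>

lemma leading_word_mult:
  assumes x: "x - bas s \<in> supported {t. R t s}" and y: "y - bas s' \<in> supported {t. R t s'}"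
    and "\<And>t. R t s \<Longrightarrow> R (t @ s') (s @ s')" "\<And>t'. R t' s' \<Longrightarrow> R (s @ t') (s @ s')"
    and "\<And>t t'. R t s \<Longrightarrow> R t' s' \<Longrightarrow> R (t @ t') (s @ s')"
  shows "x * y - bas (s @ s') \<in> supported {t. R t (s @ s')}"
proof -
  have "x * y - bas (s @ s') = (x - bas s) * bas s' + bas s * (y - bas s') + (x - bas s) * (y - bas s')"
    by (simp add: algebra_simps flip: bas_mult_bas)
  moreover have "(x - bas s) * bas s' \<in> supported {t. R t (s @ s')}"
    by (rule supported_mult_general[OF x supported_bas[of s' "{s'}"]]) (auto intro: assms)
  moreover have "bas s * (y - bas s') \<in> supported {t. R t (s @ s')}"
    by (rule supported_mult_general[OF supported_bas[of s "{s}"] y]) (auto intro: assms)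
  moreover have "(x - bas s) * (y - bas s') \<in> supported {t. R t (s @ s')}"
    by (rule supported_mult_general[OF x y]) (auto intro: assms)
  ultimately show ?thesis by (simp add: supported_add)
qed

lemma is_linear_gcomm_left [linear_intros]: "is_linear f \<Longrightarrow> is_linear (\<lambda>x. gcomm dg (f x) y)"
  unfolding gcomm_def by (intro linear_intros)

lemma is_linear_gcomm_right [linear_intros]: "is_linear f \<Longrightarrow> is_linear (\<lambda>y. gcomm dg x (f y))"
  unfolding gcomm_def by (rule is_linear_lin_ext_fun) (intro linear_intros)

lemma gcomm_bas_homog:
  assumes "homog dg n x"
  shows "gcomm dg (bas v) x = bas v * x - smul (ksign (dg v * n)) (x * bas v)"
proof (rule linear_eqI[where x = x])
  fix u assume "u \<in> keys x"
  with assms have "dg u = n" by (simp add: homog_def)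
  then show "gcomm dg (bas v) (bas u) = bas v * bas u - smul (ksign (dg v * n)) (bas u * bas v)"
    by (simp add: gcomm_def bas_mult_bas)
qed (intro linear_intros)+

section \<open>Iterated commutators of letters and the cutting of words into blocks\<close>

abbreviation letters :: "'v set \<Rightarrow> 'w set \<Rightarrow> ('v + 'w) set" where "letters \<equiv> Sum_Type.Plus"

definition ad_word :: "('v + 'w \<Rightarrow> int) \<Rightarrow> 'v list \<times> 'w \<Rightarrow> (('v + 'w) list \<Rightarrow>\<^sub>0 'r::comm_ring_1)"
  where "ad_word dg = (\<lambda>(u, w). foldr (\<lambda>a. gcomm (word_degree dg) (bas [Inl a])) u (bas [Inr w]))"

definition ad_monomial ::
  "('v + 'w \<Rightarrow> int) \<Rightarrow> ('v list \<times> 'w) list \<times> 'v list \<Rightarrow> (('v + 'w) list \<Rightarrow>\<^sub>0 'r::comm_ring_1)"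
  where "ad_monomial dg = (\<lambda>(ys, u). prod_list (map (ad_word dg) ys) * bas (map Inl u))"

text \<open>The leading word of \<open>ad_word\<close> at the same index.\<close>

definition block :: "'v list \<times> 'w \<Rightarrow> ('v + 'w) list"
  where "block = (\<lambda>(u, w). map Inl u @ [Inr w])"

definition blocks :: "('v list \<times> 'w) list \<times> 'v list \<Rightarrow> ('v + 'w) list"
  where "blocks = (\<lambda>(ys, u). concat (map block ys) @ map Inl u)"

text \<open>Cuts a word after each right letter; the left letters behind the last right letter form
  the trailing word. That this factorization is unique makes the adapted monomials correspond to all
  words.\<close>

fun parse :: "('v + 'w) list \<Rightarrow> ('v list \<times> 'w) list \<times> 'v list" where
  "parse [] = ([], [])"
| "parse (Inl a # x) =
    (case parse x of ([], u) \<Rightarrow> ([], a # u) | ((u', w) # ys, u) \<Rightarrow> ((a # u', w) # ys, u))"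
| "parse (Inr w # x) = (case parse x of (ys, u) \<Rightarrow> (([], w) # ys, u))"

lemma blocks_parse: "blocks (parse x) = x"
  by (induction x rule: parse.induct) (auto simp: blocks_def block_def split: prod.splits list.splits)

lemma parse_append_block: "parse (map Inl u @ Inr w # x) = ((u, w) # fst (parse x), snd (parse x))"
  by (induction u) (auto split: prod.splits)

lemma parse_map_Inl: "parse (map Inl u) = ([], u)"
  by (induction u) auto

lemma parse_blocks: "parse (blocks z) = z"
proof (cases z)
  case (Pair ys u)
  have "parse (concat (map block ys) @ map Inl u) = (ys, u)"
    by (induction ys) (auto simp: parse_map_Inl parse_append_block block_def)
  then show ?thesis by (simp add: Pair blocks_def)
qed

lemma parse_mem:
  "x \<in> lists (letters A B) \<Longrightarrow> parse x \<in> lists (lists A \<times> B) \<times> lists A"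
  by (induction x rule: parse.induct) (auto split: prod.splits list.splits, fastforce+)

lemma block_mem: "p \<in> lists A \<times> B \<Longrightarrow> block p \<in> lists (letters A B)"
  by (auto simp: block_def)

lemma blocks_mem: "z \<in> lists (lists A \<times> B) \<times> lists A \<Longrightarrow> blocks z \<in> lists (letters A B)"
  using block_mem[of _ A B] by (fastforce simp: blocks_def)

lemma bij_betw_blocks: "bij_betw blocks (lists (lists A \<times> B) \<times> lists A) (lists (letters A B))"
  by (intro bij_betw_byWitness[where f' = parse] ballI image_subsetI parse_mem blocks_mem)
    (simp_all only: blocks_parse parse_blocks)

section \<open>The measure for moving left letters to the right\<close>

definition num_left :: "('v + 'w) list \<Rightarrow> nat" where "num_left x = length (filter isl x)"

definition num_right :: "('v + 'w) list \<Rightarrow> nat" where "num_right x = length (filter (\<lambda>a. \<not> isl a) x)"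

text \<open>Moving left letters to the right, as the second term of a commutator does, decreases this count.\<close>

fun num_left_right :: "('v + 'w) list \<Rightarrow> nat" where
  "num_left_right [] = 0"
| "num_left_right (a # x) = (if isl a then num_right x else 0) + num_left_right x"

lemma num_append [simp]:
  "num_left (x @ y) = num_left x + num_left y" "num_right (x @ y) = num_right x + num_right y"
  by (simp_all add: num_left_def num_right_def)

lemma num_Cons [simp]:
  "num_left (a # x) = (if isl a then 1 else 0) + num_left x"
  "num_right (a # x) = (if isl a then 0 else 1) + num_right x"
  "num_left [] = 0" "num_right [] = 0"
  by (simp_all add: num_left_def num_right_def)

text \<open>A pair of a left letter before a right letter lies in \<open>x\<close>, lies in
  \<open>y\<close>, or straddles the cut.\<close>

lemma num_left_right_append [simp]:
  "num_left_right (x @ y) = num_left_right x + num_left_right y + num_left x * num_right y"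
  by (induction x) (auto simp: algebra_simps)

text \<open>The letter counts are fixed as well, because the measure of a concatenation involves
  \<open>num_left x * num_right y\<close>; with equal counts this cross term is unchanged and the
  relation is stable under concatenation.\<close>

definition moved :: "('v + 'w) set \<Rightarrow> ('v + 'w) list \<Rightarrow> ('v + 'w) list \<Rightarrow> bool"
  where "moved X t s \<longleftrightarrow> t \<in> lists X \<and> num_left t = num_left s \<and> num_right t = num_right s
    \<and> num_left_right t < num_left_right s"

lemma moved_append:
  "moved X t s \<Longrightarrow> s' \<in> lists X \<Longrightarrow> moved X (t @ s') (s @ s')"
  "moved X t' s' \<Longrightarrow> s \<in> lists X \<Longrightarrow> moved X (s @ t') (s @ s')"
  "moved X t s \<Longrightarrow> moved X t' s' \<Longrightarrow> moved X (t @ t') (s @ s')"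
  by (auto simp: moved_def)

lemma leading_word_mult_moved:
  assumes "s \<in> lists X" "s' \<in> lists X"
    and "x - bas s \<in> supported {t. moved X t s}" "y - bas s' \<in> supported {t. moved X t s'}"
  shows "x * y - bas (s @ s') \<in> supported {t. moved X t (s @ s')}"
  by (rule leading_word_mult[OF assms(3,4)]) (rule moved_append, assumption, rule assms | rule moved_append, assumption+)+

section \<open>Leading words of commutators and of their products\<close>

lemma homog_ad_word:
  fixes dg :: "'v + 'w \<Rightarrow> int"
  shows "homog (word_degree dg) (word_degree dg (block p)) (ad_word dg p :: _ \<Rightarrow>\<^sub>0 'r::comm_ring_1)"
proof (cases p)
  case (Pair u w)
  have "homog (word_degree dg) (word_degree dg (block (u, w))) (ad_word dg (u, w) :: _ \<Rightarrow>\<^sub>0 'r)"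
  proof (induction u)
    case (Cons a u)
    let ?y = "ad_word dg (u, w) :: ('v + 'w) list \<Rightarrow>\<^sub>0 'r"
    have "homog (word_degree dg) (word_degree dg [Inl a] + word_degree dg (block (u, w)))
        (bas [Inl a] * ?y)"
      by (rule homog_mult[OF _ Cons.IH]) simp
    moreover have "homog (word_degree dg) (word_degree dg (block (u, w)) + word_degree dg [Inl a])
        (?y * bas [Inl a])"
      by (rule homog_mult[OF Cons.IH]) simp
    ultimately have "homog (word_degree dg) (word_degree dg (block (a # u, w)))
        (gcomm (word_degree dg) (bas [Inl a]) ?y)"
      unfolding gcomm_bas_homog[OF Cons.IH]
      by (intro homog_diff homog_smul) (simp_all add: block_def add.commute add.left_commute)
    then show ?case by (simp add: ad_word_def)
  qed (simp add: ad_word_def block_def)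
  with Pair show ?thesis by simp
qed

lemma ad_word_Cons:
  "ad_word dg (a # u, w) = bas [Inl a] * ad_word dg (u, w)
    - smul (ksign (dg (Inl a) * word_degree dg (block (u, w)))) (ad_word dg (u, w) * bas [Inl a])"
  using gcomm_bas_homog[OF homog_ad_word, of dg "[Inl a]" "(u, w)"] by (simp add: ad_word_def)

text \<open>In the commutator of \<open>a\<close> with \<open>y\<close> the product
  \<open>a y\<close> carries the leading word. In \<open>y a\<close> the letter \<open>a\<close>
  stands behind the single right letter of the block, which lowers the measure.\<close>

lemma leading_ad_word:
  fixes dg :: "'v + 'w \<Rightarrow> int"
  assumes "p \<in> lists A \<times> B"
  shows "(ad_word dg p :: _ \<Rightarrow>\<^sub>0 'r::comm_ring_1) - bas (block p) \<in> supported {t. moved (letters A B) t (block p)}"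
proof (cases p)
  case (Pair u w)
  have "(ad_word dg (u, w) :: _ \<Rightarrow>\<^sub>0 'r) - bas (block (u, w)) \<in> supported {t. moved (letters A B) t (block (u, w))}"
    if "u \<in> lists A" "w \<in> B"
    using that(1)
  proof (induction u)
    case (Cons a u)
    let ?X = "letters A B" and ?s = "block (u, w)" and ?y = "ad_word dg (u, w) :: ('v + 'w) list \<Rightarrow>\<^sub>0 'r"
    have s: "?s \<in> lists ?X" using Cons \<open>w \<in> B\<close> by (intro block_mem) auto
    have IH: "?y - bas ?s \<in> supported {t. moved ?X t ?s}" by (rule Cons.IH)
    have "bas [Inl a] * ?y - bas ([Inl a] @ ?s) \<in> supported {t. moved ?X t ([Inl a] @ ?s)}"
      by (rule leading_word_mult_moved) (use Cons s IH in auto)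
    \<comment> \<open>The second term of the commutator is split at the leading word
      \<open>?s\<close> of \<open>?y\<close>, since the induction hypothesis speaks of the remainder
      only.\<close>
    moreover have "(?y - bas ?s) * bas [Inl a] \<in> supported {t. moved ?X t ([Inl a] @ ?s)}"
      by (rule supported_mult_general[OF IH supported_bas[of "[Inl a]" "{[Inl a]}"]])
        (use Cons.hyps in \<open>auto simp: moved_def\<close>)
    moreover have "(bas (?s @ [Inl a]) :: _ \<Rightarrow>\<^sub>0 'r) \<in> supported {t. moved ?X t ([Inl a] @ ?s)}"
      by (rule supported_bas) (use Cons.hyps s in \<open>auto simp: moved_def block_def\<close>)
    ultimately have "(bas [Inl a] * ?y - bas ([Inl a] @ ?s))
        - smul (ksign (dg (Inl a) * word_degree dg ?s)) ((?y - bas ?s) * bas [Inl a] + bas (?s @ [Inl a]))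
        \<in> supported {t. moved ?X t ([Inl a] @ ?s)}"
      by (rule supported_diff[OF _ supported_smul[OF supported_add]])
    moreover have "(?y - bas ?s) * bas [Inl a] + bas (?s @ [Inl a]) = ?y * bas [Inl a]"
      by (simp add: left_diff_distrib bas_mult_bas)
    moreover have "[Inl a] @ ?s = block (a # u, w)"
      by (simp add: block_def)
    ultimately show ?case
      by (simp only: ad_word_Cons diff_right_commute)
  qed (simp add: ad_word_def block_def)
  with Pair assms show ?thesis by simp
qed

lemma leading_ad_monomial:
  fixes dg :: "'v + 'w \<Rightarrow> int"
  assumes "z \<in> lists (lists A \<times> B) \<times> lists A"
  shows "(ad_monomial dg z :: _ \<Rightarrow>\<^sub>0 'r::comm_ring_1) - bas (blocks z) \<in> supported {t. moved (letters A B) t (blocks z)}"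
proof (cases z)
  case (Pair ys u)
  let ?X = "letters A B"
  have "prod_list (map (ad_word dg) ys) * bas (map Inl u) - (bas (concat (map block ys) @ map Inl u) :: _ \<Rightarrow>\<^sub>0 'r)
      \<in> supported {t. moved ?X t (concat (map block ys) @ map Inl u)}"
    if "ys \<in> lists (lists A \<times> B)" "u \<in> lists A"
    using that(1)
  proof (induction ys)
    case (Cons p ys)
    let ?t = "concat (map block ys) @ map Inl u"
    have "?t \<in> lists ?X" using blocks_mem[of "(ys, u)" A B] Cons that(2) by (simp add: blocks_def)
    moreover have "block p \<in> lists ?X" using Cons by (intro block_mem) auto
    ultimately have "ad_word dg p * (prod_list (map (ad_word dg) ys) * bas (map Inl u)) - (bas (block p @ ?t) :: _ \<Rightarrow>\<^sub>0 'r)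
        \<in> supported {t. moved ?X t (block p @ ?t)}"
      by (intro leading_word_mult_moved leading_ad_word Cons)
    then show ?case by (simp add: mult.assoc)
  qed simp
  with Pair assms show ?thesis by (simp add: ad_monomial_def blocks_def)
qed

lemma ad_monomial_inverse:
  fixes dg :: "'v + 'w \<Rightarrow> int"
  obtains k :: "('v + 'w) list \<Rightarrow> (('v list \<times> 'w) list \<times> 'v list \<Rightarrow>\<^sub>0 'r::comm_ring_1)"
  where "\<And>s. s \<in> lists (letters A B) \<Longrightarrow> k s \<in> supported (lists (lists A \<times> B) \<times> lists A)"
    "\<And>s. s \<in> lists (letters A B) \<Longrightarrow> lin_ext (ad_monomial dg) (k s) = bas s"
    "\<And>z. z \<in> lists (lists A \<times> B) \<times> lists A \<Longrightarrow> lin_ext k (ad_monomial dg z) = bas z"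
proof -
  let ?g = "ad_monomial dg :: _ \<Rightarrow> (('v + 'w) list \<Rightarrow>\<^sub>0 'r)"
  have "?g z - bas (blocks z) \<in> supported {s \<in> lists (letters A B). num_left_right s < num_left_right (blocks z)}"
    if "z \<in> lists (lists A \<times> B) \<times> lists A" for z
    by (rule supported_mono[OF _ leading_ad_monomial[OF that]]) (auto simp: moved_def)
  from unitriangular_inverse[OF bij_betw_blocks this] that show thesis by metis
qed

lemma supported_ad_monomial:
  assumes "z \<in> lists (lists A \<times> B) \<times> lists A"
  shows "(ad_monomial dg z :: _ \<Rightarrow>\<^sub>0 'r::comm_ring_1) \<in> supported (lists (letters A B))"
proof -
  have "(ad_monomial dg z :: _ \<Rightarrow>\<^sub>0 'r) - bas (blocks z) \<in> supported (lists (letters A B))"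
    by (rule supported_mono[OF _ leading_ad_monomial[OF assms]]) (auto simp: moved_def)
  from supported_add[OF this supported_bas[OF blocks_mem[OF assms]]] show ?thesis by simp
qed

lemma homog_ad_monomial:
  "homog (word_degree dg) (word_degree dg (blocks z)) (ad_monomial dg z :: _ \<Rightarrow>\<^sub>0 'r::comm_ring_1)"
proof (cases z)
  case (Pair ys u)
  have "homog (word_degree dg) (word_degree dg (concat (map block ys) @ map Inl u))
      (prod_list (map (ad_word dg) ys) * bas (map Inl u) :: _ \<Rightarrow>\<^sub>0 'r)"
    by (induction ys) (auto intro!: homog_mult homog_ad_word simp: mult.assoc add.assoc)
  with Pair show ?thesis by (simp add: ad_monomial_def blocks_def)
qed

section \<open>The span of the iterated commutators\<close>

lemma lin_ext_in_subspace:
  assumes "pm.subspace N" "\<And>a. a \<in> keys x \<Longrightarrow> g a \<in> N"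
  shows "lin_ext g x \<in> N"
  unfolding lin_ext_def using assms by (intro pm.subspace_sum pm.subspace_scale)

lemma subspace_lin_ext_image: "pm.subspace (lin_ext g ` supported X)"
proof (rule pm.subspaceI)
  show "0 \<in> lin_ext g ` supported X"
    using lin_ext_zero[of g] by (intro image_eqI[of _ _ 0]) auto
  show "x + y \<in> lin_ext g ` supported X"
    if "x \<in> lin_ext g ` supported X" "y \<in> lin_ext g ` supported X" for x y
    using that by (auto simp: supported_add simp flip: lin_ext_add)
  show "smul c x \<in> lin_ext g ` supported X" if "x \<in> lin_ext g ` supported X" for c x
    using that by (auto simp: supported_smul simp flip: lin_ext_smul)
qed

text \<open>The sets \<open>V\<close> and \<open>W\<close> contain all linear combinations of
  letters; bilinearity of the commutator reduces brackets of such combinations to brackets of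
  letters. This brings the span into the form required by
  \<open>tensor_presentation\<close>.\<close>

lemma ad_span_eq_image:
  fixes dg :: "'v + 'w \<Rightarrow> int" and A :: "'v set" and B :: "'w set"
  defines "V \<equiv> supported {[Inl a] | a. a \<in> A}" and "W \<equiv> supported {[Inr b] | b. b \<in> B}"
  shows "ad_span (word_degree dg) V W = lin_ext (ad_word dg) ` (supported (lists A \<times> B) :: (_ \<Rightarrow>\<^sub>0 'r::comm_ring_1) set)"
proof
  let ?N = "lin_ext (ad_word dg) ` (supported (lists A \<times> B) :: ('v list \<times> 'w \<Rightarrow>\<^sub>0 'r) set)"
  have N: "pm.subspace ?N" by (rule subspace_lin_ext_image)
  have adN: "ad_word dg p \<in> ?N" if "p \<in> lists A \<times> B" for p
    using that by (intro image_eqI[of _ _ "bas p"]) auto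
  have "x \<in> ?N" if "x \<in> iterated_commutators (word_degree dg) V W" for x
    using that
  proof induction
    case (base w)
    have "lin_ext bas w \<in> ?N"
    proof (rule lin_ext_in_subspace[OF N])
      fix a assume "a \<in> keys w"
      then obtain b where "a = [Inr b]" "b \<in> B"
        using base by (auto simp: W_def supported_def)
      then show "bas a \<in> ?N" using adN[of "([], b)"] by (simp add: ad_word_def)
    qed
    then show ?case by (simp add: lin_ext_bas_id)
  next
    case (step v x)
    from step.IH obtain y where y: "y \<in> supported (lists A \<times> B)" "x = lin_ext (ad_word dg) y" by auto
    have "lin_ext (\<lambda>c. gcomm (word_degree dg) (bas c) x) v \<in> ?N"
    proof (rule lin_ext_in_subspace[OF N])
      fix c assume "c \<in> keys v"
      then obtain a where a: "c = [Inl a]" "a \<in> A"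
        using step by (auto simp: V_def supported_def)
      have "gcomm (word_degree dg) (bas c) x = lin_ext (\<lambda>p. gcomm (word_degree dg) (bas c) (ad_word dg p)) y"
        unfolding y(2) by (rule linear_eqI[where x = y]) (auto intro!: linear_intros)
      also have "\<dots> \<in> ?N"
      proof (rule lin_ext_in_subspace[OF N])
        fix p assume "p \<in> keys y"
        then have p: "p \<in> lists A \<times> B" using y by (auto simp: supported_def)
        have "gcomm (word_degree dg) (bas c) (ad_word dg p) = ad_word dg (a # fst p, snd p)"
          by (simp add: a ad_word_def split: prod.splits)
        also have "\<dots> \<in> ?N" using p a by (intro adN) auto
        finally show "gcomm (word_degree dg) (bas c) (ad_word dg p) \<in> ?N" .
      qed
      finally show "gcomm (word_degree dg) (bas c) x \<in> ?N" .
    qed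
    then show ?case
      by (simp flip: linear_eq_lin_ext[OF is_linear_gcomm_left[OF is_linear_ident]])
  qed
  then show "ad_span (word_degree dg) V W \<subseteq> ?N"
    unfolding ad_span_def by (intro pm.span_minimal N) auto
  have "ad_word dg (u, w) \<in> iterated_commutators (word_degree dg) V W" if "u \<in> lists A" "w \<in> B" for u w
    using that(1)
    by (induction u) (use that(2) in \<open>auto simp: ad_word_def V_def W_def intro: iterated_commutators.intros\<close>)
  then have ad: "ad_word dg p \<in> iterated_commutators (word_degree dg) V W" if "p \<in> lists A \<times> B" for p
    using that by auto
  show "?N \<subseteq> ad_span (word_degree dg) V W"
  proof (rule image_subsetI)
    fix y :: "'v list \<times> 'w \<Rightarrow>\<^sub>0 'r" assume "y \<in> supported (lists A \<times> B)"
    then have "ad_word dg p \<in> iterated_commutators (word_degree dg) V W" if "p \<in> keys y" for p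
      using that by (intro ad) (auto simp: supported_def)
    then show "lin_ext (ad_word dg) y \<in> ad_span (word_degree dg) V W"
      unfolding ad_span_def by (intro lin_ext_in_subspace[OF pm.subspace_span] pm.span_base)
  qed
qed

section \<open>The coaction on the path-loop construction\<close>

text \<open>Serves for maps such as \<open>aw_comult\<close>, whose linearity is known only on the
  words in a given alphabet.\<close>

lemma linear_on_supported:
  assumes add: "\<And>x y. x \<in> supported S \<Longrightarrow> y \<in> supported S \<Longrightarrow> f (x + y) = f x + f y"
    and smul: "\<And>r x. x \<in> supported S \<Longrightarrow> f (smul r x) = smul r (f x)"
    and x: "x \<in> supported S"
  shows "f x = lin_ext (\<lambda>a. f (bas a)) x"
proof -
  have zero: "f 0 = 0" using add[of 0 0] by simp
  have "(\<Sum>a\<in>K. smul (lookup x a) (bas a)) \<in> supported S \<and>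
      f (\<Sum>a\<in>K. smul (lookup x a) (bas a)) = (\<Sum>a\<in>K. smul (lookup x a) (f (bas a)))"
    if "finite K" "K \<subseteq> S" for K
    using that by (induction K) (auto simp: zero add smul supported_add supported_smul)
  from this[of "keys x"] x have "f (\<Sum>a\<in>keys x. smul (lookup x a) (bas a)) = lin_ext (\<lambda>a. f (bas a)) x"
    by (auto simp: supported_def lin_ext_def)
  then show ?thesis using poly_mapping_decomp[of "keys x" x] by simp
qed

text \<open>The only factorizations of a one-letter word are \<open>[] @ [a]\<close> and
  \<open>[a] @ []\<close>.\<close>

lemma lookup_mult_letter:
  fixes x y :: "'a list \<Rightarrow>\<^sub>0 'r::comm_ring_1"
  shows "lookup (x * y) [a] = lookup x [] * lookup y [a] + lookup x [a] * lookup y []"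
proof -
  have sum: "lookup (x * y) [a] = (\<Sum>u\<in>keys x. \<Sum>v\<in>keys y. lookup x u * lookup y v * (if u @ v = [a] then 1 else 0))"
  proof -
    have "x * y = (\<Sum>u\<in>keys x. smul (lookup x u) (bas u)) * (\<Sum>v\<in>keys y. smul (lookup y v) (bas v))"
      using poly_mapping_decomp[of "keys x" x] poly_mapping_decomp[of "keys y" y] by simp
    also have "\<dots> = (\<Sum>u\<in>keys x. \<Sum>v\<in>keys y. smul (lookup x u * lookup y v) (bas (u @ v)))"
      by (simp add: sum_product smul_mult_left smul_mult_right bas_mult_bas mult.commute)
    finally show ?thesis
      by (simp add: lookup_sum lookup_smul lookup_single when_def)
  qed
  have "(\<Sum>u\<in>keys x. \<Sum>v\<in>keys y. lookup x u * lookup y v * (if u @ v = [a] then 1 else 0))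
    = (\<Sum>u\<in>keys x. \<Sum>v\<in>keys y. (if u = [] then lookup x u else 0) * (if v = [a] then lookup y v else 0)
        + (if u = [a] then lookup x u else 0) * (if v = [] then lookup y v else 0))"
    by (intro sum.cong) (auto simp: append_eq_Cons_conv)
  also have "\<dots> = (\<Sum>u\<in>keys x. if u = [] then lookup x u else 0) * (\<Sum>v\<in>keys y. if v = [a] then lookup y v else 0)
     + (\<Sum>u\<in>keys x. if u = [a] then lookup x u else 0) * (\<Sum>v\<in>keys y. if v = [] then lookup y v else 0)"
    by (simp only: sum_product sum.distrib)
  also have "\<dots> = lookup x [] * lookup y [a] + lookup x [a] * lookup y []"
    by (auto simp: in_keys_iff)
  finally show ?thesis using sum by simp
qed

definition total_degree :: "('a \<Rightarrow> int) \<Rightarrow> ('b \<Rightarrow> int) \<Rightarrow> 'a \<times> 'b \<Rightarrow> int"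
  where "total_degree dg dg' = (\<lambda>(u, v). dg u + dg' v)"

lemma supported_tmult2:
  assumes "x \<in> supported (lists X \<times> lists Y)" "y \<in> supported (lists X \<times> lists Y)"
  shows "tmult2 dg dg' x y \<in> supported (lists X \<times> lists Y)"
  unfolding tmult2_def split_def
  by (intro supported_lin_ext[OF assms(1)] supported_lin_ext[OF assms(2)] supported_smul supported_bas) auto

lemma homog_tmult2:
  fixes dg :: "'a \<Rightarrow> int" and dg' :: "'b \<Rightarrow> int"
  defines "d \<equiv> total_degree (word_degree dg) (word_degree dg')"
  assumes "homog d m x" "homog d n y"
  shows "homog d (m + n) (tmult2 (word_degree dg) (word_degree dg') x y)"
  using assms(2,3) unfolding homog_conv_supported tmult2_def split_def
  by (auto simp: d_def total_degree_def intro!: supported_lin_ext[of x] supported_lin_ext[of y] supported_smul supported_bas)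

lemma tmult2_one_right: "tmult2 (word_degree dg) (word_degree dg') x (bas ([], [])) = x"
  by (rule linear_eqI[where x = x]) (auto intro!: linear_intros simp: tmult2_bas)

section \<open>The comultiplication of the cobar construction\<close>

locale aw =
  fixes C :: "('b, 'r::comm_ring_1) coalg"
    and \<Psi> :: "('b list \<Rightarrow>\<^sub>0 'r) \<Rightarrow> (('b \<times> 'b) list \<Rightarrow>\<^sub>0 'r)"
  assumes AW: "AW_coalgebra C \<Psi>"
    and conn: "\<forall>b\<in>cbasis C. cdeg C b \<noteq> 1 \<and> cdeg C b \<noteq> 2"
begin

abbreviation dC :: "'b list \<Rightarrow> int" where "dC \<equiv> word_degree (ldeg C)"

abbreviation dP :: "('b + 'b) list \<Rightarrow> int" where "dP \<equiv> word_degree (ldeg (path_coalg C))"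

abbreviation L :: "'b set" where "L \<equiv> pbasis C"

abbreviation X :: "('b + 'b) set" where "X \<equiv> letters L L"

text \<open>\<open>\<Psi>\<close>, and hence \<open>aw_comult\<close>, is controlled only on
  \<open>cobar C\<close>. This replacement agrees with \<open>aw_comult\<close> there and is linear
  everywhere, so that \<open>linear_eqI\<close> applies.\<close>

definition psi :: "('b list \<Rightarrow>\<^sub>0 'r) \<Rightarrow> ('b list \<times> 'b list \<Rightarrow>\<^sub>0 'r)"
  where "psi = lin_ext (\<lambda>w. aw_comult C \<Psi> (bas w))"

lemma chain_map: "chain_algebra_map C (tensor_coalg C C) \<Psi>"
  and chain_coalgebra: "chain_coalgebra C"
  using AW by (auto simp: AW_coalgebra_def simply_connected_def)

lemma ldeg_ge_2: "b \<in> L \<Longrightarrow> 2 \<le> ldeg C b"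
  using chain_coalgebra conn unfolding chain_coalgebra_def pbasis_def ldeg_def
  by (smt (verit) DiffE insertI1)

lemma ldeg_path [simp]:
  "ldeg (path_coalg C) (Inl b) = ldeg C b" "ldeg (path_coalg C) (Inr b) = ldeg C b - 1"
  by (simp_all add: ldeg_def path_coalg_def)

lemma pbasis_path: "pbasis (path_coalg C) = X"
  by (auto simp: pbasis_def path_coalg_def)

text \<open>Here the absence of degree 2 enters: a letter \<open>Inr b\<close> is desuspended twice
  and still has degree at least 1, so the length of a word is bounded by its degree.\<close>

lemma ldeg_path_pos: "a \<in> X \<Longrightarrow> 1 \<le> ldeg (path_coalg C) a"
  using ldeg_ge_2 by fastforce

lemma cobar_eq: "cobar C = supported (lists L)"
  by (simp add: cobar_def)

lemma dP_map_Inl [simp]: "dP (map Inl w) = dC w"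
  by (induction w) auto

lemma milgram_mult: "milgram C (x * y) = tmult2 dC dC (milgram C x) (milgram C y)"
  unfolding milgram_def tmult_conv_tmult2 by (rule alg_ext_tmult2)

lemma is_linear_milgram: "is_linear (milgram C)"
  unfolding milgram_def by (intro linear_intros)

text \<open>A letter survives only if one of its entries is the unit; as the unit has degree 0,
  dropping it preserves the degree.\<close>

lemma milgram_word:
  assumes "w \<in> lists (pbasis (tensor_coalg C C))"
  shows "milgram C (bas w) \<in> supported (lists L \<times> lists L)
    \<and> homog (total_degree dC dC) (wdeg (tensor_coalg C C) w) (milgram C (bas w))"
  using assms
proof (induction w)
  case Nil
  then show ?case by (simp add: milgram_def total_degree_def)
next
  case (Cons a w)
  obtain c d where a: "a = (c, d)" by (cases a)
  have deg_unit: "cdeg C (cunit C) = 0"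
    using chain_coalgebra by (auto simp: chain_coalgebra_def)
  have letter: "milgram C (bas [a]) \<in> supported (lists L \<times> lists L)
      \<and> homog (total_degree dC dC) (ldeg (tensor_coalg C C) a) (milgram C (bas [a]))"
    using Cons.hyps(1)
    by (auto simp: a milgram_def alg_ext_bas tmult_conv_tmult2 tmult2_one_right pbasis_def tensor_coalg_def
        total_degree_def ldeg_def deg_unit)
  show ?case
    unfolding bas_Cons[of a w] milgram_mult
    using letter Cons.IH by (auto intro: supported_tmult2 homog_tmult2)
qed

lemma psi_eq:
  assumes "x \<in> cobar C"
  shows "aw_comult C \<Psi> x = psi x"
  unfolding psi_def
  by (rule linear_on_supported[OF _ _ assms[unfolded cobar_eq]])
    (use chain_map in \<open>auto simp: chain_algebra_map_def aw_comult_def cobar_eq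
      linear_add[OF is_linear_milgram] linear_smul[OF is_linear_milgram]\<close>)

lemma is_linear_psi [linear_intros]: "is_linear f \<Longrightarrow> is_linear (\<lambda>x. psi (f x))"
  unfolding psi_def by (intro linear_intros)

lemma psi_mult:
  assumes "x \<in> cobar C" "y \<in> cobar C"
  shows "psi (x * y) = tmult2 dC dC (psi x) (psi y)"
proof -
  have "x * y \<in> cobar C" using assms by (simp add: cobar_eq supported_mult)
  then show ?thesis
    using assms chain_map
    by (simp add: chain_algebra_map_def aw_comult_def milgram_mult flip: psi_eq)
qed

lemma psi_one: "psi 1 = bas ([], [])"
proof -
  have "(1 :: 'b list \<Rightarrow>\<^sub>0 'r) \<in> cobar C" by (simp add: cobar_eq supported_one)
  then show ?thesis
    using chain_map by (simp add: chain_algebra_map_def aw_comult_def milgram_def flip: psi_eq)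
qed

lemma psi_word:
  assumes "w \<in> lists L"
  shows "psi (bas w) \<in> supported (lists L \<times> lists L)" "homog (total_degree dC dC) (dC w) (psi (bas w))"
proof -
  let ?D = "tensor_coalg C C"
  have w: "bas w \<in> cobar C" using assms by (simp add: cobar_eq)
  have "\<Psi> (bas w) \<in> cobar ?D" "homog (wdeg ?D) (dC w) (\<Psi> (bas w))"
    using chain_map w by (auto simp: chain_algebra_map_def)
  then have keys: "v \<in> lists (pbasis ?D)" "wdeg ?D v = dC w" if "v \<in> keys (\<Psi> (bas w))" for v
    using that by (auto simp: cobar_def supported_def homog_def)
  have eq: "psi (bas w) = lin_ext (\<lambda>v. milgram C (bas v)) (\<Psi> (bas w))"
    using w by (simp add: aw_comult_def flip: psi_eq linear_eq_lin_ext[OF is_linear_milgram])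
  show "psi (bas w) \<in> supported (lists L \<times> lists L)"
    unfolding eq by (rule supported_lin_ext[of _ "keys (\<Psi> (bas w))"])
      (use keys milgram_word in \<open>auto simp: supported_def\<close>)
  show "homog (total_degree dC dC) (dC w) (psi (bas w))"
    unfolding eq homog_conv_supported
  proof (rule supported_lin_ext)
    show "\<Psi> (bas w) \<in> supported (keys (\<Psi> (bas w)))" by (simp add: supported_def)
    show "milgram C (bas v) \<in> supported {a. total_degree dC dC a = dC w}" if "v \<in> keys (\<Psi> (bas w))" for v
      using milgram_word[OF keys(1)[OF that]] keys(2)[OF that] by (simp add: homog_conv_supported)
  qed
qed

lemma psi_supported: "x \<in> cobar C \<Longrightarrow> psi x \<in> supported (lists L \<times> lists L)"
  unfolding linear_eq_lin_ext[OF is_linear_psi[OF is_linear_ident], of x] cobar_eq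
  by (rule supported_lin_ext) (auto intro: psi_word)

lemma component_psi:
  assumes "x \<in> cobar C"
  shows "component (total_degree dC dC) n (psi x) = psi (component dC n x)"
  unfolding psi_def
proof (rule component_lin_ext)
  fix w assume "w \<in> keys x"
  then have "w \<in> lists L" using assms by (auto simp: cobar_eq supported_def)
  moreover from this have "bas w \<in> cobar C" by (simp add: cobar_eq)
  ultimately show "homog (total_degree dC dC) (dC w) (aw_comult C \<Psi> (bas w))"
    by (simp add: psi_eq psi_word)
qed

section \<open>Primitive elements and their linear parts\<close>

lemma primitives_iff: "x \<in> primitives C \<Psi> \<longleftrightarrow> x \<in> cobar C \<and> psi x = tens x 1 + tens 1 x"
  by (auto simp: primitives_def psi_eq)

text \<open>All three terms of the primitivity equation respect the degree, so the equation splits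
  into homogeneous parts.\<close>

lemma component_primitive:
  assumes "x \<in> primitives C \<Psi>"
  shows "component dC n x \<in> primitives C \<Psi>"
proof -
  have x: "x \<in> cobar C" "psi x = tens x 1 + tens 1 x"
    using assms by (auto simp: primitives_iff)
  have "component (total_degree dC dC) n (tens x 1) = tens (component dC n x) 1"
    by (rule linear_eqI[where x = x])
      (auto intro!: linear_intros simp: component_def total_degree_def simp flip: bas_Nil)
  moreover have "component (total_degree dC dC) n (tens 1 x) = tens 1 (component dC n x)"
    by (rule linear_eqI[where x = x])
      (auto intro!: linear_intros simp: component_def total_degree_def simp flip: bas_Nil)
  moreover have "component dC n x \<in> cobar C"
    using x keys_component[of dC n x] by (auto simp: cobar_eq supported_def)
  ultimately show ?thesis
    using component_psi[OF x(1), of n] x(2)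
    by (simp add: primitives_iff linear_add[OF is_linear_component[OF is_linear_ident]])
qed

text \<open>Primitives reach every linear part. The linear part of a product is a combination of
  those of its factors, with the constant terms as coefficients, and combinations of primitives are
  primitive. The unit has zero linear part, whence the witness 0.\<close>

lemma generated_linear_part:
  assumes "x \<in> generated_subalgebra (primitives C \<Psi>)"
  shows "\<exists>q\<in>primitives C \<Psi>. \<forall>a. lookup q [a] = lookup x [a]"
  using assms
proof induction
  have lin: "0 \<in> primitives C \<Psi>" "smul r x + smul s y \<in> primitives C \<Psi>"
    if "x \<in> primitives C \<Psi>" "y \<in> primitives C \<Psi>" for r s x y
    using that
    by (simp_all add: primitives_iff cobar_eq supported_add supported_smul psi_def lin_ext_zero lin_ext_add lin_ext_smul
        tens_smul_left tens_smul_right pm.scale_right_distrib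
        linear_add[OF is_linear_tens_left[OF is_linear_ident]]
        linear_add[OF is_linear_tens_right[OF is_linear_ident]])
  {
    case one
    have "0 \<in> primitives C \<Psi>"
      by (simp add: primitives_iff cobar_eq psi_def lin_ext_zero)
    then show ?case by (intro bexI[of _ 0]) (auto simp: lookup_one zero_list_def when_def)
  next
    case (gen x)
    then show ?case by blast
  next
    case (add x y)
    then obtain q q' where "q \<in> primitives C \<Psi>" "q' \<in> primitives C \<Psi>"
      "\<forall>a. lookup q [a] = lookup x [a]" "\<forall>a. lookup q' [a] = lookup y [a]" by blast
    then show ?case using lin(2)[of q q' 1 1]
      by (intro bexI[of _ "q + q'"]) (auto simp: lookup_add)
  next
    case (mul x y)
    then obtain q q' where "q \<in> primitives C \<Psi>" "q' \<in> primitives C \<Psi>"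
      "\<forall>a. lookup q [a] = lookup x [a]" "\<forall>a. lookup q' [a] = lookup y [a]" by blast
    then show ?case using lin(2)[of q q' "lookup y []" "lookup x []"]
      by (intro bexI[of _ "smul (lookup y []) q + smul (lookup x []) q'"])
        (auto simp: lookup_add lookup_smul lookup_mult_letter mult.commute)
  next
    case (scl x r)
    then obtain q where "q \<in> primitives C \<Psi>" "\<forall>a. lookup q [a] = lookup x [a]" by blast
    then show ?case using lin(2)[of q q r 0]
      by (intro bexI[of _ "smul r q"]) (auto simp: lookup_smul)
  }
qed

text \<open>A primitive with linear part \<open>b\<close> is cut down to the degree of
  \<open>b\<close>. That degree is positive, so the constant term disappears and only words of
  length at least 2 are left beside \<open>b\<close>.\<close>

lemma primitive_lift:
  assumes "primitively_generated C \<Psi>" "b \<in> L"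
  shows "\<exists>p\<in>primitives C \<Psi>. homog dC (ldeg C b) p
    \<and> p - bas [b] \<in> supported {w \<in> lists L. dC w = ldeg C b \<and> 2 \<le> length w}"
proof -
  have "bas [b] \<in> generated_subalgebra (primitives C \<Psi>)"
    using assms by (simp add: primitively_generated_def cobar_eq)
  then obtain q where q: "q \<in> primitives C \<Psi>" "\<And>a. lookup q [a] = lookup (bas [b] :: _ \<Rightarrow>\<^sub>0 'r) [a]"
    using generated_linear_part by blast
  let ?p = "component dC (ldeg C b) q"
  have p: "?p \<in> primitives C \<Psi>" by (rule component_primitive[OF q(1)])
  have h: "homog dC (ldeg C b) ?p" by (rule homog_component)
  have "homog dC (ldeg C b) (bas [b] :: _ \<Rightarrow>\<^sub>0 'r)" by simp
  then have hd: "homog dC (ldeg C b) (?p - bas [b])" by (intro homog_diff h)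
  have "?p - bas [b] \<in> supported (lists L)"
    using p assms(2) by (intro supported_diff) (auto simp: primitives_iff cobar_eq)
  moreover have "2 \<le> length w" if w: "w \<in> keys (?p - bas [b])" for w
  proof (rule ccontr)
    assume "\<not> 2 \<le> length w"
    then consider "w = []" | a where "w = [a]"
      by (cases w rule: list.exhaust; cases "tl w") auto
    then show False
    proof cases
      case 1
      with hd w have "ldeg C b = 0" by (auto simp: homog_def)
      with ldeg_ge_2[OF assms(2)] show False by simp
    next
      case 2
      have "lookup (?p - bas [b]) [a] = 0"
        by (auto simp: lookup_minus lookup_component q(2) lookup_single when_def)
      with w 2 show False by (simp add: in_keys_iff)
    qed
  qed
  ultimately have "?p - bas [b] \<in> supported {w \<in> lists L. dC w = ldeg C b \<and> 2 \<le> length w}"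
    using hd by (auto simp: supported_def homog_def)
  with p h show ?thesis by blast
qed

section \<open>Projection, inclusion and the derivation \<open>kappa\<close>\<close>

definition proj :: "(('b + 'b) list \<Rightarrow>\<^sub>0 'r) \<Rightarrow> ('b list \<Rightarrow>\<^sub>0 'r)"
  where "proj = cobar_map (path_coalg C) C path_proj"

definition rho :: "(('b + 'b) list \<Rightarrow>\<^sub>0 'r) \<Rightarrow> (('b + 'b) list \<times> 'b list \<Rightarrow>\<^sub>0 'r)"
  where "rho x = tmap dP 0 id proj (path_loop_comult C \<Psi> x)"

lemma double_loop_eq: "double_loop C \<Psi> = {x \<in> cobar (path_coalg C). rho x = tens x 1}"
  by (simp add: double_loop_def rho_def proj_def)

lemma is_linear_proj [linear_intros]: "is_linear f \<Longrightarrow> is_linear (\<lambda>x. proj (f x))"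
  unfolding proj_def cobar_map_def by (intro linear_intros)

lemma is_linear_incl [linear_intros]: "is_linear f \<Longrightarrow> is_linear (\<lambda>x. incl (f x))"
  unfolding incl_def by (intro linear_intros)

lemma is_linear_kappa [linear_intros]: "is_linear f \<Longrightarrow> is_linear (\<lambda>x. kappa C (f x))"
  unfolding kappa_def by (intro linear_intros)

lemma is_linear_rho [linear_intros]: "is_linear f \<Longrightarrow> is_linear (\<lambda>x. rho (f x))"
  unfolding rho_def path_loop_comult_def by (intro linear_intros)

lemmas proj_linear = linear_add[OF is_linear_proj[OF is_linear_ident]]
  linear_smul[OF is_linear_proj[OF is_linear_ident]] linear_minus[OF is_linear_proj[OF is_linear_ident]]
  linear_diff[OF is_linear_proj[OF is_linear_ident]] linear_zero[OF is_linear_proj[OF is_linear_ident]]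

lemmas rho_linear = linear_add[OF is_linear_rho[OF is_linear_ident]]
  linear_smul[OF is_linear_rho[OF is_linear_ident]] linear_minus[OF is_linear_rho[OF is_linear_ident]]
  linear_diff[OF is_linear_rho[OF is_linear_ident]] linear_zero[OF is_linear_rho[OF is_linear_ident]]

lemma proj_mult: "proj (x * y) = proj x * proj y"
  unfolding proj_def cobar_map_def by (rule alg_ext_times)

lemma incl_mult: "incl (x * y) = incl x * incl y"
  unfolding incl_def by (rule alg_ext_times)

lemma proj_one [simp]: "proj 1 = 1"
  by (simp add: proj_def cobar_map_def)

lemma incl_one [simp]: "incl 1 = 1"
  by (simp add: incl_def)

lemma incl_bas: "incl (bas w) = bas (map Inl w)"
  by (induction w) (simp_all add: incl_def alg_ext_bas bas_mult_bas)

lemma proj_letter: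
  "proj (bas [Inl b]) = (if b = cunit C then 0 else bas [b])" "proj (bas [Inr b]) = 0"
  by (simp_all add: proj_def cobar_map_def alg_ext_bas path_proj_def sinv_def lin_ext_zero)

lemma homog_proj: "homog dC (dP w) (proj (bas w))"
  unfolding proj_def cobar_map_def
  by (rule homog_alg_ext_word) (auto simp: path_proj_def sinv_def lin_ext_zero split: sum.splits)

lemma proj_incl:
  assumes "x \<in> cobar C"
  shows "proj (incl x) = x"
proof (rule linear_eqI_supported[OF _ _ assms[unfolded cobar_eq]])
  fix w assume "w \<in> lists L"
  then show "proj (incl (bas w)) = bas w"
  proof (induction w)
    case (Cons a w)
    have "proj (incl (bas [a])) = bas [a]"
      using Cons.hyps(1) by (simp add: incl_bas proj_letter pbasis_def)
    then show ?case
      unfolding bas_Cons[of a w] incl_mult proj_mult Cons.IH by simp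
  qed simp
qed (intro linear_intros)+

lemma kappa_one [simp]: "kappa C 1 = 0"
  by (simp add: kappa_def)

lemma kappa_letter: "kappa C (bas [a]) = - bas [Inr a]"
  by (simp add: kappa_def der_ext_bas)

lemma kappa_append:
  "kappa C (bas (u @ v)) = kappa C (bas u) * incl (bas v)
    + smul (ksign (dC u)) (incl (bas u) * kappa C (bas v))"
  by (simp add: kappa_def incl_def der_ext_bas der_word_append)

text \<open>Each word in a value of \<open>kappa\<close> contains a letter \<open>Inr b\<close>, and
  the projection kills these letters.\<close>

lemma proj_kappa: "proj (kappa C x) = 0"
proof -
  have "proj (kappa C (bas w)) = 0" for w
  proof (induction w)
    case (Cons a w)
    show ?case
      using kappa_append[of "[a]" w] Cons.IH
      by (simp add: kappa_letter proj_mult proj_letter proj_linear)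
  qed (simp add: proj_linear)
  then show ?thesis
    using linear_eqI[OF is_linear_proj[OF is_linear_kappa[OF is_linear_ident]] is_linear_zero] by blast
qed

text \<open>Constancy of the length is what later keeps the longer words of a primitive lift longer
  after applying \<open>kappa\<close>.\<close>

lemma kappa_word:
  assumes "w \<in> lists L"
  shows "kappa C (bas w) \<in> supported {t \<in> lists X. length t = length w \<and> dP t = dC w - 1}"
  using assms
proof (induction w)
  case (Cons a w)
  let ?S = "{t \<in> lists X. length t = length (a # w) \<and> dP t = dC (a # w) - 1}"
  have "kappa C (bas [a]) * incl (bas w) \<in> supported ?S"
    unfolding kappa_letter incl_bas
    using Cons.hyps by (auto simp: bas_mult_bas intro!: supported_uminus supported_bas)
  moreover have "incl (bas [a]) * kappa C (bas w) \<in> supported ?S"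
    unfolding incl_bas
    by (rule supported_mult_general[OF supported_bas[of _ "{map Inl [a]}"] Cons.IH]) (use Cons.hyps in auto)
  ultimately show ?case
    using kappa_append[of "[a]" w] by (simp add: supported_add supported_smul)
qed simp

lemma homog_kappa: "homog dP (dC w - 1) (kappa C (bas w))"
proof (induction w)
  case (Cons a w)
  have "homog dP (dP [Inr a] + dP (map Inl w)) (bas [Inr a] * incl (bas w))"
    unfolding incl_bas by (intro homog_mult) auto
  moreover have "homog dP (dP [Inl a] + (dC w - 1)) (incl (bas [a]) * kappa C (bas w))"
    unfolding incl_bas using Cons.IH by (intro homog_mult) auto
  moreover have eq: "kappa C (bas (a # w)) = - (bas [Inr a] * incl (bas w))
      + smul (ksign (dC [a])) (incl (bas [a]) * kappa C (bas w))"
    using kappa_append[of "[a]" w] by (simp add: kappa_letter)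
  ultimately show ?case
    unfolding eq by (intro homog_add homog_uminus homog_smul) (simp_all add: algebra_simps)
qed (simp add: homog_def)

section \<open>Multiplicativity of the coaction and its values on \<open>incl\<close> and
  \<open>kappa\<close>\<close>

lemma tmap_proj_tmult2:
  "tmap dP 0 id proj (tmult2 dP dP x y) = tmult2 dP dC (tmap dP 0 id proj x) (tmap dP 0 id proj y)"
proof (rule linear_eqI[where x = x])
  fix a
  show "tmap dP 0 id proj (tmult2 dP dP (bas a) y) = tmult2 dP dC (tmap dP 0 id proj (bas a)) (tmap dP 0 id proj y)"
  proof (rule linear_eqI[where x = y])
    fix b :: "('b + 'b) list \<times> ('b + 'b) list"
    obtain u v where a: "a = (u, v)" by (cases a)
    obtain u' v' where b: "b = (u', v')" by (cases b)
    note ab = a b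
    have "tmult2 dP dC (tens (bas u) (proj (bas v))) (tens (bas u') (proj (bas v')))
      = smul (ksign (dP v * dP u')) (tens (bas u * bas u') (proj (bas v) * proj (bas v')))"
      by (rule tmult2_tens[OF homog_proj]) simp
    moreover have "proj (bas (v @ v')) = proj (bas v) * proj (bas v')"
      by (simp add: proj_mult flip: bas_mult_bas)
    ultimately show "tmap dP 0 id proj (tmult2 dP dP (bas a) (bas b))
        = tmult2 dP dC (tmap dP 0 id proj (bas a)) (tmap dP 0 id proj (bas b))"
      by (simp add: ab tmult2_bas tmap_bas tmap_linear bas_mult_bas)
  qed (intro linear_intros)+
qed (intro linear_intros)+

lemma rho_mult: "rho (x * y) = tmult2 dP dC (rho x) (rho y)"
  unfolding rho_def path_loop_comult_def tmult_conv_tmult2 alg_ext_tmult2 by (rule tmap_proj_tmult2)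

lemma rho_one: "rho 1 = tens 1 1"
  unfolding rho_def path_loop_comult_def alg_ext_one
  by (simp add: tmap_bas)

lemma rho_Inl:
  assumes "b \<in> L"
  shows "rho (bas [Inl b]) = tmap dC 0 incl id (psi (bas [b]))"
proof -
  have b: "bas [b] \<in> cobar C" using assms by (simp add: cobar_eq)
  have "rho (bas [Inl b]) = tmap dP 0 id proj (tmap dC 0 incl incl (psi (bas [b])))"
    by (simp add: rho_def path_loop_comult_def alg_ext_bas tmult_conv_tmult2 tmult2_one_right psi_eq[OF b])
  also have "\<dots> = tmap dC 0 incl id (psi (bas [b]))"
  proof (rule linear_eqI_supported[OF _ _ psi_supported[OF b]])
    fix a assume a: "a \<in> lists L \<times> lists L"
    then have "proj (incl (bas (snd a))) = bas (snd a)"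
      unfolding mem_Times_iff by (intro proj_incl) (simp add: cobar_eq)
    then show "tmap dP 0 id proj (tmap dC 0 incl incl (bas a)) = tmap dC 0 incl id (bas a)"
      by (cases a) (simp add: tmap_bas tmap_tens is_linear_id is_linear_incl is_linear_kappa is_linear_proj is_linear_ident)
  qed (intro linear_intros)+
  finally show ?thesis .
qed

text \<open>Of the two terms that define the comultiplication on \<open>Inr b\<close>, the one with
  \<open>kappa\<close> in the right factor is killed by the projection.\<close>

lemma rho_Inr:
  assumes "b \<in> L"
  shows "rho (bas [Inr b]) = - tmap dC 0 (kappa C) id (psi (bas [b]))"
proof -
  have b: "bas [b] \<in> cobar C" using assms by (simp add: cobar_eq)
  have "rho (bas [Inr b]) = - tmap dP 0 id proj
      (tmap dC 0 (kappa C) incl (psi (bas [b])) + tmap dC (- 1) incl (kappa C) (psi (bas [b])))"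
    by (simp add: rho_def path_loop_comult_def alg_ext_bas tmult_conv_tmult2 tmult2_one_right psi_eq[OF b]
        tmap_linear del: minus_add_distrib)
  also have "tmap dP 0 id proj
      (tmap dC 0 (kappa C) incl (psi (bas [b])) + tmap dC (- 1) incl (kappa C) (psi (bas [b])))
      = tmap dC 0 (kappa C) id (psi (bas [b]))"
  proof (rule linear_eqI_supported[OF _ _ psi_supported[OF b]])
    fix a assume a: "a \<in> lists L \<times> lists L"
    then have "proj (incl (bas (snd a))) = bas (snd a)"
      unfolding mem_Times_iff by (intro proj_incl) (simp add: cobar_eq)
    then show "tmap dP 0 id proj (tmap dC 0 (kappa C) incl (bas a) + tmap dC (- 1) incl (kappa C) (bas a))
        = tmap dC 0 (kappa C) id (bas a)"
      by (cases a) (simp add: tmap_bas tmap_tens is_linear_id is_linear_incl is_linear_kappa is_linear_proj is_linear_ident tmap_linear proj_kappa)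
  qed (intro linear_intros)+
  finally show ?thesis .
qed

lemma tmap_incl_tmult2:
  "tmap dC 0 incl id (tmult2 dC dC x y) = tmult2 dP dC (tmap dC 0 incl id x) (tmap dC 0 incl id y)"
proof (rule linear_eqI[where x = x])
  fix a
  show "tmap dC 0 incl id (tmult2 dC dC (bas a) y) = tmult2 dP dC (tmap dC 0 incl id (bas a)) (tmap dC 0 incl id y)"
  proof (rule linear_eqI[where x = y])
    fix b :: "'b list \<times> 'b list"
    show "tmap dC 0 incl id (tmult2 dC dC (bas a) (bas b))
        = tmult2 dP dC (tmap dC 0 incl id (bas a)) (tmap dC 0 incl id (bas b))"
      by (cases a; cases b) (simp add: tmult2_bas tmap_bas incl_bas tmap_linear)
  qed (intro linear_intros)+
qed (intro linear_intros)+

text \<open>The signs of the second Leibniz term for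
  \<open>(u \<otimes> v) (u' \<otimes> v')\<close>, with \<open>m\<close>, \<open>k\<close>,
  \<open>n\<close> the degrees of \<open>u\<close>, \<open>v\<close>, \<open>u'\<close>: on the left
  \<open>kappa\<close> has passed \<open>u\<close> and \<open>v\<close> before \<open>v\<close>
  passes the shifted \<open>u'\<close>; on the right it has passed \<open>u\<close> only.\<close>

lemma ksign_shift: "ksign (m + k) * ksign (k * (n - 1)) = (ksign (k * n) * ksign m :: 'r)"
  by (auto simp: ksign_def)

text \<open>\<open>kappa \<otimes> id\<close> is a derivation along
  \<open>incl \<otimes> id\<close>. The sign is the total degree of \<open>x\<close>, because
  \<open>kappa\<close> has to pass both tensor factors of \<open>x\<close>.\<close>

lemma tmap_kappa_tmult2:
  assumes "homog (total_degree dC dC) n x"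
  shows "tmap dC 0 (kappa C) id (tmult2 dC dC x y)
    = tmult2 dP dC (tmap dC 0 (kappa C) id x) (tmap dC 0 incl id y)
      + smul (ksign n) (tmult2 dP dC (tmap dC 0 incl id x) (tmap dC 0 (kappa C) id y))"
proof (rule linear_eqI[where x = x])
  fix a assume "a \<in> keys x"
  show "tmap dC 0 (kappa C) id (tmult2 dC dC (bas a) y)
    = tmult2 dP dC (tmap dC 0 (kappa C) id (bas a)) (tmap dC 0 incl id y)
      + smul (ksign n) (tmult2 dP dC (tmap dC 0 incl id (bas a)) (tmap dC 0 (kappa C) id y))"
  proof (rule linear_eqI[where x = y])
    fix b :: "'b list \<times> 'b list"
    obtain u v where a: "a = (u, v)" by (cases a)
    obtain u' v' where b: "b = (u', v')" by (cases b)
    note ab = a b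
    have n: "n = dC u + dC v"
      using assms \<open>a \<in> keys x\<close> by (auto simp: homog_def total_degree_def ab)
    have 1: "tmult2 dP dC (tens (kappa C (bas u)) (bas v)) (tens (incl (bas u')) (bas v'))
      = smul (ksign (dC v * dC u')) (tens (kappa C (bas u) * incl (bas u')) (bas v * bas v'))"
      by (rule tmult2_tens) (simp_all add: incl_bas)
    have 2: "tmult2 dP dC (tens (incl (bas u)) (bas v)) (tens (kappa C (bas u')) (bas v'))
      = smul (ksign (dC v * (dC u' - 1))) (tens (incl (bas u) * kappa C (bas u')) (bas v * bas v'))"
      by (rule tmult2_tens[OF _ homog_kappa]) simp
    show "tmap dC 0 (kappa C) id (tmult2 dC dC (bas a) (bas b))
      = tmult2 dP dC (tmap dC 0 (kappa C) id (bas a)) (tmap dC 0 incl id (bas b))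
        + smul (ksign n) (tmult2 dP dC (tmap dC 0 incl id (bas a)) (tmap dC 0 (kappa C) id (bas b)))"
      by (simp add: ab tmult2_bas tmap_bas tmap_linear 1 2
          kappa_append bas_mult_bas n ksign_shift pm.scale_right_distrib tens_smul_left
          linear_add[OF is_linear_tens_left[OF is_linear_ident]])
  qed (intro linear_intros)+
qed (intro linear_intros)+

lemma rho_incl:
  assumes "x \<in> cobar C"
  shows "rho (incl x) = tmap dC 0 incl id (psi x)"
proof (rule linear_eqI_supported[OF _ _ assms[unfolded cobar_eq]])
  fix w assume "w \<in> lists L"
  then show "rho (incl (bas w)) = tmap dC 0 incl id (psi (bas w))"
  proof (induction w)
    case Nil
    then show ?case by (simp add: rho_one psi_one tmap_bas)
  next
    case (Cons a w)
    then have c: "bas [a] \<in> cobar C" "bas w \<in> cobar C" by (auto simp: cobar_eq)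
    show ?case
      unfolding bas_Cons[of a w] incl_mult rho_mult psi_mult[OF c] tmap_incl_tmult2 Cons.IH
      using rho_Inl[OF Cons.hyps(1)] by (simp add: incl_bas)
  qed
qed (intro linear_intros)+

text \<open>Both sides obey the same Leibniz rule along \<open>rho o incl\<close>, on the right by
  \<open>tmap_kappa_tmult2\<close>, and they agree on letters by \<open>rho_Inr\<close>.\<close>

lemma rho_kappa:
  assumes "x \<in> cobar C"
  shows "rho (kappa C x) = tmap dC 0 (kappa C) id (psi x)"
proof (rule linear_eqI_supported[OF _ _ assms[unfolded cobar_eq]])
  fix w assume "w \<in> lists L"
  then show "rho (kappa C (bas w)) = tmap dC 0 (kappa C) id (psi (bas w))"
  proof (induction w)
    case Nil
    then show ?case by (simp add: rho_linear psi_one tmap_bas)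
  next
    case (Cons a w)
    then have c: "bas [a] \<in> cobar C" "bas w \<in> cobar C" by (auto simp: cobar_eq)
    have letter: "rho (kappa C (bas [a])) = tmap dC 0 (kappa C) id (psi (bas [a]))"
      using rho_Inr[OF Cons.hyps(1)]
      by (simp add: kappa_letter rho_linear)
    have "homog (total_degree dC dC) (ldeg C a) (psi (bas [a]))"
      using psi_word(2)[of "[a]"] Cons.hyps by simp
    from tmap_kappa_tmult2[OF this] show ?case
      using kappa_append[of "[a]" w] psi_mult[OF c]
      by (simp add: bas_mult_bas rho_mult rho_incl c letter Cons.IH rho_linear id_def)
  qed
qed (intro linear_intros)+

text \<open>In the second claim the summand \<open>1 \<otimes> x\<close> of \<open>psi x\<close>
  contributes nothing, since \<open>kappa\<close> vanishes on the unit. This is why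
  \<open>kappa\<close> turns primitives into coinvariants.\<close>

lemma rho_primitive:
  assumes "x \<in> primitives C \<Psi>"
  shows "rho (incl x) = tens (incl x) 1 + tens 1 x" "rho (kappa C x) = tens (kappa C x) 1"
proof -
  have x: "x \<in> cobar C" "psi x = tens x 1 + tens 1 x"
    using assms by (auto simp: primitives_iff)
  show "rho (incl x) = tens (incl x) 1 + tens 1 x"
    by (simp add: rho_incl x tmap_linear tmap_tens is_linear_id
        is_linear_incl[OF is_linear_ident])
  show "rho (kappa C x) = tens (kappa C x) 1"
    by (simp add: rho_kappa x tmap_linear tmap_tens is_linear_id
        is_linear_kappa[OF is_linear_ident])
qed

end

section \<open>Presenting a subalgebra as a tensor algebra\<close>

lemma free_algebra_simps [simp]:
  "carrier (free_algebra M) = supported (lists M)" "mult (free_algebra M) = (*)"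
  "one (free_algebra M) = 1" "zero (free_algebra M) = 0" "add (free_algebra M) = (+)"
  by (simp_all add: free_algebra_def)

lemma a_minus_free_algebra:
  assumes "x \<in> supported (lists M)" "y \<in> supported (lists M)"
  shows "a_minus (free_algebra M) x y = x - (y :: 'm list \<Rightarrow>\<^sub>0 'r::comm_ring_1)"
proof -
  interpret R: Ring.ring "free_algebra M :: ('m list \<Rightarrow>\<^sub>0 'r) ring" by (rule ring_free_algebra)
  have "a_inv (free_algebra M) y = - y"
    using R.minus_equality[of "- y" y] assms by (simp add: supported_uminus)
  then show ?thesis by (simp add: a_minus_def)
qed

text \<open>\<open>\<theta>\<close> is the restriction to letters of an algebra map out of the tensor algebra on the span of \<open>f\<close>.\<close>

locale tensor_presentation =
  fixes f :: "'y \<Rightarrow> ('a list \<Rightarrow>\<^sub>0 'r::comm_ring_1)" and Y :: "'y set"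
    and \<theta> :: "('a list \<Rightarrow>\<^sub>0 'r) \<Rightarrow> ('a list \<Rightarrow>\<^sub>0 'r)"
    and dg :: "'a \<Rightarrow> int" and dY :: "'y \<Rightarrow> int"
  assumes linear: "is_linear \<theta>"
    and independent: "\<And>y. y \<in> supported (lists Y) \<Longrightarrow>
      lin_ext (\<lambda>ys. prod_list (map (\<lambda>y. \<theta> (f y)) ys)) y = 0 \<Longrightarrow> y = 0"
    and homog_f: "\<And>y. y \<in> Y \<Longrightarrow> homog (word_degree dg) (dY y) (f y)"
    and homog_\<theta>: "\<And>k m. m \<in> lin_ext f ` supported Y \<Longrightarrow> homog (word_degree dg) k m \<Longrightarrow>
      homog (word_degree dg) k (\<theta> m)"
begin

definition M :: "('a list \<Rightarrow>\<^sub>0 'r) set" where "M = lin_ext f ` supported Y"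

abbreviation F :: "(('a list \<Rightarrow>\<^sub>0 'r) list \<Rightarrow>\<^sub>0 'r) ring" where "F \<equiv> free_algebra M"

abbreviation I :: "(('a list \<Rightarrow>\<^sub>0 'r) list \<Rightarrow>\<^sub>0 'r) set" where "I \<equiv> tensor_ideal M"

definition ev :: "(('a list \<Rightarrow>\<^sub>0 'r) list \<Rightarrow>\<^sub>0 'r) \<Rightarrow> ('a list \<Rightarrow>\<^sub>0 'r)" where "ev = alg_ext (*) 1 \<theta>"

definition H :: "'y list \<Rightarrow> ('a list \<Rightarrow>\<^sub>0 'r)" where "H ys = prod_list (map (\<lambda>y. \<theta> (f y)) ys)"

text \<open>The free algebra behind \<open>tensor_algebra\<close> has a generator for every element
  of \<open>M\<close>; \<open>lift\<close> picks out the generators from the family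
  \<open>f\<close>. Each class modulo \<open>I\<close> contains a value of
  \<open>lift\<close>.\<close>

definition lift :: "('y list \<Rightarrow>\<^sub>0 'r) \<Rightarrow> (('a list \<Rightarrow>\<^sub>0 'r) list \<Rightarrow>\<^sub>0 'r)"
  where "lift = lin_ext (\<lambda>ys. bas (map f ys))"

definition image_algebra :: "('r, 'a list \<Rightarrow>\<^sub>0 'r) graded_algebra" where
  "image_algebra = (let D = lin_ext H ` supported (lists Y) in \<lparr>
    carrier = D, mult = (*), one = 1, zero = 0, add = (+), smult = smul,
    grade = (\<lambda>n. {x \<in> D. homog (word_degree dg) n x}) \<rparr>)"

lemma is_linear_ev [linear_intros]: "is_linear h \<Longrightarrow> is_linear (\<lambda>x. ev (h x))"
  unfolding ev_def by (intro linear_intros)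

lemma is_linear_lift [linear_intros]: "is_linear h \<Longrightarrow> is_linear (\<lambda>x. lift (h x))"
  unfolding lift_def by (intro linear_intros)

lemmas ev_linear = linear_add[OF is_linear_ev[OF is_linear_ident]]
  linear_smul[OF is_linear_ev[OF is_linear_ident]] linear_diff[OF is_linear_ev[OF is_linear_ident]]
  linear_zero[OF is_linear_ev[OF is_linear_ident]]

lemma ev_mult: "ev (x * y) = ev x * ev y"
  unfolding ev_def by (rule alg_ext_times)

lemma ev_letter: "ev (bas [m]) = \<theta> m"
  unfolding ev_def by (rule alg_ext_letter)

lemma ev_one [simp]: "ev 1 = 1"
  by (simp add: ev_def)

lemma f_mem: "y \<in> Y \<Longrightarrow> f y \<in> M"
  unfolding M_def by (intro image_eqI[of _ _ "bas y"]) auto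

lemma subspace_M: "pm.subspace M"
  unfolding M_def by (rule subspace_lin_ext_image)

lemma lift_mem: "y \<in> supported (lists Y) \<Longrightarrow> lift y \<in> supported (lists M)"
  unfolding lift_def by (rule supported_lin_ext) (auto intro!: supported_bas f_mem)

lemma lift_mult: "lift (x * y) = lift x * lift y"
proof (rule linear_eqI[where x = x])
  fix u
  show "lift (bas u * y) = lift (bas u) * lift y"
    by (rule linear_eqI[where x = y]) (auto intro!: linear_intros simp: lift_def bas_mult_bas)
qed (intro linear_intros)+

lemma ev_lift: "ev (lift y) = lin_ext H y"
proof (rule linear_eqI[where x = y])
  fix ys
  show "ev (lift (bas ys)) = lin_ext H (bas ys)"
    by (induction ys) (simp_all add: lift_def H_def ev_def alg_ext_bas)
qed (intro linear_intros is_linear_lin_ext)+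

section \<open>The ideal of relations as the kernel of evaluation\<close>

lemma ideal_I: "ideal I F"
  and relations_I: "tensor_relations M \<subseteq> I"
proof -
  interpret R: Ring.ring F by (rule ring_free_algebra)
  have "tensor_relations M \<subseteq> carrier F"
    using pm.subspace_add[OF subspace_M] pm.subspace_scale[OF subspace_M]
    by (auto simp: tensor_relations_def intro!: supported_diff supported_smul)
  then show "ideal I F" "tensor_relations M \<subseteq> I"
    unfolding tensor_ideal_def by (rule R.genideal_ideal, rule R.genideal_self)
qed

lemma I_zero: "0 \<in> I"
  using additive_subgroup.zero_closed[OF ideal.axioms(1)[OF ideal_I]] by simp

lemma I_add: "a \<in> I \<Longrightarrow> b \<in> I \<Longrightarrow> a + b \<in> I"
  using additive_subgroup.a_closed[OF ideal.axioms(1)[OF ideal_I]] by simp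

lemma I_l: "a \<in> I \<Longrightarrow> x \<in> supported (lists M) \<Longrightarrow> x * a \<in> I"
  using ideal.I_l_closed[OF ideal_I] by simp

lemma I_r: "a \<in> I \<Longrightarrow> x \<in> supported (lists M) \<Longrightarrow> a * x \<in> I"
  using ideal.I_r_closed[OF ideal_I] by simp

lemma I_smul: "a \<in> I \<Longrightarrow> smul r a \<in> I"
  using I_l[of a "smul r 1"] by (simp add: smul_mult_left supported_smul supported_one)

lemma subspace_I: "pm.subspace I"
  by (intro pm.subspaceI I_zero I_add I_smul)

lemma I_sub: "I \<subseteq> supported (lists M)"
  using additive_subgroup.a_subset[OF ideal.axioms(1)[OF ideal_I]] by simp

text \<open>Linearity of \<open>\<theta>\<close> puts the relations into the kernel of
  \<open>ev\<close>, which is an ideal, and \<open>I\<close> is the least ideal containing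
  them.\<close>

lemma ev_I:
  assumes "a \<in> I"
  shows "ev a = 0"
proof -
  interpret R: Ring.ring F by (rule ring_free_algebra)
  \<comment> \<open>All words over the full alphabet: the target of \<open>ev\<close> regarded as a
    ring with explicit carrier.\<close>
  let ?S = "free_algebra UNIV :: ('a list \<Rightarrow>\<^sub>0 'r) ring"
  have "ev \<in> ring_hom F ?S"
    by (rule ring_hom_memI) (simp_all add: ev_mult ev_linear supported_def)
  then have h: "ring_hom_ring F ?S ev"
    by (rule ring_hom_ringI2[OF ring_free_algebra ring_free_algebra])
  have "tensor_relations M \<subseteq> a_kernel F ?S ev"
    using pm.subspace_add[OF subspace_M] pm.subspace_scale[OF subspace_M]
    by (auto simp: tensor_relations_def a_kernel_def' ev_linear ev_letter linear_add[OF linear]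
        linear_smul[OF linear] intro!: supported_diff supported_smul)
  then have "I \<subseteq> a_kernel F ?S ev"
    unfolding tensor_ideal_def by (intro R.genideal_minimal ring_hom_ring.kernel_is_ideal[OF h])
  with assms show ?thesis by (auto simp: a_kernel_def')
qed

text \<open>The additivity and scalar relations break the formal letter of a linear combination into
  the combination of formal letters, one summand at a time.\<close>

lemma letter_reduction:
  assumes "c \<in> supported Y"
  shows "bas [lin_ext f c] - lift (lin_ext (\<lambda>y. bas [y]) c) \<in> I"
proof -
  have sum: "(\<Sum>k\<in>K. smul (lookup c k) (f k)) \<in> M \<and>
      bas [\<Sum>k\<in>K. smul (lookup c k) (f k)] - (\<Sum>k\<in>K. smul (lookup c k) (bas [f k])) \<in> I"
    if "finite K" "K \<subseteq> Y" for K
    using that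
  proof (induction K)
    case empty
    have "0 \<in> M" by (rule pm.subspace_0[OF subspace_M])
    \<comment> \<open>The formal letter \<open>[0]\<close> is a nonzero element of the free algebra;
      the scalar relation with both scalar and vector 0 puts it into \<open>I\<close>.\<close>
    moreover from this have "bas [smul 0 0] - smul 0 (bas [0]) \<in> tensor_relations M"
      unfolding tensor_relations_def by blast
    ultimately show ?case using relations_I by auto
  next
    case (insert k K)
    let ?x = "smul (lookup c k) (f k)" and ?y = "\<Sum>k\<in>K. smul (lookup c k) (f k)"
    let ?y' = "\<Sum>k\<in>K. smul (lookup c k) (bas [f k])"
    have k: "f k \<in> M" using insert f_mem by auto
    then have x: "?x \<in> M" by (rule pm.subspace_scale[OF subspace_M])
    have y: "?y \<in> M" "bas [?y] - ?y' \<in> I" using insert by auto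
    have "bas [?x + ?y] - bas [?x] - bas [?y] \<in> I" "bas [?x] - smul (lookup c k) (bas [f k]) \<in> I"
      using relations_I k x y(1) unfolding tensor_relations_def by blast+
    from I_add[OF I_add[OF this] y(2)] have "bas [?x + ?y] - (smul (lookup c k) (bas [f k]) + ?y') \<in> I"
      by (simp add: algebra_simps)
    moreover have "?x + ?y \<in> M" by (rule pm.subspace_add[OF subspace_M x y(1)])
    ultimately show ?case using insert.hyps by simp
  qed
  have "lift (lin_ext (\<lambda>y. bas [y]) c) = lin_ext (\<lambda>y. bas [f y]) c"
    by (simp add: lift_def lin_ext_lin_ext)
  then show ?thesis
    using sum[of "keys c"] assms by (simp add: supported_def lin_ext_def)
qed

lemma reduction:
  assumes "a \<in> supported (lists M)"
  shows "\<exists>y\<in>supported (lists Y). a - lift y \<in> I"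
proof -
  have word: "\<exists>y\<in>supported (lists Y). bas ms - lift y \<in> I" if "ms \<in> lists M" for ms
    using that
  proof (induction ms)
    case Nil
    show ?case using I_zero by (intro bexI[of _ 1]) (auto simp: lift_def supported_one)
  next
    case (Cons m ms)
    then obtain y where y: "y \<in> supported (lists Y)" "bas ms - lift y \<in> I" by blast
    obtain c where c: "c \<in> supported Y" "m = lin_ext f c" using Cons.hyps by (auto simp: M_def)
    let ?c = "lin_ext (\<lambda>y. bas [y]) c"
    have c': "?c \<in> supported (lists Y)" by (rule supported_lin_ext[OF c(1)]) auto
    \<comment> \<open>The first letter is replaced while the rest of the word stands, then the rest
      behind the replaced letter; the two differences add up to the whole one.\<close>
    have "(bas [m] - lift ?c) * bas ms + lift ?c * (bas ms - lift y) \<in> I"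
      using letter_reduction[OF c(1)] c(2) y(2) lift_mem[OF c'] Cons.hyps
      by (intro I_add I_r I_l) auto
    then have "bas (m # ms) - lift (?c * y) \<in> I"
      unfolding bas_Cons[of m ms] by (simp add: lift_mult algebra_simps del: bas_Nil)
    then show ?case using supported_mult[OF c' y(1)] by blast
  qed
  then obtain g where g: "\<And>ms. ms \<in> lists M \<Longrightarrow> g ms \<in> supported (lists Y)"
    "\<And>ms. ms \<in> lists M \<Longrightarrow> bas ms - lift (g ms) \<in> I" by metis
  have "lin_ext (\<lambda>ms. bas ms - lift (g ms)) a \<in> I"
    by (rule lin_ext_in_subspace[OF subspace_I]) (use assms in \<open>auto simp: supported_def intro!: g\<close>)
  moreover have "lin_ext (\<lambda>ms. bas ms - lift (g ms)) a = a - lift (lin_ext g a)"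
    by (rule linear_eqI[where x = a]) (auto intro!: linear_intros)
  moreover have "lin_ext g a \<in> supported (lists Y)"
    by (rule supported_lin_ext[OF assms g(1)])
  ultimately show ?thesis by auto
qed

text \<open>Modulo \<open>I\<close> every element is a lift, and on lifts \<open>ev\<close> is
  injective by independence of the monomials.\<close>

lemma kernel_ev:
  assumes "a \<in> supported (lists M)" "ev a = 0"
  shows "a \<in> I"
proof -
  obtain y where y: "y \<in> supported (lists Y)" "a - lift y \<in> I" using reduction[OF assms(1)] by blast
  from ev_I[OF y(2)] have "lin_ext H y = 0" by (simp add: ev_linear ev_lift assms(2))
  with independent[OF y(1)] have "y = 0" by (simp add: H_def[abs_def])
  with y(2) show ?thesis by (simp add: lift_def lin_ext_zero)
qed

lemma tensor_class_eq_iff: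
  assumes "a \<in> supported (lists M)" "b \<in> supported (lists M)"
  shows "tensor_class M a = tensor_class M b \<longleftrightarrow> ev a = ev b"
proof -
  interpret R: Ring.ring F by (rule ring_free_algebra)
  have "tensor_class M a = tensor_class M b \<longleftrightarrow> a - b \<in> I"
    using R.quotient_eq_iff_same_a_r_cos[OF ideal_I, of a b] assms
    by (simp add: tensor_class_def a_minus_free_algebra)
  also have "\<dots> \<longleftrightarrow> ev a = ev b"
    using ev_I[of "a - b"] kernel_ev[of "a - b"] assms by (auto simp: ev_linear supported_diff)
  finally show ?thesis .
qed

lemma tensor_class_mem:
  assumes "a \<in> supported (lists M)"
  shows "b \<in> tensor_class M a \<longleftrightarrow> b \<in> supported (lists M) \<and> ev b = ev a"
proof
  assume "b \<in> tensor_class M a"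
  then obtain i where "i \<in> I" "b = i + a"
    by (auto simp: tensor_class_def a_r_coset_def')
  then show "b \<in> supported (lists M) \<and> ev b = ev a"
    using I_sub assms by (auto simp: ev_linear ev_I intro: supported_add)
next
  assume "b \<in> supported (lists M) \<and> ev b = ev a"
  then have "b - a \<in> I" using assms by (intro kernel_ev) (auto simp: ev_linear supported_diff)
  then show "b \<in> tensor_class M a"
    by (auto simp: tensor_class_def a_r_coset_def' intro!: bexI[of _ "b - a"])
qed

lemma ev_image: "ev ` supported (lists M) = lin_ext H ` supported (lists Y)"
proof
  show "ev ` supported (lists M) \<subseteq> lin_ext H ` supported (lists Y)"
  proof (rule image_subsetI)
    fix a :: "('a list \<Rightarrow>\<^sub>0 'r) list \<Rightarrow>\<^sub>0 'r" assume "a \<in> supported (lists M)"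
    from reduction[OF this] obtain y where "y \<in> supported (lists Y)" "a - lift y \<in> I" by blast
    with ev_I[of "a - lift y"] show "ev a \<in> lin_ext H ` supported (lists Y)"
      by (auto simp: ev_linear ev_lift)
  qed
  show "lin_ext H ` supported (lists Y) \<subseteq> ev ` supported (lists M)"
    by (auto simp: lift_mem simp flip: ev_lift)
qed

section \<open>Compatibility with the gradings\<close>

abbreviation graded_words :: "int \<Rightarrow> ('a list \<Rightarrow>\<^sub>0 'r) list set"
  where "graded_words n \<equiv>
    {ms. \<exists>ks. list_all2 (\<lambda>m k. m \<in> M \<and> homog (word_degree dg) k m) ms ks \<and> sum_list ks = n}"

lemma graded_word:
  assumes "ms \<in> graded_words n"
  shows "ms \<in> lists M" "homog (word_degree dg) n (ev (bas ms))"
proof -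
  from assms obtain ks where "list_all2 (\<lambda>m k. m \<in> M \<and> homog (word_degree dg) k m) ms ks" "sum_list ks = n"
    by blast
  then have "ms \<in> lists M \<and> homog (word_degree dg) n (ev (bas ms))"
  proof (induction ms ks arbitrary: n rule: list_all2_induct)
    case (Cons m ms k ks)
    have "homog (word_degree dg) k (\<theta> m)" using Cons.hyps homog_\<theta> by (simp add: M_def)
    moreover have "homog (word_degree dg) (sum_list ks) (ev (bas ms))" using Cons.IH by blast
    ultimately have "homog (word_degree dg) (k + sum_list ks) (\<theta> m * ev (bas ms))"
      by (rule homog_mult)
    then show ?case using Cons by (auto simp: ev_def alg_ext_bas)
  qed simp
  then show "ms \<in> lists M" "homog (word_degree dg) n (ev (bas ms))" by auto
qed

lemma graded_span:
  assumes "a \<in> pm.span {bas ms | ms. ms \<in> graded_words n}"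
  shows "a \<in> supported (lists M)" "homog (word_degree dg) n (ev a)"
proof -
  have "a \<in> supported (lists M) \<and> homog (word_degree dg) n (ev a)"
    using assms
  proof (induction rule: pm.span_induct_alt)
    case base
    then show ?case by (simp add: ev_linear)
  next
    case (step c x y)
    then obtain ms where ms: "x = bas ms" "ms \<in> graded_words n" by blast
    then show ?case
      using graded_word[OF ms(2)] step
      by (auto simp: ev_linear intro!: supported_add supported_smul supported_bas homog_add homog_smul)
  qed
  then show "a \<in> supported (lists M)" "homog (word_degree dg) n (ev a)" by auto
qed

lemma homog_H: "ys \<in> lists Y \<Longrightarrow> homog (word_degree dg) (word_degree dY ys) (H ys)"
  by (induction ys) (auto simp: H_def intro!: homog_mult homog_\<theta> homog_f f_mem[unfolded M_def])

text \<open>A preimage of a homogeneous element need not be homogeneous, but its component of the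
  right degree has the same image, because the monomials \<open>H ys\<close> are
  homogeneous.\<close>

lemma graded_image:
  assumes "x \<in> lin_ext H ` supported (lists Y)" "homog (word_degree dg) n x"
  shows "x \<in> ev ` pm.span {bas ms | ms. ms \<in> graded_words n}"
proof -
  obtain y where y: "y \<in> supported (lists Y)" "x = lin_ext H y" using assms by blast
  let ?y = "component (word_degree dY) n y"
  have "x = component (word_degree dg) n x" using component_homog[OF assms(2)] by simp
  also have "\<dots> = lin_ext H ?y"
    unfolding y(2) by (rule component_lin_ext) (use y(1) in \<open>auto simp: supported_def intro!: homog_H\<close>)
  finally have x: "x = ev (lift ?y)" by (simp add: ev_lift)
  have "lift ?y \<in> pm.span {bas ms | ms. ms \<in> graded_words n}"
    unfolding lift_def
  proof (rule lin_ext_in_subspace[OF pm.subspace_span], rule pm.span_base)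
    fix ys assume ys: "ys \<in> keys ?y"
    then have "ys \<in> lists Y" using y(1) keys_component[of "word_degree dY" n y] by (auto simp: supported_def)
    then have "list_all2 (\<lambda>m k. m \<in> M \<and> homog (word_degree dg) k m) (map f ys) (map dY ys)"
      by (auto simp: list_all2_map1 list_all2_map2 list_all2_same f_mem homog_f)
    moreover have "sum_list (map dY ys) = n"
      using homog_component[of "word_degree dY" n y] ys by (auto simp: homog_def word_degree_def)
    ultimately show "bas (map f ys) \<in> {bas ms | ms. ms \<in> graded_words n}" by blast
  qed
  with x show ?thesis by blast
qed

theorem image_algebra_isomorphic:
  "graded_algebra_isomorphic image_algebra (tensor_algebra (word_degree dg) M)"
proof -
  let ?T = "tensor_algebra (word_degree dg) M"
  let ?D = "lin_ext H ` supported (lists Y)"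
  \<comment> \<open>The inverse of the map induced by \<open>ev\<close> on classes. The choice of
    preimage is harmless, as elements with equal evaluation have equal class.\<close>
  define \<phi> where "\<phi> x = tensor_class M (SOME a. a \<in> supported (lists M) \<and> ev a = x)" for x
  have \<phi>_ev: "\<phi> (ev a) = tensor_class M a" if "a \<in> supported (lists M)" for a
  proof -
    have "(SOME b. b \<in> supported (lists M) \<and> ev b = ev a) \<in> supported (lists M)
      \<and> ev (SOME b. b \<in> supported (lists M) \<and> ev b = ev a) = ev a"
      by (rule someI[of _ a]) (use that in auto)
    then show ?thesis unfolding \<phi>_def using that by (simp add: tensor_class_eq_iff)
  qed
  have D: "\<exists>a\<in>supported (lists M). x = ev a" if "x \<in> ?D" for x
    using that unfolding ev_image[symmetric] by blast
  have hom: "tensor_class M \<in> ring_hom F (F Quot I)"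
    using ideal.rcos_ring_hom[OF ideal_I] by (simp add: tensor_class_def[abs_def])
  have T: "carrier ?T = tensor_class M ` supported (lists M)"
    "mult ?T = mult (F Quot I)" "add ?T = add (F Quot I)" "one ?T = one (F Quot I)"
    "smult ?T = (\<lambda>r X. \<Union>x\<in>X. tensor_class M (smul r x))"
    "grade ?T = (\<lambda>n. tensor_class M ` pm.span {bas ms | ms. ms \<in> graded_words n})"
    by (auto simp: tensor_algebra_def Let_def FactRing_def A_RCOSETS_def' tensor_class_def)
  have iso: "\<phi> \<in> ring_iso image_algebra ?T"
    unfolding ring_iso_def
  proof (rule CollectI, rule conjI)
    show "\<phi> \<in> ring_hom image_algebra ?T"
    proof (rule ring_hom_memI)
      show "\<phi> x \<in> carrier ?T" if "x \<in> carrier image_algebra" for x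
        using D[of x] that by (auto simp: image_algebra_def T \<phi>_ev)
      fix x y assume "x \<in> carrier image_algebra" "y \<in> carrier image_algebra"
      then have "x \<in> ?D" "y \<in> ?D" by (simp_all add: image_algebra_def)
      then obtain a b where a: "a \<in> supported (lists M)" "x = ev a" and b: "b \<in> supported (lists M)" "y = ev b"
        using D[of x] D[of y] by blast
      show "\<phi> (mult image_algebra x y) = mult ?T (\<phi> x) (\<phi> y)"
        using ring_hom_mult[OF hom, of a b] a b
        by (simp add: image_algebra_def T \<phi>_ev supported_mult flip: ev_mult)
      show "\<phi> (add image_algebra x y) = add ?T (\<phi> x) (\<phi> y)"
        using ring_hom_add[OF hom, of a b] a b
        by (simp add: image_algebra_def T \<phi>_ev supported_add flip: ev_linear)
    next
      show "\<phi> (one image_algebra) = one ?T"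
        using ring_hom_one[OF hom] \<phi>_ev[OF supported_one] by (simp add: image_algebra_def T)
    qed
    have "inj_on \<phi> ?D"
    proof (rule inj_onI)
      fix x y assume "x \<in> ?D" "y \<in> ?D" "\<phi> x = \<phi> y"
      then show "x = y" using D[of x] D[of y] by (auto simp: \<phi>_ev tensor_class_eq_iff)
    qed
    moreover have "\<phi> ` ?D = tensor_class M ` supported (lists M)"
      unfolding ev_image[symmetric] image_image by (rule image_cong) (auto simp: \<phi>_ev)
    ultimately show "bij_betw \<phi> (carrier image_algebra) (carrier ?T)"
      by (simp add: bij_betw_def image_algebra_def T)
  qed
  have "\<phi> (smult image_algebra r x) = smult ?T r (\<phi> x)" if "x \<in> carrier image_algebra" for r x
  proof -
    have "x \<in> ?D" using that by (simp add: image_algebra_def)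
    then obtain a where a: "a \<in> supported (lists M)" "x = ev a"
      using D[of x] by blast
    \<comment> \<open>Scalar multiplication on classes is a union over all representatives. They all
      yield the same class, so the union is that class.\<close>
    have "tensor_class M (smul r b) = tensor_class M (smul r a)" if "b \<in> tensor_class M a" for b
      using that a by (simp add: tensor_class_mem tensor_class_eq_iff supported_smul ev_linear)
    moreover have "a \<in> tensor_class M a" using a by (simp add: tensor_class_mem)
    ultimately have "(\<Union>b\<in>tensor_class M a. tensor_class M (smul r b)) = tensor_class M (smul r a)" by blast
    then show ?thesis
      using \<phi>_ev[OF supported_smul[OF a(1)], of r] a
      by (simp add: image_algebra_def T \<phi>_ev ev_linear)
  qed
  moreover have "\<phi> ` grade image_algebra n = grade ?T n" for n
  proof -
    let ?S = "pm.span {bas ms | ms. ms \<in> graded_words n}"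
    have "grade image_algebra n = ev ` ?S"
      using graded_image[of _ n] graded_span[of _ n] ev_image
      by (auto simp: image_algebra_def Let_def)
    then show ?thesis
      by (auto simp: T \<phi>_ev graded_span image_image intro!: image_cong)
  qed
  ultimately show ?thesis
    unfolding graded_algebra_isomorphic_def using iso by (intro bexI[of _ \<phi>]) auto
qed

end

section \<open>Coinvariants\<close>

locale aw_primitive = aw C \<Psi>
  for C :: "('b, 'r::comm_ring_1) coalg"
    and \<Psi> :: "('b list \<Rightarrow>\<^sub>0 'r) \<Rightarrow> (('b \<times> 'b) list \<Rightarrow>\<^sub>0 'r)" +
  fixes p :: "'b \<Rightarrow> ('b list \<Rightarrow>\<^sub>0 'r)"
  assumes primitive: "\<And>b. b \<in> L \<Longrightarrow> p b \<in> primitives C \<Psi>"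
    and homog_p: "\<And>b. b \<in> L \<Longrightarrow> homog dC (ldeg C b) (p b)"
    and leading_p: "\<And>b. b \<in> L \<Longrightarrow>
      p b - bas [b] \<in> supported {w \<in> lists L. dC w = ldeg C b \<and> 2 \<le> length w}"
begin

text \<open>The minus sign cancels the one in the value of \<open>kappa\<close> on letters, so that
  the leading term is \<open>Inr b\<close> with coefficient 1.\<close>

definition phi_letter :: "'b + 'b \<Rightarrow> (('b + 'b) list \<Rightarrow>\<^sub>0 'r)"
  where "phi_letter = case_sum (\<lambda>b. incl (p b)) (\<lambda>b. - kappa C (p b))"

definition phi :: "(('b + 'b) list \<Rightarrow>\<^sub>0 'r) \<Rightarrow> (('b + 'b) list \<Rightarrow>\<^sub>0 'r)"
  where "phi = alg_ext (*) 1 phi_letter"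

lemma is_linear_phi [linear_intros]: "is_linear f \<Longrightarrow> is_linear (\<lambda>x. phi (f x))"
  unfolding phi_def by (intro linear_intros)

lemmas phi_linear = linear_smul[OF is_linear_phi[OF is_linear_ident]]
  linear_diff[OF is_linear_phi[OF is_linear_ident]]

lemma phi_mult: "phi (x * y) = phi x * phi y"
  unfolding phi_def by (rule alg_ext_times)

lemma phi_one [simp]: "phi 1 = 1"
  by (simp add: phi_def)

lemma phi_bas_letter: "phi (bas [a]) = phi_letter a"
  by (simp add: phi_def alg_ext_bas)

text \<open>Fixing the degree bounds the possible lengths, so passing to longer words
  terminates.\<close>

definition longer :: "('b + 'b) list \<Rightarrow> ('b + 'b) list \<Rightarrow> bool"
  where "longer t s \<longleftrightarrow> t \<in> lists X \<and> dP t = dP s \<and> length s < length t"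

text \<open>Both \<open>incl\<close> and \<open>kappa\<close> preserve word length, so the words of
  length at least 2 in \<open>p b - bas [b]\<close> stay longer than a letter.\<close>

lemma leading_phi_letter:
  assumes "a \<in> X"
  shows "phi_letter a - bas [a] \<in> supported {t. longer t [a]}"
  using assms
proof
  fix b assume a: "a = Inl b" and b: "b \<in> L"
  have "lin_ext (\<lambda>w. incl (bas w)) (p b - bas [b]) \<in> supported {t. longer t [a]}"
    by (rule supported_lin_ext[OF leading_p[OF b]])
      (auto simp: incl_bas longer_def a intro!: supported_bas)
  then have "incl (p b - bas [b]) \<in> supported {t. longer t [a]}"
    by (simp only: linear_eq_lin_ext[OF is_linear_incl[OF is_linear_ident], symmetric])
  then show ?thesis
    by (simp add: a phi_letter_def linear_diff[OF is_linear_incl[OF is_linear_ident]] incl_bas)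
next
  fix b assume a: "a = Inr b" and b: "b \<in> L"
  have "lin_ext (\<lambda>w. kappa C (bas w)) (p b - bas [b]) \<in> supported {t. longer t [a]}"
  proof (rule supported_lin_ext[OF leading_p[OF b]])
    fix w assume w: "w \<in> {w \<in> lists L. dC w = ldeg C b \<and> 2 \<le> length w}"
    then show "kappa C (bas w) \<in> supported {t. longer t [a]}"
      by (intro supported_mono[OF _ kappa_word]) (auto simp: longer_def a)
  qed
  then have "- kappa C (p b - bas [b]) \<in> supported {t. longer t [a]}"
    by (intro supported_uminus) (simp only: linear_eq_lin_ext[OF is_linear_kappa[OF is_linear_ident], symmetric])
  then show ?thesis
    by (simp add: a phi_letter_def linear_diff[OF is_linear_kappa[OF is_linear_ident]] kappa_letter)
qed

lemma phi_letter_mem: "a \<in> X \<Longrightarrow> phi_letter a \<in> supported (lists X)"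
proof -
  assume a: "a \<in> X"
  have "phi_letter a - bas [a] \<in> supported (lists X)"
    by (rule supported_mono[OF _ leading_phi_letter[OF a]]) (auto simp: longer_def)
  moreover have "bas [a] \<in> supported (lists X)"
    by (rule supported_bas) (use a in simp)
  ultimately have "(phi_letter a - bas [a]) + bas [a] \<in> supported (lists X)"
    by (rule supported_add)
  then show ?thesis by simp
qed

lemma homog_phi_letter: "a \<in> X \<Longrightarrow> homog dP (ldeg (path_coalg C) a) (phi_letter a)"
proof -
  assume a: "a \<in> X"
  have "homog dP (ldeg (path_coalg C) a) (phi_letter a - bas [a])"
    unfolding homog_conv_supported
    by (rule supported_mono[OF _ leading_phi_letter[OF a]]) (auto simp: longer_def)
  then have "homog dP (ldeg (path_coalg C) a) ((phi_letter a - bas [a]) + bas [a])"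
    by (rule homog_add) simp
  then show ?thesis by simp
qed

lemma phi_mem: "x \<in> supported (lists X) \<Longrightarrow> phi x \<in> supported (lists X)"
  unfolding phi_def by (rule supported_alg_ext[OF _ phi_letter_mem])

lemma homog_phi:
  assumes "x \<in> supported (lists X)" "homog dP n x"
  shows "homog dP n (phi x)"
  unfolding linear_eq_lin_ext[OF is_linear_phi[OF is_linear_ident], of x]
proof (rule homog_lin_ext[OF assms(2)])
  fix w assume "w \<in> keys x" "dP w = n"
  then have "w \<in> lists X" using assms(1) by (auto simp: supported_def)
  then have "homog dP (dP w) (phi (bas w))"
    unfolding phi_def by (intro homog_alg_ext_word homog_phi_letter) auto
  with \<open>dP w = n\<close> show "homog dP n (phi (bas w))" by simp
qed

lemma leading_phi:
  assumes "w \<in> lists X"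
  shows "phi (bas w) - bas w \<in> supported {t. longer t w}"
  using assms
proof (induction w)
  case (Cons a w)
  have "phi_letter a * phi (bas w) - bas ([a] @ w) \<in> supported {t. longer t ([a] @ w)}"
    by (rule leading_word_mult[where R = longer, OF leading_phi_letter[OF Cons.hyps(1)] Cons.IH])
      (use Cons.hyps in \<open>auto simp: longer_def\<close>)
  then show ?case by (simp add: phi_def alg_ext_bas)
qed simp

lemma length_le_dP: "w \<in> lists X \<Longrightarrow> int (length w) \<le> dP w"
  by (induction w) (use ldeg_path_pos in fastforce)+

lemma phi_inverse:
  obtains k where "\<And>s. s \<in> lists X \<Longrightarrow> k s \<in> supported (lists X)"
    "\<And>s. s \<in> lists X \<Longrightarrow> phi (k s) = bas s"
    "\<And>s. s \<in> lists X \<Longrightarrow> lin_ext k (phi (bas s)) = bas s"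
proof -
  \<comment> \<open>Longer words have to count as smaller. At constant degree the difference of
    degree and length decreases, and \<open>length_le_dP\<close> keeps it nonnegative, so
    \<open>nat\<close> loses nothing.\<close>
  let ?\<mu> = "\<lambda>w. nat (dP w - int (length w))"
  have bij: "bij_betw (\<lambda>w. w) (lists X) (lists X)" by (simp add: bij_betw_def)
  have tri: "phi (bas s) - bas s \<in> supported {t \<in> lists X. ?\<mu> t < ?\<mu> s}" if "s \<in> lists X" for s
    by (rule supported_mono[OF _ leading_phi[OF that]]) (use length_le_dP in \<open>force simp: longer_def\<close>)
  obtain k where "\<And>s. s \<in> lists X \<Longrightarrow> k s \<in> supported (lists X)"
    "\<And>s. s \<in> lists X \<Longrightarrow> lin_ext (\<lambda>s. phi (bas s)) (k s) = bas s"
    "\<And>s. s \<in> lists X \<Longrightarrow> lin_ext k (phi (bas s)) = bas s"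
    by (rule unitriangular_inverse[where g = "\<lambda>s. phi (bas s)", OF bij tri]) blast+
  then show thesis
    by (intro that) (simp_all only: linear_eq_lin_ext[OF is_linear_phi[OF is_linear_ident], symmetric])
qed

section \<open>The adapted basis transported by \<open>phi\<close>\<close>

abbreviation ad :: "'b list \<times> 'b \<Rightarrow> (('b + 'b) list \<Rightarrow>\<^sub>0 'r)"
  where "ad \<equiv> ad_word (ldeg (path_coalg C))"

abbreviation Y :: "('b list \<times> 'b) set" where "Y \<equiv> lists L \<times> L"

definition gen :: "('b list \<times> 'b) list \<Rightarrow> 'b list \<Rightarrow> (('b + 'b) list \<Rightarrow>\<^sub>0 'r)"
  where "gen ys u = phi (prod_list (map ad ys)) * phi (bas (map Inl u))"

lemma gen_eq: "gen ys u = phi (ad_monomial (ldeg (path_coalg C)) (ys, u))"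
  by (simp add: gen_def ad_monomial_def phi_mult)

text \<open>The inverses of two unitriangular changes of basis are composed: \<open>k2\<close>
  undoes \<open>phi\<close>, then \<open>k1\<close> reads off coefficients in the adapted
  monomials.\<close>

lemma gen_inverse:
  obtains k where "\<And>s. s \<in> lists X \<Longrightarrow> k s \<in> supported (lists Y \<times> lists L)"
    "\<And>s. s \<in> lists X \<Longrightarrow> lin_ext (\<lambda>(ys, u). gen ys u) (k s) = bas s"
    "\<And>z. z \<in> lists Y \<times> lists L \<Longrightarrow> lin_ext k (case z of (ys, u) \<Rightarrow> gen ys u) = bas z"
proof -
  let ?g = "ad_monomial (ldeg (path_coalg C)) :: _ \<Rightarrow> (('b + 'b) list \<Rightarrow>\<^sub>0 'r)"
  obtain k1 where k1: "\<And>s. s \<in> lists X \<Longrightarrow> k1 s \<in> supported (lists Y \<times> lists L)"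
    "\<And>s. s \<in> lists X \<Longrightarrow> lin_ext ?g (k1 s) = bas s"
    "\<And>z. z \<in> lists Y \<times> lists L \<Longrightarrow> lin_ext k1 (?g z) = bas z"
    by (rule ad_monomial_inverse[of L L "ldeg (path_coalg C)"]) blast
  obtain k2 where k2: "\<And>s. s \<in> lists X \<Longrightarrow> k2 s \<in> supported (lists X)"
    "\<And>s. s \<in> lists X \<Longrightarrow> phi (k2 s) = bas s"
    "\<And>s. s \<in> lists X \<Longrightarrow> lin_ext k2 (phi (bas s)) = bas s"
    by (rule phi_inverse) blast
  have gen: "(\<lambda>(ys, u). gen ys u) = (\<lambda>z. phi (?g z))"
    by (simp add: fun_eq_iff gen_eq)
  show thesis
  proof
    fix s :: "('b + 'b) list" assume s: "s \<in> lists X"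
    show "lin_ext k1 (k2 s) \<in> supported (lists Y \<times> lists L)"
      by (rule supported_lin_ext[OF k2(1)[OF s] k1(1)])
    have "lin_ext (\<lambda>z. phi (?g z)) (lin_ext k1 (k2 s)) = phi (lin_ext ?g (lin_ext k1 (k2 s)))"
      by (rule linear_eqI) (auto intro!: linear_intros)
    also have "lin_ext ?g (lin_ext k1 (k2 s)) = k2 s"
      by (rule linear_eqI_supported[OF _ _ k2(1)[OF s]]) (auto intro!: linear_intros simp: k1(2))
    finally show "lin_ext (\<lambda>(ys, u). gen ys u) (lin_ext k1 (k2 s)) = bas s"
      by (simp add: gen k2(2)[OF s])
  next
    fix z :: "('b list \<times> 'b) list \<times> 'b list" assume z: "z \<in> lists Y \<times> lists L"
    have "lin_ext (\<lambda>s. lin_ext k1 (k2 s)) (phi (?g z)) = lin_ext k1 (lin_ext k2 (phi (?g z)))"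
      by (simp add: lin_ext_lin_ext)
    also have "lin_ext k2 (phi (?g z)) = ?g z"
      by (rule linear_eqI_supported[OF _ _ supported_ad_monomial[OF z]]) (auto intro!: linear_intros simp: k2(3))
    finally show "lin_ext (\<lambda>s. lin_ext k1 (k2 s)) (case z of (ys, u) \<Rightarrow> gen ys u) = bas z"
      by (simp add: k1(3)[OF z] gen_eq split: prod.splits)
  qed
qed

lemma ad_mem: "y \<in> Y \<Longrightarrow> ad y \<in> supported (lists X)"
  using supported_ad_monomial[of "([y], [])" L L "ldeg (path_coalg C)"] by (simp add: ad_monomial_def)

section \<open>The coaction on the transported basis\<close>

lemma rho_phi_Inl: "a \<in> L \<Longrightarrow> rho (phi (bas [Inl a])) = tens (phi (bas [Inl a])) 1 + tens 1 (p a)"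
  using rho_primitive(1)[OF primitive] by (simp add: phi_bas_letter phi_letter_def)

text \<open>For a coinvariant \<open>x\<close>, the cross terms in the coaction on the bracket of
  \<open>phi (bas [Inl a])\<close> with \<open>x\<close> are two multiples of
  \<open>x \<otimes> p a\<close>. The Koszul sign of the tensor product matches the sign in the
  commutator, so they cancel.\<close>

lemma rho_phi_ad:
  assumes "y \<in> Y"
  shows "rho (phi (ad y)) = tens (phi (ad y)) 1"
proof -
  have "rho (phi (ad (u, w))) = tens (phi (ad (u, w))) 1" if "u \<in> lists L" "w \<in> L" for u w
    using that(1)
  proof (induction u)
    case Nil
    show ?case
      using rho_primitive(2)[OF primitive[OF that(2)]]
      by (simp add: ad_word_def phi_bas_letter phi_letter_def rho_linear tens_uminus_left)
  next
    case (Cons a u)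
    let ?x = "phi (ad (u, w))" and ?v = "phi (bas [Inl a])"
    have x: "homog dP (dP (block (u, w))) ?x"
      using Cons.hyps that(2) by (intro homog_phi ad_mem homog_ad_word) auto
    have v: "homog dP (ldeg C a) ?v"
      using homog_phi_letter[OF InlI[OF Cons.hyps(1)]] by (simp add: phi_bas_letter)
    have pa: "homog dC (ldeg C a) (p a)" using Cons.hyps by (intro homog_p)
    have "tmult2 dP dC (tens ?v 1) (tens ?x 1) = tens (?v * ?x) 1"
      using tmult2_tens[where x = ?v and y' = 1 and dg' = dC, OF homog_one x] by simp
    moreover have "tmult2 dP dC (tens ?x 1) (tens ?v 1) = tens (?x * ?v) 1"
      using tmult2_tens[where x = ?x and y' = 1 and dg' = dC, OF homog_one v] by simp
    moreover have "tmult2 dP dC (tens 1 (p a)) (tens ?x 1)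
        = smul (ksign (ldeg C a * dP (block (u, w)))) (tens ?x (p a))"
      using tmult2_tens[where x = 1 and y' = 1, OF pa x] by simp
    moreover have "tmult2 dP dC (tens ?x 1) (tens 1 (p a)) = tens ?x (p a)"
      using tmult2_tens[where x = ?x and y' = "p a" and dg = dP and dg' = dC, OF homog_one homog_one] by simp
    ultimately show ?case
      using Cons.hyps
      by (simp add: ad_word_Cons phi_linear phi_mult rho_linear rho_mult rho_phi_Inl Cons.IH
          tmult2_add_left tmult2_add_right pm.scale_right_distrib tens_diff_left tens_smul_left)
  qed
  with assms show ?thesis by auto
qed

lemma rho_gen_Nil: "ys \<in> lists Y \<Longrightarrow> rho (gen ys []) = tens (gen ys []) 1"
proof (induction ys)
  case Nil
  show ?case by (simp add: gen_def rho_one)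
next
  case (Cons y ys)
  have "homog dP (dP (blocks (ys, []))) (gen ys [])"
    using Cons.prems unfolding gen_eq
    by (intro homog_phi homog_ad_monomial supported_ad_monomial) auto
  from tmult2_tens[where x = "phi (ad y)" and y' = 1 and dg' = dC, OF homog_one this]
  have "tmult2 dP dC (tens (phi (ad y)) 1) (tens (gen ys []) 1) = tens (phi (ad y) * gen ys []) 1"
    by simp
  moreover have "gen (y # ys) [] = phi (ad y) * gen ys []"
    by (simp add: gen_def phi_mult)
  ultimately show ?case using Cons by (simp add: rho_mult rho_phi_ad)
qed

text \<open>The linear map \<open>\<lambda>\<close> from the path-loop construction onto the subalgebra generated by the
  iterated commutators, killing the other basis elements, satisfies \<open>\<mu> (\<lambda> \<otimes> \<phi>) \<rho> = id\<close>; hence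
  \<open>x = \<lambda> x\<close> for a coinvariant \<open>x\<close>.\<close>

lemma coinvariant_in_image:
  assumes x: "x \<in> supported (lists X)" and coinv: "rho x = tens x 1"
  shows "x \<in> lin_ext (\<lambda>ys. gen ys []) ` supported (lists Y)"
proof -
  obtain k where k: "\<And>s. s \<in> lists X \<Longrightarrow> k s \<in> supported (lists Y \<times> lists L)"
    "\<And>s. s \<in> lists X \<Longrightarrow> lin_ext (\<lambda>(ys, u). gen ys u) (k s) = bas s"
    "\<And>z. z \<in> lists Y \<times> lists L \<Longrightarrow> lin_ext k (case z of (ys, u) \<Rightarrow> gen ys u) = bas z"
    by (rule gen_inverse) blast
  \<comment> \<open>Coordinates of \<open>x\<close> at the basis elements \<open>gen ys []\<close>,
    those without a trailing word in \<open>V\<close>.\<close>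
  define top :: "(('b + 'b) list \<Rightarrow>\<^sub>0 'r) \<Rightarrow> _"
    where "top x = lin_ext (\<lambda>(ys, u). if u = [] then bas ys else 0) (lin_ext k x)" for x
  define lam where "lam x = lin_ext (\<lambda>ys. gen ys []) (top x)" for x
  \<comment> \<open>The right factor lies in the cobar construction, where the coaction produces
    products of elements \<open>p a\<close>; \<open>incl\<close> sends \<open>p a\<close> to the
    value of \<open>phi\<close> on the letter \<open>Inl a\<close>.\<close>
  define S where "S = lin_ext (\<lambda>(s, t). lam (bas s) * incl (bas t))"
  have lam_linear: "is_linear (\<lambda>x. lam (f x))" if "is_linear f" for f :: "(('b + 'b) list \<Rightarrow>\<^sub>0 'r) \<Rightarrow> (('b + 'b) list \<Rightarrow>\<^sub>0 'r)"
    unfolding lam_def top_def using that by (intro linear_intros)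
  have lam_gen: "lam (gen ys u) = (if u = [] then gen ys [] else 0)" if "ys \<in> lists Y" "u \<in> lists L" for ys u
    using k(3)[of "(ys, u)"] that by (simp add: lam_def top_def lin_ext_zero)
  have S_tens: "S (tens a b) = lam a * incl b" for a b
  proof (rule linear_eqI[where x = a])
    fix s
    show "S (tens (bas s) b) = lam (bas s) * incl b"
      unfolding S_def by (rule linear_eqI[where x = b]) (auto intro!: linear_intros)
  qed (auto intro!: linear_intros lam_linear simp: S_def)
  have S_linear: "S (x + y) = S x + S y" "S (smul r x) = smul r (S x)" for x y r
    by (simp_all add: S_def lin_ext_add lin_ext_smul)
  \<comment> \<open>For the induction on \<open>u\<close> the left factor gets an arbitrary trailing
    word \<open>u0\<close> and the right factor an arbitrary homogeneous \<open>q\<close>. Each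
    letter of \<open>u\<close> either joins \<open>u0\<close>, and such terms are killed by
    \<open>lam\<close>, or joins \<open>q\<close> as \<open>p a\<close>; the one surviving term
    reassembles \<open>phi\<close> of the word.\<close>
  have S_rho: "S (tmult2 dP dC (tens (gen ys u0) q) (rho (phi (bas (map Inl u)))))
      = (if u0 = [] then gen ys [] * incl q * phi (bas (map Inl u)) else 0)"
    if "ys \<in> lists Y" "u \<in> lists L" "u0 \<in> lists L" "homog dC m q" for ys u u0 q m
    using that(2-)
  proof (induction u arbitrary: u0 q m)
    case Nil
    have "tmult2 dP dC (tens (gen ys u0) q) (tens 1 1) = tens (gen ys u0) q"
      using tmult2_tens[where x = "gen ys u0" and y' = 1 and dg = dP, OF Nil.prems(2) homog_one] by simp
    then show ?case using Nil.prems that(1) by (simp add: rho_one S_tens lam_gen)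
  next
    case (Cons a u)
    let ?v = "phi (bas [Inl a])" and ?R = "rho (phi (bas (map Inl u)))"
    have v: "homog dP (ldeg C a) ?v"
      using homog_phi_letter[OF InlI[OF Cons.hyps(1)]] by (simp add: phi_bas_letter)
    have pa: "homog dC (ldeg C a) (p a)" using Cons.hyps by (intro homog_p)
    have word: "phi (bas (map Inl (a # u))) = ?v * phi (bas (map Inl u))"
      by (simp add: bas_mult_bas flip: phi_mult)
    \<comment> \<open>Right multiplication by \<open>phi\<close> of a left letter only lengthens the
      trailing word, so the left factor remains a basis element, on which \<open>lam\<close> is
      known.\<close>
    have next_gen: "gen ys u0 * ?v = gen ys (u0 @ [a])"
      by (simp add: gen_def mult.assoc bas_mult_bas flip: phi_mult)
    have 1: "tmult2 dP dC (tens (gen ys u0) q) (tens ?v 1)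
        = smul (ksign (m * ldeg C a)) (tens (gen ys (u0 @ [a])) q)"
      using tmult2_tens[where x = "gen ys u0" and y' = 1, OF Cons.prems(2) v] by (simp add: next_gen)
    have 2: "tmult2 dP dC (tens (gen ys u0) q) (tens 1 (p a)) = tens (gen ys u0) (q * p a)"
      using tmult2_tens[where x = "gen ys u0" and y' = "p a" and dg = dP, OF Cons.prems(2) homog_one] by simp
    have "tmult2 dP dC (tens (gen ys u0) q) (rho (phi (bas (map Inl (a # u)))))
        = smul (ksign (m * ldeg C a)) (tmult2 dP dC (tens (gen ys (u0 @ [a])) q) ?R)
          + tmult2 dP dC (tens (gen ys u0) (q * p a)) ?R"
      unfolding word rho_mult rho_phi_Inl[OF Cons.hyps(1)]
      by (simp add: 1 2 tmult2_add_right tmult2_add_left tmult2_smul_left flip: tmult2_assoc)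
    moreover have "S (tmult2 dP dC (tens (gen ys (u0 @ [a])) q) ?R) = 0"
      using Cons.IH[of "u0 @ [a]" m q] Cons.prems Cons.hyps by simp
    moreover have "S (tmult2 dP dC (tens (gen ys u0) (q * p a)) ?R)
        = (if u0 = [] then gen ys [] * incl (q * p a) * phi (bas (map Inl u)) else 0)"
      by (rule Cons.IH[OF Cons.prems(1) homog_mult[OF Cons.prems(2) pa]])
    ultimately show ?case
      unfolding word by (simp add: S_linear incl_mult phi_bas_letter phi_letter_def mult.assoc)
  qed
  have id: "S (rho (gen ys u)) = gen ys u" if "ys \<in> lists Y" "u \<in> lists L" for ys u
  proof -
    have "gen ys u = gen ys [] * phi (bas (map Inl u))" by (simp add: gen_def)
    then show ?thesis
      using S_rho[OF that(1,2) _ homog_one, of "[]"] that by (simp add: rho_mult rho_gen_Nil)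
  qed
  let ?c = "lin_ext k x"
  have c: "?c \<in> supported (lists Y \<times> lists L)" by (rule supported_lin_ext[OF x k(1)])
  have x_eq: "lin_ext (\<lambda>(ys, u). gen ys u) ?c = x"
    by (rule linear_eqI_supported[OF _ _ x]) (auto intro!: linear_intros simp: k(2))
  have "S (rho (lin_ext (\<lambda>(ys, u). gen ys u) ?c)) = lin_ext (\<lambda>(ys, u). gen ys u) ?c"
  proof (rule linear_eqI_supported[OF _ _ c])
    show "is_linear (\<lambda>c. S (rho (lin_ext (\<lambda>(ys, u). gen ys u) c)))"
      unfolding S_def by (intro linear_intros)
    show "S (rho (lin_ext (\<lambda>(ys, u). gen ys u) (bas z))) = lin_ext (\<lambda>(ys, u). gen ys u) (bas z)"
      if "z \<in> lists Y \<times> lists L" for z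
      using that id by auto
  qed (rule is_linear_lin_ext)
  then have "x = lam x" by (simp add: x_eq coinv S_tens)
  moreover have "top x \<in> supported (lists Y)"
    unfolding top_def by (rule supported_lin_ext[OF c]) (auto intro!: supported_bas)
  ultimately show ?thesis unfolding lam_def by blast
qed

section \<open>The double loop as a free algebra\<close>

lemma gen_Nil_mem: "ys \<in> lists Y \<Longrightarrow> gen ys [] \<in> supported (lists X)"
  unfolding gen_eq by (intro phi_mem supported_ad_monomial) auto

lemma double_loop_image: "double_loop C \<Psi> = lin_ext (\<lambda>ys. gen ys []) ` supported (lists Y)"
proof
  have cobar: "cobar (path_coalg C) = supported (lists X)"
    by (simp add: cobar_def pbasis_path)
  show "double_loop C \<Psi> \<subseteq> lin_ext (\<lambda>ys. gen ys []) ` supported (lists Y)"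
    using coinvariant_in_image by (auto simp: double_loop_eq cobar)
  show "lin_ext (\<lambda>ys. gen ys []) ` supported (lists Y) \<subseteq> double_loop C \<Psi>"
  proof (rule image_subsetI)
    fix y :: "('b list \<times> 'b) list \<Rightarrow>\<^sub>0 'r" assume y: "y \<in> supported (lists Y)"
    have "rho (lin_ext (\<lambda>ys. gen ys []) y) = tens (lin_ext (\<lambda>ys. gen ys []) y) 1"
      by (rule linear_eqI_supported[OF _ _ y]) (auto intro!: linear_intros simp: rho_gen_Nil)
    then show "lin_ext (\<lambda>ys. gen ys []) y \<in> double_loop C \<Psi>"
      using supported_lin_ext[OF y gen_Nil_mem] by (simp add: double_loop_eq cobar)
  qed
qed

lemma gen_independent:
  assumes y: "y \<in> supported (lists Y)" and zero: "lin_ext (\<lambda>ys. gen ys []) y = 0"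
  shows "y = 0"
proof -
  obtain k where k: "\<And>z. z \<in> lists Y \<times> lists L \<Longrightarrow> lin_ext k (case z of (ys, u) \<Rightarrow> gen ys u) = bas z"
    by (rule gen_inverse) blast
  have "lin_ext (\<lambda>z. bas (fst z)) (lin_ext k (lin_ext (\<lambda>ys. gen ys []) y)) = y"
  proof (rule linear_eqI_supported[OF _ _ y])
    fix ys assume "ys \<in> lists Y"
    with k[of "(ys, [])"]
    show "lin_ext (\<lambda>z. bas (fst z)) (lin_ext k (lin_ext (\<lambda>ys. gen ys []) (bas ys))) = bas ys" by simp
  qed (intro linear_intros)+
  then show ?thesis by (simp add: zero lin_ext_zero)
qed

lemma double_loop_isomorphic:
  "graded_algebra_isomorphic (double_loop_algebra C \<Psi>)
     (tensor_algebra dP (ad_span dP (desusp_C C) (desusp_Cbar C)))"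
proof -
  have H: "prod_list (map (\<lambda>y. phi (ad y)) ys) = gen ys []" for ys
    by (induction ys) (simp_all add: gen_def phi_mult)
  \<comment> \<open>The generators are the commutators of letters, so that they span the required
    submodule, while their values in the double loop are taken through \<open>phi\<close>.\<close>
  interpret T: tensor_presentation ad Y phi "ldeg (path_coalg C)" "\<lambda>y. dP (block y)"
  proof
    show "is_linear phi" by (rule is_linear_phi[OF is_linear_ident])
    show "y = 0" if "y \<in> supported (lists Y)" "lin_ext (\<lambda>ys. prod_list (map (\<lambda>y. phi (ad y)) ys)) y = 0" for y
      using gen_independent that by (simp add: H)
    show "homog dP (dP (block y)) (ad y)" for y by (rule homog_ad_word)
    show "homog dP n (phi m)" if "m \<in> lin_ext ad ` supported Y" "homog dP n m" for n m
      using that by (intro homog_phi) (auto intro!: supported_lin_ext[OF _ ad_mem])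
  qed
  have "T.image_algebra = double_loop_algebra C \<Psi>"
    by (simp add: T.image_algebra_def double_loop_algebra_def double_loop_image T.H_def[abs_def] H)
  moreover have "T.M = ad_span dP (desusp_C C) (desusp_Cbar C)"
    by (simp add: T.M_def desusp_C_def desusp_Cbar_def ad_span_eq_image)
  ultimately show ?thesis using T.image_algebra_isomorphic by simp
qed

end

theorem theorem6p7:
  fixes C :: "('b, 'r::idom) coalg"
    and \<Psi> :: "('b list \<Rightarrow>\<^sub>0 'r) \<Rightarrow> (('b \<times> 'b) list \<Rightarrow>\<^sub>0 'r)"
  assumes R: "(2::'r) dvd 1 \<or> (CHAR('r) = 2 \<and> (\<forall>a::'r. a \<noteq> 0 \<longrightarrow> a dvd 1))"
    and AW: "AW_coalgebra C \<Psi>"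
    and conn: "\<forall>b\<in>cbasis C. cdeg C b \<noteq> 1 \<and> cdeg C b \<noteq> 2"
    and prim: "primitively_generated C \<Psi>"
  shows "graded_algebra_isomorphic
           (double_loop_algebra C \<Psi>)
           (tensor_algebra (wdeg (path_coalg C))
             (ad_span (wdeg (path_coalg C)) (desusp_C C) (desusp_Cbar C)))"
proof -
  interpret aw C \<Psi> using AW conn by unfold_locales
  have "\<forall>b\<in>L. \<exists>q. q \<in> primitives C \<Psi> \<and> homog dC (ldeg C b) q
      \<and> q - bas [b] \<in> supported {w \<in> lists L. dC w = ldeg C b \<and> 2 \<le> length w}"
    using primitive_lift[OF prim] by blast
  from bchoice[OF this] obtain p where p: "\<forall>b\<in>L. p b \<in> primitives C \<Psi> \<and> homog dC (ldeg C b) (p b)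
      \<and> p b - bas [b] \<in> supported {w \<in> lists L. dC w = ldeg C b \<and> 2 \<le> length w}"
    by blast
  interpret aw_primitive C \<Psi> p using p by unfold_locales auto
  show ?thesis by (rule double_loop_isomorphic)
qed

end
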